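(* Let $1<\delta<2$. Let $b,c,f\in C^{q,\mu}(0,1]$ for some integer $q\ge2$ and some $\mu\le2-\delta$. Let $\alpha_0,\alpha_1,\gamma_0,\gamma_1$ be real constants. Assume that $c\ge0$ on $[0,1]$, $\alpha_1\ge0$ and $\alpha_0\ge\frac1{\delta-1}$. Let $u$ be the solution of the boundary value problem $$-D_*^\delta u(x)+b(x)u'(x)+c(x)u(x)=f(x)\ \text{ for }x\in(0,1),\quad u(0)-\alpha_0u'(0)=\gamma_0,\quad u(1)+\alpha_1u'(1)=\gamma_1.$$ Then there is a constant $C$, depending on the data of the problem but independent of $N$, such that for every positive integer $N$, with $h=1/N$ and $x_j=jh$, the solution $\vec u=(u_0,u_1,\dots,u_N)^T$ of the finite difference system $A\vec u=\vec f$ described in the context satisfies $$\max_{j=0,1,\dots,N}|u(x_j)-u_j|\le Ch^{\delta-1}.$$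
   Context: Caputo derivative: for $1<\delta<2$, $D_*^\delta g = D^\delta[g-T_1[g;0]]$, where $T_1[g;0](x)=g(0)+g'(0)x$ and $D^\delta w(x)=\left(\frac{d}{dx}\right)^2\left[\frac{1}{\Gamma(2-\delta)}\int_0^x(x-t)^{1-\delta}w(t)\,dt\right]$ for $0<x\le 1$. Function spaces: for an integer $q\ge1$ and $\nu\in(-\infty,1)$, $C^{q,\nu}(0,1]$ is the set of continuous functions $y:[0,1]\to\mathbb{R}$ that are $q$ times continuously differentiable in $(0,1]$ and for which there is a constant $C$ with, for all $0<x\le1$ and $i=1,\dots,q$: $|y^{(i)}(x)|\le C$ if $i<1-\nu$; $|y^{(i)}(x)|\le C(1+|\ln x|)$ if $i=1-\nu$; $|y^{(i)}(x)|\le Cx^{1-\nu-i}$ if $i>1-\nu$. Under the stated hypotheses the boundary value problem has a unique solution $u$, with $u\in C^1[0,1]\cap C^{q+1}(0,1]$. Discretization: let $N$ be a positive integer, $h=1/N$, $x_j=jh$ for $j=0,\dots,N$; $b_j=b(x_j)$, $c_j=c(x_j)$, $f_j=f(x_j)$. For all integers $r$ set $d_r=r_+^{2-\delta}-(r-1)_+^{2-\delta}$, where $s_+=s$ if $s\ge0$ and $s_+=0$ if $s<0$ (so $d_r=0$ for $r\le0$). The $(N+1)\times(N+1)$ matrix $A=(a_{jk})_{j,k=0}^N$ is defined by its action on vectors $\vec v=(v_0,\dots,v_N)^T$: $$(A\vec v)_0=v_0-\frac{\alpha_0}{h}(v_1-v_0),\qquad (A\vec v)_N=v_N+\frac{\alpha_1}{h}(v_N-v_{N-1}),$$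 and for $j=1,\dots,N-1$ $$(A\vec v)_j=-\frac1{h^\delta\,\Gamma(3-\delta)}\sum_{k=0}^{j-1}d_{j-k}(v_{k+2}-2v_{k+1}+v_k)+b_jD^{\aleph}v_j+c_jv_j,$$ where $b_jD^{\aleph}v_j=b_j(v_{j+1}-v_j)/h$ if $b_j<0$ and $b_jD^{\aleph}v_j=b_j(v_j-v_{j-1})/h$ if $b_j\ge0$ (simple upwinding). The right-hand side is $\vec f=(\gamma_0,f_1,f_2,\dots,f_{N-1},\gamma_1)^T$. The matrix $A$ is invertible, so $\vec u$ is well defined. *)

theory Defs
  imports "HOL-Analysis.Analysis"
begin

text \<open>
  Functions on the unit interval are total functions on the reals of which only the values on
  \<open>[0,1]\<close> matter. All derivatives are taken relative to \<open>[0,1]\<close>: two-sided in the interior,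
  one-sided at the end points. At points of \<open>(0,1]\<close> the iterates do not depend on what happens
  at \<open>0\<close>, because differentiation is local; so the same operator serves for \<open>(0,1]\<close>.
\<close>

definition D01 :: "(real \<Rightarrow> real) \<Rightarrow> real \<Rightarrow> real" where
  "D01 g x = vector_derivative g (at x within {0..1})"

text \<open>The space \<open>C\<^sup>k(S)\<close>, intended for \<open>S = [0,1]\<close> and \<open>S = (0,1]\<close>.\<close>

definition Ck :: "nat \<Rightarrow> real set \<Rightarrow> (real \<Rightarrow> real) set" where
  "Ck k S = {g. (\<forall>i<k. \<forall>x\<in>S. (D01 ^^ i) g differentiable (at x within {0..1}))
               \<and> continuous_on S ((D01 ^^ k) g)}"

text \<open>The weighted space \<open>C\<^sup>q\<^sup>,\<^sup>\<nu>(0,1]\<close>, for \<open>q \<ge> 1\<close> and \<open>\<nu> < 1\<close>.\<close>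

definition Cq_weighted :: "nat \<Rightarrow> real \<Rightarrow> (real \<Rightarrow> real) set" where
  "Cq_weighted q \<nu> = {y. continuous_on {0..1} y \<and> y \<in> Ck q {0<..1} \<and>
     (\<exists>C. \<forall>x\<in>{0<..1}. \<forall>i\<in>{1..q}.
        (real i < 1 - \<nu> \<longrightarrow> \<bar>(D01 ^^ i) y x\<bar> \<le> C) \<and>
        (real i = 1 - \<nu> \<longrightarrow> \<bar>(D01 ^^ i) y x\<bar> \<le> C * (1 + \<bar>ln x\<bar>)) \<and>
        (real i > 1 - \<nu> \<longrightarrow> \<bar>(D01 ^^ i) y x\<bar> \<le> C * x powr (1 - \<nu> - real i)))}"

definition T1 :: "(real \<Rightarrow> real) \<Rightarrow> real \<Rightarrow> real" where
  "T1 g x = g 0 + D01 g 0 * x"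

text \<open>
  Riemann-Liouville and Caputo derivatives of order \<open>1 < \<delta> < 2\<close>, meaningful for \<open>0 < x \<le> 1\<close>.
  The kernel takes the value \<open>0\<close> at \<open>t = x\<close>, which does not affect the integral.
  For \<open>g \<in> C\<^sup>1[0,1] \<inter> C\<^sup>2(0,1]\<close> both derivatives of the integral exist on \<open>(0,1]\<close>.
\<close>

definition RL_deriv :: "real \<Rightarrow> (real \<Rightarrow> real) \<Rightarrow> real \<Rightarrow> real" where
  "RL_deriv \<delta> w x =
     (D01 ^^ 2) (\<lambda>y. 1 / Gamma (2 - \<delta>) * integral {0..y} (\<lambda>t. (y - t) powr (1 - \<delta>) * w t)) x"

definition caputo_deriv :: "real \<Rightarrow> (real \<Rightarrow> real) \<Rightarrow> real \<Rightarrow> real" where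
  "caputo_deriv \<delta> g = RL_deriv \<delta> (\<lambda>x. g x - T1 g x)"

definition solves_bvp ::
  "real \<Rightarrow> (real \<Rightarrow> real) \<Rightarrow> (real \<Rightarrow> real) \<Rightarrow> (real \<Rightarrow> real) \<Rightarrow>
   real \<Rightarrow> real \<Rightarrow> real \<Rightarrow> real \<Rightarrow> (real \<Rightarrow> real) \<Rightarrow> bool" where
  "solves_bvp \<delta> b c f \<alpha>0 \<alpha>1 \<gamma>0 \<gamma>1 u \<longleftrightarrow>
     (\<forall>x\<in>{0<..<1}. - caputo_deriv \<delta> u x + b x * D01 u x + c x * u x = f x) \<and>
     u 0 - \<alpha>0 * D01 u 0 = \<gamma>0 \<and>
     u 1 + \<alpha>1 * D01 u 1 = \<gamma>1"

definition mesh :: "nat \<Rightarrow> nat \<Rightarrow> real" where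
  "mesh N j = real j * (1 / real N)"

definition dcoef :: "real \<Rightarrow> int \<Rightarrow> real" where
  "dcoef \<delta> r = (max 0 (real_of_int r)) powr (2 - \<delta>) - (max 0 (real_of_int (r - 1))) powr (2 - \<delta>)"

definition upwind :: "nat \<Rightarrow> real \<Rightarrow> (nat \<Rightarrow> real) \<Rightarrow> nat \<Rightarrow> real" where
  "upwind N \<beta> v j =
     (if \<beta> < 0 then \<beta> * (v (j + 1) - v j) / (1 / real N)
      else \<beta> * (v j - v (j - 1)) / (1 / real N))"

text \<open>
  Vectors with entries indexed by \<open>0,\<dots>,N\<close> are functions on \<open>nat\<close>, entries beyond \<open>N\<close> being
  irrelevant: \<open>fd_op \<delta> b c \<alpha>0 \<alpha>1 N v j\<close> is the \<open>j\<close>-th entry of \<open>A v\<close>, for \<open>j \<le> N\<close> and \<open>N \<ge> 1\<close>,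
  and involves only \<open>v 0, \<dots>, v N\<close>.
\<close>

definition fd_op ::
  "real \<Rightarrow> (real \<Rightarrow> real) \<Rightarrow> (real \<Rightarrow> real) \<Rightarrow> real \<Rightarrow> real \<Rightarrow> nat \<Rightarrow>
   (nat \<Rightarrow> real) \<Rightarrow> nat \<Rightarrow> real" where
  "fd_op \<delta> b c \<alpha>0 \<alpha>1 N v j =
     (let h = 1 / real N in
      if j = 0 then v 0 - \<alpha>0 / h * (v 1 - v 0)
      else if j = N then v N + \<alpha>1 / h * (v N - v (N - 1))
      else - (1 / (h powr \<delta> * Gamma (3 - \<delta>)))
             * (\<Sum>k<j. dcoef \<delta> (int j - int k) * (v (k + 2) - 2 * v (k + 1) + v k))
           + upwind N (b (mesh N j)) v j
           + c (mesh N j) * v j)"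

definition fd_rhs :: "(real \<Rightarrow> real) \<Rightarrow> real \<Rightarrow> real \<Rightarrow> nat \<Rightarrow> nat \<Rightarrow> real" where
  "fd_rhs f \<gamma>0 \<gamma>1 N j = (if j = 0 then \<gamma>0 else if j = N then \<gamma>1 else f (mesh N j))"

end

theory Submission
  imports Defs
begin

text \<open>
  Put \<open>\<beta> = \<delta> - 1\<close>. The scheme is the L1 discretization of a fractional derivative of order
  \<open>\<beta>\<close>, applied to the difference quotients of the grid function. The proof is the usual one, stability plus
  consistency, but the truncation error at \<open>x\<^sub>j\<close> is only \<open>O(j\<^sup>-\<^sup>\<beta>) = O(h\<^sup>\<beta> x\<^sub>j\<^sup>-\<^sup>\<beta>)\<close>: it
  does not tend to zero near the origin, so stability must use the decay in \<open>j\<close>.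

  Stability (\<open>discrete_stability\<close>). The error equations determine the quotients \<open>z\<^sub>0, z\<^sub>1, \<dots>\<close> of the
  error \<open>e\<close> one after the other. The weights \<open>d\<^sub>r\<close> are positive and decreasing, hence the discrete
  fractional derivative is monotone in the quotients (\<open>dcaputo_le\<close>), and with \<open>c \<ge> 0\<close> and upwinding a
  comparison principle for this initial value problem follows (\<open>discrete_comparison\<close>). A supersolution that
  jumps at the beginning of blocks of fixed length (\<open>block_supersolution\<close>) dominates the lower-order terms
  whatever the sign of \<open>b\<close>; its first jump, of size \<open>h\<^sup>\<beta>\<close>, absorbs a source of size \<open>j\<^sup>-\<^sup>\<beta>\<close>.
  The boundary value problem is then treated by shooting: a positive initial slope
  \<open>z\<^sub>0\<close> raises \<open>e\<^sub>0\<close> by \<open>\<alpha>\<^sub>0 z\<^sub>0\<close>, comparison prevents \<open>e\<close> and \<open>z\<close> from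
  coming down again, and this contradicts the condition at \<open>x = 1\<close> unless \<open>z\<^sub>0 = O(h\<^sup>\<beta>)\<close>.

  Consistency (\<open>truncation_error\<close>). Let \<open>W = u' - u'(0)\<close> and \<open>g = b u' + c u - f\<close>. The differential
  equation says that \<open>I\<^sup>1\<^sup>-\<^sup>\<beta> W = I\<^sup>1 g\<close> (\<open>caputo_integral_equation\<close>), equivalently
  \<open>W = I\<^sup>\<beta> g\<close> (\<open>abel_inversion\<close>), where \<open>I\<^sup>a\<close> is the fractional integral. As \<open>g\<close> contains \<open>u'\<close>,
  this is an integral equation for \<open>u'\<close>. Comparing a solution with its dilates and applying a singular
  Gronwall inequality shows \<open>\<bar>u' x - u' t\<bar> \<le> H (x - t) x\<^sup>\<beta>\<^sup>-\<^sup>1\<close> for \<open>t \<le> x\<close> (\<open>fractional_regularity\<close>),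
  so \<open>g\<close> has the same property, and the second differences of \<open>W\<close> are bounded by
  \<open>h\<^sup>2 x\<^sup>\<beta>\<^sup>-\<^sup>2 + h\<^sup>1\<^sup>+\<^sup>\<beta> x\<^sup>\<beta>\<^sup>-\<^sup>1\<close> (\<open>second_difference_frac_int\<close>). On the
  other hand the discrete operator is the exact one, averaged over a cell, except that an increment of \<open>W\<close> from cell to cell is
  replaced by its mean; the error is a convolution of the kernel with second differences of \<open>W\<close>.
\<close>

section \<open>Elementary inequalities for powers\<close>

text \<open>
  Write \<open>x\<^sup>p - t\<^sup>p = x x\<^sup>p\<^sup>-\<^sup>1 - t t\<^sup>p\<^sup>-\<^sup>1\<close> and use that \<open>s\<^sup>p\<^sup>-\<^sup>1\<close> decreases in \<open>s\<close>.
  Besides the bound for the weights of the scheme, this is what turns a derivative bounded by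
  \<open>C x\<^sup>p\<^sup>-\<^sup>1\<close> into an increment bounded by \<open>(C/p) (x - t) x\<^sup>p\<^sup>-\<^sup>1\<close>, even for \<open>t = 0\<close>.
\<close>

lemma powr_diff_le:
  fixes p x t :: real
  assumes "0 < p" "p \<le> 1" "0 \<le> t" "t \<le> x"
  shows "x powr p - t powr p \<le> (x - t) * x powr (p - 1)"
proof (cases "t = 0")
  case True
  then show ?thesis using assms by (cases "x = 0") (simp_all add: powr_mult_base)
next
  case False
  then have t: "0 < t" "0 < x" using assms by auto
  have "t * x powr (p - 1) \<le> t * t powr (p - 1)"
    using assms t by (intro mult_left_mono powr_mono2') auto
  then show ?thesis using t by (simp add: powr_mult_base algebra_simps)
qed

lemma powr_diff_mvt:
  fixes p x t :: real
  assumes "0 \<le> t" "t < x" "0 < p"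
  shows "\<exists>\<xi>. t < \<xi> \<and> \<xi> < x \<and> x powr p - t powr p = (x - t) * (p * \<xi> powr (p - 1))"
proof -
  have "\<exists>l \<xi>. t < \<xi> \<and> \<xi> < x \<and> ((\<lambda>x. x powr p) has_real_derivative l) (at \<xi>) \<and>
      x powr p - t powr p = (x - t) * l"
  proof (rule MVT[OF assms(2)])
    show "continuous_on {t..x} (\<lambda>x. x powr p)"
      using assms by (intro continuous_on_powr') (auto intro: continuous_intros)
    show "\<And>y. t < y \<Longrightarrow> y < x \<Longrightarrow> (\<lambda>x. x powr p) differentiable (at y)"
      using assms by (auto simp: real_differentiable_def intro!: exI derivative_eq_intros)
  qed
  then obtain l \<xi> where *: "t < \<xi>" "\<xi> < x" "((\<lambda>x. x powr p) has_real_derivative l) (at \<xi>)"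
      "x powr p - t powr p = (x - t) * l" by blast
  moreover have "l = p * \<xi> powr (p - 1)"
    using * assms by (intro DERIV_unique[OF *(3)]) (auto intro!: derivative_eq_intros)
  ultimately show ?thesis by blast
qed

lemma powr_diff_ge:
  fixes p x t :: real
  assumes "0 < p" "p \<le> 1" "0 \<le> t" "t \<le> x"
  shows "p * (x - t) * x powr (p - 1) \<le> x powr p - t powr p"
proof (cases "t = x")
  case False
  then have "t < x" using assms by auto
  from powr_diff_mvt[OF assms(3) this assms(1)] obtain \<xi> where
    \<xi>: "t < \<xi>" "\<xi> < x" "x powr p - t powr p = (x - t) * (p * \<xi> powr (p - 1))" by blast
  have "x powr (p - 1) \<le> \<xi> powr (p - 1)"
    using \<xi> assms by (intro powr_mono2') auto
  then have "(p * (x - t)) * x powr (p - 1) \<le> (p * (x - t)) * \<xi> powr (p - 1)"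
    using \<open>t < x\<close> assms by (intro mult_left_mono) auto
  then show ?thesis using \<xi>(3) by (simp add: algebra_simps)
qed auto

lemma powr_diff_le_left:
  fixes p x t :: real
  assumes "0 < p" "p \<le> 1" "0 < t" "t \<le> x"
  shows "x powr p - t powr p \<le> p * (x - t) * t powr (p - 1)"
proof (cases "t = x")
  case False
  then have "t < x" "0 \<le> t" using assms by auto
  from powr_diff_mvt[OF this(2,1) assms(1)] obtain \<xi> where
    \<xi>: "t < \<xi>" "\<xi> < x" "x powr p - t powr p = (x - t) * (p * \<xi> powr (p - 1))" by blast
  have "\<xi> powr (p - 1) \<le> t powr (p - 1)"
    using \<xi> assms by (intro powr_mono2') auto
  then have "(p * (x - t)) * \<xi> powr (p - 1) \<le> (p * (x - t)) * t powr (p - 1)"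
    using \<open>t < x\<close> assms by (intro mult_left_mono) auto
  then show ?thesis using \<xi>(3) by (simp add: algebra_simps)
qed auto

section \<open>The discrete Caputo operator and its stability\<close>

text \<open>
  The weights \<open>d\<^sub>r\<close> of the scheme for \<open>r \<ge> 1\<close>, in terms of \<open>\<beta> = \<delta> - 1 \<in> (0,1)\<close>, the order of the
  fractional derivative that acts on \<open>u'\<close>.
\<close>

definition wgt :: "real \<Rightarrow> nat \<Rightarrow> real" where
  "wgt \<beta> r = real r powr (1 - \<beta>) - real (r - 1) powr (1 - \<beta>)"

lemma dcoef_eq_wgt:
  assumes "1 \<le> r" shows "dcoef \<delta> (int r) = wgt (\<delta> - 1) r"
  using assms by (simp add: dcoef_def wgt_def max_def of_nat_diff)

text \<open>
  Up to the factor \<open>h\<^sup>-\<^sup>\<beta> / \<Gamma>(2 - \<beta>)\<close> this is the classical L1 approximation of the Caputo derivative of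
  order \<open>\<beta>\<close>. The scheme applies it to the difference quotients of the grid function.
\<close>

definition dcaputo :: "real \<Rightarrow> (nat \<Rightarrow> real) \<Rightarrow> nat \<Rightarrow> real" where
  "dcaputo \<beta> z j = (\<Sum>k<j. wgt \<beta> (j - k) * (z (Suc k) - z k))"

lemma dcaputo_add: "dcaputo \<beta> (\<lambda>k. y k + z k) j = dcaputo \<beta> y j + dcaputo \<beta> z j"
  by (simp add: dcaputo_def sum.distrib[symmetric] algebra_simps)

lemma dcaputo_minus: "dcaputo \<beta> (\<lambda>k. - z k) j = - dcaputo \<beta> z j"
  by (simp add: dcaputo_def sum_negf[symmetric] algebra_simps)

lemma dcaputo_scale: "dcaputo \<beta> (\<lambda>k. a * z k) j = a * dcaputo \<beta> z j"
  by (simp add: dcaputo_def sum_distrib_left algebra_simps)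

text \<open>
  The system satisfied by the error \<open>e\<close>, multiplied by \<open>-1\<close> in the interior rows so that the fractional term
  has a positive sign. Here \<open>G\<close> stands for \<open>\<Gamma>(2 - \<beta>)\<close>, and \<open>r\<close> is the residual; \<open>R j\<^sup>-\<^sup>\<beta>\<close> is the size
  of the truncation error, which does not tend to zero near the origin.
\<close>

definition error_system ::
  "real \<Rightarrow> real \<Rightarrow> real \<Rightarrow> real \<Rightarrow> real \<Rightarrow> real \<Rightarrow> real \<Rightarrow> nat \<Rightarrow> (nat \<Rightarrow> real) \<Rightarrow> bool" where
  "error_system \<beta> G \<alpha>0 \<alpha>1 B Cc R N e \<longleftrightarrow> (\<exists>b c r :: nat \<Rightarrow> real. let z = (\<lambda>k. real N * (e (Suc k) - e k)) in
     (\<forall>j. 1 \<le> j \<longrightarrow> j < N \<longrightarrow> b j \<le> B \<and> 0 \<le> c j \<and> c j \<le> Cc \<and> \<bar>r j\<bar> \<le> R * real j powr (- \<beta>) \<and>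
        real N powr \<beta> / G * dcaputo \<beta> z j = b j * (if b j < 0 then z j else z (j - 1)) + c j * e j + r j) \<and>
     \<bar>e 0 - \<alpha>0 * z 0\<bar> \<le> R * real N powr (- \<beta>) \<and>
     \<bar>e N + \<alpha>1 * z (N - 1)\<bar> \<le> R * real N powr (- \<beta>))"

lemma error_system_minus:
  assumes "error_system \<beta> G \<alpha>0 \<alpha>1 B Cc R N e"
  shows "error_system \<beta> G \<alpha>0 \<alpha>1 B Cc R N (\<lambda>k. - e k)"
proof -
  define z where "z = (\<lambda>k. real N * (e (Suc k) - e k))"
  have z: "(\<lambda>k. real N * (- e (Suc k) - - e k)) = (\<lambda>k. - z k)"
    by (auto simp: z_def algebra_simps)
  from assms obtain b c r :: "nat \<Rightarrow> real" where
    "\<And>j. 1 \<le> j \<Longrightarrow> j < N \<Longrightarrow> b j \<le> B \<and> 0 \<le> c j \<and> c j \<le> Cc \<and> \<bar>r j\<bar> \<le> R * real j powr (- \<beta>) \<and>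
        real N powr \<beta> / G * dcaputo \<beta> z j = b j * (if b j < 0 then z j else z (j - 1)) + c j * e j + r j"
    and bc: "\<bar>e 0 - \<alpha>0 * z 0\<bar> \<le> R * real N powr (- \<beta>)"
     "\<bar>e N + \<alpha>1 * z (N - 1)\<bar> \<le> R * real N powr (- \<beta>)"
    unfolding error_system_def z_def Let_def by blast
  then have "\<forall>j. 1 \<le> j \<longrightarrow> j < N \<longrightarrow> b j \<le> B \<and> 0 \<le> c j \<and> c j \<le> Cc \<and> \<bar>- r j\<bar> \<le> R * real j powr (- \<beta>) \<and>
        real N powr \<beta> / G * dcaputo \<beta> (\<lambda>k. - z k) j
          = b j * (if b j < 0 then - z j else - z (j - 1)) + c j * (- e j) + - r j"
    unfolding dcaputo_minus by (auto simp: algebra_simps)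
  moreover have "\<bar>- e 0 - \<alpha>0 * - z 0\<bar> \<le> R * real N powr (- \<beta>)"
     "\<bar>- e N + \<alpha>1 * - z (N - 1)\<bar> \<le> R * real N powr (- \<beta>)" using bc by linarith+
  ultimately show ?thesis
    unfolding error_system_def z
    by (intro exI[of _ b] exI[of _ c] exI[of _ "\<lambda>j. - r j"]) (simp only: Let_def simp_thms)
qed

context
  fixes \<beta> :: real
  assumes \<beta>: "0 < \<beta>" "\<beta> < 1"
begin

lemma wgt_1: "wgt \<beta> (Suc 0) = 1"
  using \<beta> by (simp add: wgt_def)

lemma wgt_le: "1 \<le> r \<Longrightarrow> wgt \<beta> r \<le> real r powr (- \<beta>)"
  using powr_diff_le[of "1 - \<beta>" "real (r - 1)" "real r"] \<beta>
  by (simp add: wgt_def of_nat_diff)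

lemma wgt_ge: "1 \<le> r \<Longrightarrow> (1 - \<beta>) * real r powr (- \<beta>) \<le> wgt \<beta> r"
  using powr_diff_ge[of "1 - \<beta>" "real (r - 1)" "real r"] \<beta>
  by (simp add: wgt_def of_nat_diff)

lemma wgt_nonneg: "1 \<le> r \<Longrightarrow> 0 \<le> wgt \<beta> r"
  using wgt_ge[of r] \<beta> by (smt (verit) mult_nonneg_nonneg powr_ge_zero)

lemma wgt_antimono_Suc: "1 \<le> r \<Longrightarrow> wgt \<beta> (Suc r) \<le> wgt \<beta> r"
  using powr_diff_le_left[of "1 - \<beta>" "real r" "real (Suc r)"] \<beta> wgt_ge[of r]
  by (simp add: wgt_def)

lemma wgt_antimono: "1 \<le> r \<Longrightarrow> r \<le> s \<Longrightarrow> wgt \<beta> s \<le> wgt \<beta> r"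
proof (induction s)
  case (Suc s)
  then show ?case by (cases "r = Suc s") (auto intro: order_trans[OF wgt_antimono_Suc])
qed simp

text \<open>
  Summation by parts gives \<open>z\<^sub>j\<close> (the coefficient is \<open>d\<^sub>1 = 1\<close>) minus a combination of the earlier values
  with coefficients \<open>d\<^sub>j\<close> and \<open>d\<^sub>r - d\<^sub>r\<^sub>+\<^sub>1\<close>, all nonnegative. This monotonicity is the whole source
  of stability.
\<close>

lemma dcaputo_le:
  assumes "1 \<le> j" and pos: "\<And>k. k < j \<Longrightarrow> 0 \<le> w k"
  shows "dcaputo \<beta> w j \<le> w j"
proof -
  obtain n where n: "j = Suc n" using assms(1) by (cases j) auto
  have "dcaputo \<beta> w j = (\<Sum>k<j. wgt \<beta> (j - k) * w (Suc k)) - (\<Sum>k<j. wgt \<beta> (j - k) * w k)"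
    by (simp add: dcaputo_def right_diff_distrib sum_subtractf)
  also have "(\<Sum>k<j. wgt \<beta> (j - k) * w (Suc k)) = w j + (\<Sum>k<n. wgt \<beta> (Suc n - k) * w (Suc k))"
    by (simp add: n wgt_1)
  also have "(\<Sum>k<j. wgt \<beta> (j - k) * w k) = wgt \<beta> j * w 0 + (\<Sum>k<n. wgt \<beta> (n - k) * w (Suc k))"
    unfolding n by (subst sum.lessThan_Suc_shift) simp
  finally have "dcaputo \<beta> w j = w j - wgt \<beta> j * w 0 +
      ((\<Sum>k<n. wgt \<beta> (Suc n - k) * w (Suc k)) - (\<Sum>k<n. wgt \<beta> (n - k) * w (Suc k)))" by simp
  moreover have "(\<Sum>k<n. wgt \<beta> (Suc n - k) * w (Suc k)) \<le> (\<Sum>k<n. wgt \<beta> (n - k) * w (Suc k))"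
    by (intro sum_mono mult_right_mono wgt_antimono pos) (auto simp: n)
  moreover have "0 \<le> wgt \<beta> j * w 0"
    using wgt_nonneg[OF assms(1)] pos[of 0] assms(1) by simp
  ultimately show ?thesis by linarith
qed

lemma dcaputo_ge_jump:
  assumes "k < j" "mono Z"
  shows "wgt \<beta> (j - k) * (Z (Suc k) - Z k) \<le> dcaputo \<beta> Z j"
  unfolding dcaputo_def using assms
  by (intro member_le_sum[where f = "\<lambda>k. wgt \<beta> (j - k) * (Z (Suc k) - Z k)"])
     (auto intro!: mult_nonneg_nonneg wgt_nonneg simp: mono_def)

text \<open>
  The equation is read as an initial value problem for the difference quotients \<open>z\<close> of \<open>e\<close>: it determines
  \<open>z j\<close> from the earlier values. Let \<open>w = z + Z\<close>. If \<open>w\<close> is nonnegative before \<open>j\<close>, then the operator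
  at \<open>w\<close> is at most \<open>w j\<close>, while the equation and the supersolution property bound it from below by \<open>0\<close>
  or, where \<open>b j < 0\<close>, by \<open>b j w\<^sub>j\<close>: there upwinding makes \<open>b j z\<^sub>j\<close> an implicit term with the
  favourable sign, which is moved to the other side. The term \<open>c j e\<^sub>j\<close> only involves the past, since
  \<open>e j\<close> is \<open>e 0\<close> plus the sum of the earlier quotients; it costs \<open>2 Cc Z\<^sub>j\<^sub>-\<^sub>1\<close>.
\<close>

lemma discrete_comparison:
  fixes z e Z b c r :: "nat \<Rightarrow> real"
  assumes "0 < \<kappa>" "0 \<le> h" "h * real N \<le> 1"
    and eq: "\<And>j. 1 \<le> j \<Longrightarrow> j < N \<Longrightarrow>
        \<kappa> * dcaputo \<beta> z j = b j * (if b j < 0 then z j else z (j - 1)) + c j * e j + r j"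
    and b: "\<And>j. 1 \<le> j \<Longrightarrow> j < N \<Longrightarrow> b j \<le> B"
    and c: "\<And>j. 1 \<le> j \<Longrightarrow> j < N \<Longrightarrow> 0 \<le> c j \<and> c j \<le> Cc"
    and e: "\<And>j. e j = e 0 + h * (\<Sum>k<j. z k)"
    and B: "0 \<le> B"
    and Z: "mono Z" "0 \<le> Z 0"
    and super: "\<And>j. 1 \<le> j \<Longrightarrow> j < N \<Longrightarrow> (B + 2 * Cc) * Z (j - 1) + \<bar>r j\<bar> \<le> \<kappa> * dcaputo \<beta> Z j"
    and init: "- Z 0 \<le> z 0" "- Z 0 \<le> e 0"
  shows "j < N \<Longrightarrow> - Z j \<le> z j"
proof (induction j rule: less_induct)
  case (less j)
  have Zpos: "0 \<le> Z k" for k using Z monoD[OF Z(1), of 0 k] by simp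
  show ?case
  proof (cases "j = 0")
    case True then show ?thesis using init by simp
  next
    case False
    then have j: "1 \<le> j" "j < N" using less by auto
    define w where "w k = z k + Z k" for k
    have IH: "0 \<le> w k" if "k < j" for k
      using less.IH[OF that] that j by (simp add: w_def)
    have "dcaputo \<beta> w j \<le> w j" by (rule dcaputo_le[OF j(1) IH])
    then have 1: "\<kappa> * dcaputo \<beta> z j + \<kappa> * dcaputo \<beta> Z j \<le> \<kappa> * w j"
      using dcaputo_add[of \<beta> z Z j] \<open>0 < \<kappa>\<close> by (simp add: w_def[abs_def] distrib_left[symmetric])
    have "- (\<Sum>k<j. z k) \<le> (\<Sum>k<j. Z (j - 1))"
      unfolding sum_negf[symmetric]
    proof (rule sum_mono)
      fix k assume "k \<in> {..<j}"
      then have "k < j" "Z k \<le> Z (j - 1)" by (auto intro!: monoD[OF Z(1)])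
      then show "- z k \<le> Z (j - 1)" using IH[of k] by (simp add: w_def)
    qed
    then have "- (h * (\<Sum>k<j. z k)) \<le> h * (real j * Z (j - 1))"
      using \<open>0 \<le> h\<close> mult_left_mono[of "- (\<Sum>k<j. z k)" "real j * Z (j - 1)" h] by simp
    also have "\<dots> \<le> 1 * Z (j - 1)"
    proof -
      have "h * real j \<le> h * real N" using j \<open>0 \<le> h\<close> by (intro mult_left_mono) auto
      then have "h * real j * Z (j - 1) \<le> 1 * Z (j - 1)"
        using assms(3) Zpos by (intro mult_right_mono) auto
      then show ?thesis by simp
    qed
    finally have "- e j \<le> 2 * Z (j - 1)"
      using e[of j] init(2) monoD[OF Z(1), of 0 "j - 1"] by simp
    then have "c j * (- e j) \<le> c j * (2 * Z (j - 1))"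
      using c[OF j] by (intro mult_left_mono) auto
    also have "\<dots> \<le> Cc * (2 * Z (j - 1))"
      using c[OF j] Zpos by (intro mult_right_mono) auto
    finally have ce: "- (2 * Cc * Z (j - 1)) \<le> c j * e j" by simp
    have 2: "(B + 2 * Cc) * Z (j - 1) + \<bar>r j\<bar> +
        (b j * (if b j < 0 then z j else z (j - 1)) + c j * e j + r j) \<le> \<kappa> * w j"
      using 1 super[OF j] eq[OF j] by linarith
    have "0 \<le> w j"
    proof (cases "b j < 0")
      case True
      have "b j * z j = b j * w j - b j * Z j" by (simp add: w_def algebra_simps)
      moreover have "b j * Z j \<le> 0" using True Zpos[of j] by (simp add: mult_nonpos_nonneg)
      moreover have "0 \<le> B * Z (j - 1)" using B Zpos by simp
      ultimately have "b j * w j \<le> \<kappa> * w j"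
        using 2 ce True by (simp add: algebra_simps)
      then have "0 \<le> (\<kappa> - b j) * w j" by (simp add: algebra_simps)
      then show ?thesis using True \<open>0 < \<kappa>\<close> by (simp add: zero_le_mult_iff)
    next
      case False
      have "b j * (- z (j - 1)) \<le> b j * Z (j - 1)"
        using False IH[of "j - 1"] j by (intro mult_left_mono) (auto simp: w_def)
      also have "\<dots> \<le> B * Z (j - 1)" using b[OF j] Zpos by (intro mult_right_mono) auto
      finally have "0 \<le> \<kappa> * w j" using 2 ce False by (simp add: algebra_simps)
      then show ?thesis using \<open>0 < \<kappa>\<close> by (simp add: zero_le_mult_iff)
    qed
    then show ?thesis by (simp add: w_def)
  qed
qed

text \<open>
  A discrete substitute for the Mittag-Leffler function: a step function that is multiplied by a constant
  \<open>\<Lambda>\<close> at the beginning of every block of \<open>L\<close> mesh points. At a point of a block the jump at its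
  beginning lies at most \<open>L\<close> steps back, so it contributes at least \<open>d\<^sub>L\<close> times the jump. After
  the factor \<open>h\<^sup>-\<^sup>\<beta>\<close> this is of size \<open>(L h)\<^sup>-\<^sup>\<beta> Z\<close>, which exceeds \<open>2 M Z\<close> (half of it is for the
  source) as soon as the block length \<open>L h\<close> is a small constant \<open>l\<close>; the number of blocks, hence the growth of \<open>Z\<close>, stays bounded
  independently of \<open>N\<close>. On coarse meshes, where \<open>l N < 1\<close>, blocks of one point do, because the bound is
  needed only against the previous value and \<open>\<Lambda> - 1 \<ge> 2 M G\<close>. The very first jump, between the indices \<open>0\<close>
  and \<open>1\<close>, also absorbs the source \<open>R j\<^sup>-\<^sup>\<beta>\<close>, since \<open>d\<^sub>j\<close> is comparable with \<open>j\<^sup>-\<^sup>\<beta>\<close>; it only has to be of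
  size \<open>R h\<^sup>\<beta>\<close> for that.
\<close>

lemma block_supersolution:
  fixes M G :: real
  assumes "0 \<le> M" "0 < G"
  shows "\<exists>C\<ge>0. \<forall>N\<ge>1. \<forall>A\<ge>0. \<forall>R\<ge>0. \<exists>Z. mono Z \<and> A \<le> Z 0 \<and>
      Z N \<le> C * (A + R * real N powr (- \<beta>)) \<and>
      (\<forall>j. 1 \<le> j \<longrightarrow> j < N \<longrightarrow>
        M * Z (j - 1) + R * real j powr (- \<beta>) \<le> real N powr \<beta> / G * dcaputo \<beta> Z j)"
proof -
  define \<Lambda> where "\<Lambda> = 2 + 2 * M * G"
  \<comment> \<open>Chosen so that \<open>l\<^sup>-\<^sup>\<beta> (1 - \<beta>) / G\<close> exceeds \<open>4 M\<close>: half of it would do for the rate \<open>2 M\<close>, the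
      other half pays for \<open>\<Lambda> / (\<Lambda> - 1) \<le> 2\<close>.\<close>
  define l where "l = ((1 - \<beta>) / (G * (4 * M + 1))) powr (1 / \<beta>)"
  define c1 where "c1 = 2 * G / (1 - \<beta>)"
  define C where "C = \<Lambda> powr (2 / l + 1) * (1 + c1)"
  have \<Lambda>: "2 \<le> \<Lambda>" using assms by (simp add: \<Lambda>_def)
  have c1: "0 < c1" using assms \<beta> by (simp add: c1_def)
  have l: "0 < l" using assms \<beta> by (simp add: l_def)
  have l\<beta>: "l powr (- \<beta>) * (1 - \<beta>) / G = 4 * M + 1"
  proof -
    have "l powr \<beta> = (1 - \<beta>) / (G * (4 * M + 1))"
      using assms \<beta> by (simp add: l_def powr_powr)
    then show ?thesis using assms \<beta> by (simp add: powr_minus field_simps)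
  qed
  have C: "0 \<le> C" using c1 by (simp add: C_def)
  have "\<exists>Z. mono Z \<and> A \<le> Z 0 \<and> Z N \<le> C * (A + R * real N powr (- \<beta>)) \<and>
      (\<forall>j. 1 \<le> j \<longrightarrow> j < N \<longrightarrow>
        M * Z (j - 1) + R * real j powr (- \<beta>) \<le> real N powr \<beta> / G * dcaputo \<beta> Z j)"
    if "1 \<le> N" "0 \<le> A" "0 \<le> R" for N A R
  proof -
    \<comment> \<open>Block length about \<open>l\<close>, rounded to a positive number of mesh points.\<close>
    define L where "L = max 1 (nat \<lfloor>l * real N\<rfloor>)"
    have L1: "1 \<le> L" by (simp add: L_def)
    have L2: "l * real N \<le> 2 * real L"
      unfolding L_def by linarith
    have L3: "L = 1 \<or> real L \<le> l * real N"
    proof -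
      have "0 \<le> l * real N" using l by simp
      then have "real (nat \<lfloor>l * real N\<rfloor>) \<le> l * real N" by (rule of_nat_floor)
      then show ?thesis unfolding L_def by (auto simp: max_def)
    qed
    define m where "m k = (k + L - 1) div L" for k
    define Y where "Y k = \<Lambda> ^ m k" for k
    define K where "K = A + c1 * (R * real N powr (- \<beta>))"
    have K: "0 \<le> K" using that c1 by (simp add: K_def)
    have mono_m: "mono m" unfolding m_def by (intro monoI div_le_mono) auto
    have "mono Y" unfolding Y_def
      using \<Lambda> by (intro monoI power_increasing monoD[OF mono_m]) auto
    have Y0: "Y 0 = 1" using L1 by (simp add: Y_def m_def)
    have Ypos: "0 \<le> Y k" for k using \<Lambda> by (simp add: Y_def)
    have Y1: "Y (Suc 0) = \<Lambda>" using L1 by (simp add: Y_def m_def)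
    have "Y N \<le> \<Lambda> powr (2 / l + 1)"
    proof -
      have "real (m N) \<le> real (N + L - 1) / real L"
        unfolding m_def by (rule of_nat_div_le_of_nat)
      also have "\<dots> \<le> real N / real L + 1"
        using L1 by (simp add: field_simps)
      also have "real N / real L \<le> 2 / l"
        using L1 L2 l by (simp add: field_simps)
      finally have "\<Lambda> powr real (m N) \<le> \<Lambda> powr (2 / l + 1)"
        using \<Lambda> by (intro powr_mono) auto
      then show ?thesis using \<Lambda> by (simp add: Y_def powr_realpow)
    qed
    then have "K * Y N \<le> (A + c1 * (R * real N powr (- \<beta>))) * \<Lambda> powr (2 / l + 1)"
      unfolding K_def[symmetric] using K by (intro mult_left_mono)
    also have "\<dots> \<le> (1 + c1) * (A + R * real N powr (- \<beta>)) * \<Lambda> powr (2 / l + 1)"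
      using that c1 by (intro mult_right_mono) (auto simp: algebra_simps)
    finally have final: "K * Y N \<le> C * (A + R * real N powr (- \<beta>))" by (simp add: C_def mult_ac)
    have N: "1 \<le> real N powr \<beta>" using that \<beta> by (simp add: ge_one_powr_ge_zero)
    then have N0: "real N powr \<beta> \<noteq> 0" by linarith
    have super: "M * (K * Y (j - 1)) + R * real j powr (- \<beta>)
        \<le> real N powr \<beta> / G * dcaputo \<beta> (\<lambda>k. K * Y k) j" if j: "1 \<le> j" "j < N" for j
    proof -
      define q where "q = (j - 1) div L"
      define k where "k = q * L"
      have k: "k \<le> j - 1" by (simp add: k_def q_def)
      have jk: "1 \<le> j - k" "j - k \<le> L" "k < j"
      proof -
        have "j - 1 = k + (j - 1) mod L" by (simp add: k_def q_def)
        moreover have "(j - 1) mod L < L" using L1 by simp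
        ultimately show "j - k \<le> L" by linarith
        show "1 \<le> j - k" "k < j" using k j by linarith+
      qed
      have mk: "m k = q" "m (Suc k) = Suc q"
      proof -
        have "m k = (L - 1 + q * L) div L" using L1 by (simp add: m_def k_def algebra_simps)
        also have "\<dots> = q" using L1 by (subst div_mult_self1) auto
        finally show "m k = q" .
        have "m (Suc k) = (0 + Suc q * L) div L" using L1 by (simp add: m_def k_def)
        also have "\<dots> = Suc q" using L1 by (subst div_mult_self1) auto
        finally show "m (Suc k) = Suc q" .
      qed
      have mj: "m (j - 1) \<le> Suc q" "L = 1 \<Longrightarrow> m (j - 1) = q"
      proof -
        have "m (j - 1) \<le> (j - 1 + 1 * L) div L" unfolding m_def by (intro div_le_mono) simp
        also have "\<dots> = Suc q" using L1 by (subst div_mult_self1) (auto simp: q_def)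
        finally show "m (j - 1) \<le> Suc q" .
        show "L = 1 \<Longrightarrow> m (j - 1) = q" by (simp add: m_def q_def)
      qed
      have jump: "wgt \<beta> (j - k) * ((\<Lambda> - 1) * \<Lambda> ^ q) \<le> dcaputo \<beta> Y j"
        using dcaputo_ge_jump[OF jk(3) \<open>mono Y\<close>] mk by (simp add: Y_def algebra_simps)
      have 1: "2 * M * Y (j - 1) \<le> real N powr \<beta> / G * dcaputo \<beta> Y j"
      proof (cases "L = 1")
        case True
        then have "j - k = Suc 0" using jk by simp
        then have "(\<Lambda> - 1) * \<Lambda> ^ q \<le> dcaputo \<beta> Y j" using jump wgt_1 by simp
        moreover have "2 * M * G \<le> \<Lambda> - 1" by (simp add: \<Lambda>_def)
        then have "2 * M * G * \<Lambda> ^ q \<le> (\<Lambda> - 1) * \<Lambda> ^ q" using \<Lambda> by (intro mult_right_mono) auto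
        ultimately have 2: "2 * M * G * Y (j - 1) \<le> dcaputo \<beta> Y j"
          using mj(2)[OF True] by (simp add: Y_def)
        moreover have "0 \<le> 2 * M * G * Y (j - 1)" using assms Ypos by simp
        ultimately have "1 * (2 * M * G * Y (j - 1)) \<le> real N powr \<beta> * dcaputo \<beta> Y j"
          using N by (intro mult_mono) auto
        then show ?thesis using assms by (simp add: field_simps)
      next
        case False
        then have L: "real L \<le> l * real N" using L3 by simp
        have "(l * real N) powr (- \<beta>) \<le> real L powr (- \<beta>)"
          using L L1 \<beta> by (intro powr_mono2') auto
        then have "(1 - \<beta>) * (l powr (- \<beta>) * real N powr (- \<beta>)) \<le> (1 - \<beta>) * real L powr (- \<beta>)"
          using l \<beta> by (simp add: powr_mult)
        also have "\<dots> \<le> wgt \<beta> L" by (rule wgt_ge[OF L1])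
        also have "\<dots> \<le> wgt \<beta> (j - k)" by (rule wgt_antimono[OF jk(1,2)])
        finally have "real N powr \<beta> / G * ((1 - \<beta>) * (l powr (- \<beta>) * real N powr (- \<beta>)))
            \<le> real N powr \<beta> / G * wgt \<beta> (j - k)"
          using assms by (intro mult_left_mono) auto
        also have "real N powr \<beta> / G * ((1 - \<beta>) * (l powr (- \<beta>) * real N powr (- \<beta>)))
            = l powr (- \<beta>) * (1 - \<beta>) / G"
          using N0 by (simp add: powr_minus divide_simps)
        finally have 2: "4 * M \<le> real N powr \<beta> / G * wgt \<beta> (j - k)" using l\<beta> by simp
        have "2 * M * Y (j - 1) \<le> 2 * M * (\<Lambda> * \<Lambda> ^ q)"
          using mj(1) \<Lambda> assms power_increasing[of "m (j - 1)" "Suc q" \<Lambda>]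
          by (intro mult_left_mono) (auto simp: Y_def)
        also have "\<dots> \<le> 2 * M * ((2 * (\<Lambda> - 1)) * \<Lambda> ^ q)"
          using \<Lambda> assms by (intro mult_left_mono mult_right_mono) auto
        also have "\<dots> = 4 * M * ((\<Lambda> - 1) * \<Lambda> ^ q)" by simp
        also have "\<dots> \<le> real N powr \<beta> / G * wgt \<beta> (j - k) * ((\<Lambda> - 1) * \<Lambda> ^ q)"
          using \<Lambda> by (intro mult_right_mono 2) auto
        also have "\<dots> = real N powr \<beta> / G * (wgt \<beta> (j - k) * ((\<Lambda> - 1) * \<Lambda> ^ q))" by simp
        also have "\<dots> \<le> real N powr \<beta> / G * dcaputo \<beta> Y j"
          using assms by (intro mult_left_mono jump) auto
        finally show ?thesis .
      qed
      have 2: "2 * (R * real j powr (- \<beta>)) \<le> real N powr \<beta> / G * (K * dcaputo \<beta> Y j)"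
      proof -
        have "(1 - \<beta>) * real j powr (- \<beta>) * 1 \<le> wgt \<beta> j * (Y (Suc 0) - Y 0)"
          using \<Lambda> wgt_ge[OF j(1)] wgt_nonneg[OF j(1)] by (intro mult_mono) (auto simp: Y0 Y1)
        also have "\<dots> \<le> dcaputo \<beta> Y j" using dcaputo_ge_jump[of 0 j, OF _ \<open>mono Y\<close>] j by simp
        finally have "real N powr \<beta> / G * ((c1 * (R * real N powr (- \<beta>))) * ((1 - \<beta>) * real j powr (- \<beta>)))
            \<le> real N powr \<beta> / G * (K * dcaputo \<beta> Y j)"
          using assms that \<beta> c1 \<open>0 \<le> A\<close> \<open>0 \<le> R\<close> by (intro mult_left_mono mult_mono) (auto simp: K_def)
        moreover have "real N powr \<beta> / G * ((c1 * (R * real N powr (- \<beta>))) * ((1 - \<beta>) * real j powr (- \<beta>)))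
            = 2 * (R * real j powr (- \<beta>))"
          using N0 assms \<beta> by (simp add: powr_minus c1_def divide_simps)
        ultimately show ?thesis by simp
      qed
      have "K * (2 * M * Y (j - 1)) \<le> K * (real N powr \<beta> / G * dcaputo \<beta> Y j)"
        by (rule mult_left_mono[OF 1 K])
      then show ?thesis using 2 by (simp add: dcaputo_scale algebra_simps)
    qed
    show ?thesis
    proof (intro exI[of _ "\<lambda>k. K * Y k"] conjI allI impI)
      show "mono (\<lambda>k. K * Y k)" using \<open>mono Y\<close> K by (auto simp: mono_def intro: mult_left_mono)
      show "A \<le> K * Y 0" using that c1 by (simp add: Y0 K_def)
    qed (use final super in auto)
  qed
  then show ?thesis using C by blast
qed

lemma error_lower_bound:
  assumes sys: "error_system \<beta> G \<alpha>0 \<alpha>1 B Cc R N e" and "1 \<le> N" "0 < G" "0 \<le> B"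
    and Z: "mono Z" "A \<le> Z 0" "0 \<le> A"
     "\<forall>j. 1 \<le> j \<longrightarrow> j < N \<longrightarrow>
        (B + 2 * Cc) * Z (j - 1) + R * real j powr (- \<beta>) \<le> real N powr \<beta> / G * dcaputo \<beta> Z j"
    and init: "- A \<le> real N * (e (Suc 0) - e 0)" "- A \<le> e 0" and "j < N"
  shows "- Z j \<le> real N * (e (Suc j) - e j)"
proof -
  define z where "z = (\<lambda>k. real N * (e (Suc k) - e k))"
  from sys obtain b c r :: "nat \<Rightarrow> real" where
    bcr: "\<And>j. 1 \<le> j \<Longrightarrow> j < N \<Longrightarrow> b j \<le> B \<and> 0 \<le> c j \<and> c j \<le> Cc \<and> \<bar>r j\<bar> \<le> R * real j powr (- \<beta>) \<and>
        real N powr \<beta> / G * dcaputo \<beta> z j = b j * (if b j < 0 then z j else z (j - 1)) + c j * e j + r j"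
    unfolding error_system_def z_def Let_def by blast
  have "- Z j \<le> z j"
  proof (rule discrete_comparison[where N = N and h = "1 / real N" and \<kappa> = "real N powr \<beta> / G" and b = b and c = c
        and r = r and e = e and B = B and Cc = Cc])
    show "\<And>j. e j = e 0 + 1 / real N * sum z {..<j}"
      using \<open>1 \<le> N\<close> by (simp add: z_def sum_distrib_left[symmetric] sum_lessThan_telescope)
    show "(B + 2 * Cc) * Z (j - 1) + \<bar>r j\<bar> \<le> real N powr \<beta> / G * dcaputo \<beta> Z j"
      if "1 \<le> j" "j < N" for j using Z(4) bcr[OF that] that by force
  qed (use assms bcr in \<open>auto simp: z_def\<close>)
  then show ?thesis by (simp add: z_def)
qed

text \<open>
  A shooting argument. The error is controlled by the initial slope \<open>z 0\<close> through the comparison principle,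
  and the slope by the boundary conditions: if \<open>z 0 \<ge> 0\<close>, then \<open>z\<close> stays above a quantity of order \<open>- h\<^sup>\<beta>\<close>, so
  that \<open>e\<close> can fall below \<open>e 0 = \<alpha>0 z 0 + O(h\<^sup>\<beta>)\<close> only by \<open>O(h\<^sup>\<beta>)\<close>. But the condition at the right end
  forces \<open>e N \<le> O(h\<^sup>\<beta>)\<close>, whence \<open>\<alpha>0 z 0 = O(h\<^sup>\<beta>)\<close>. The negative case is the same for \<open>- e\<close>. With \<open>z 0\<close>
  and \<open>e 0\<close> of order \<open>h\<^sup>\<beta>\<close>, comparison from both sides bounds all of \<open>e\<close>.
\<close>

lemma discrete_stability:
  assumes "0 < \<alpha>0" "0 \<le> \<alpha>1" "0 \<le> B" "0 \<le> Cc" "0 \<le> R" "0 < G"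
  shows "\<exists>C. \<forall>N\<ge>1. \<forall>e. error_system \<beta> G \<alpha>0 \<alpha>1 B Cc R N e \<longrightarrow> (\<forall>j\<le>N. \<bar>e j\<bar> \<le> C * real N powr (- \<beta>))"
proof -
  from block_supersolution[of "B + 2 * Cc" G] assms obtain C0 where C0: "0 \<le> C0" and
    super: "\<And>N A R. 1 \<le> N \<Longrightarrow> 0 \<le> A \<Longrightarrow> 0 \<le> R \<Longrightarrow> \<exists>Z. mono Z \<and> A \<le> Z 0 \<and>
      Z N \<le> C0 * (A + R * real N powr (- \<beta>)) \<and> (\<forall>j. 1 \<le> j \<longrightarrow> j < N \<longrightarrow>
        (B + 2 * Cc) * Z (j - 1) + R * real j powr (- \<beta>) \<le> real N powr \<beta> / G * dcaputo \<beta> Z j)"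
    by auto
  define T where "T = (2 * R + (1 + \<alpha>1) * (C0 * (2 * R))) / \<alpha>0"
  have T: "0 \<le> T" using assms C0 by (simp add: T_def)
  have \<alpha>T: "\<alpha>0 * T = 2 * R + (1 + \<alpha>1) * (C0 * (2 * R))" using assms(1) by (simp add: T_def)
  define A1 where "A1 = T + R + \<alpha>0 * T"
  define C where "C = A1 + C0 * (A1 + R)"
  have A1: "0 \<le> A1" using assms T by (simp add: A1_def)
  have tele: "e j = e 0 + (\<Sum>k<j. real N * (e (Suc k) - e k)) / real N" if "1 \<le> N" for e :: "nat \<Rightarrow> real" and j N
    using that by (simp add: sum_distrib_left[symmetric] sum_lessThan_telescope)
  have sum_le: "(\<Sum>k<j. y k) / real N \<le> S"
    if "1 \<le> N" "j \<le> N" "\<And>k. k < j \<Longrightarrow> y k \<le> S" "0 \<le> S" for y :: "nat \<Rightarrow> real" and S j N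
  proof -
    have "(\<Sum>k<j. y k) \<le> (\<Sum>k<j. S)" using that by (intro sum_mono) auto
    also have "\<dots> \<le> real N * S" using that by (auto intro: mult_right_mono)
    finally show ?thesis using that by (simp add: field_simps)
  qed
  \<comment> \<open>The slope at the left end is bounded from above; the lower bound will follow by symmetry.\<close>
  have shoot: "real N * (e (Suc 0) - e 0) \<le> T * real N powr (- \<beta>)"
    if N: "1 \<le> N" and sys: "error_system \<beta> G \<alpha>0 \<alpha>1 B Cc R N e" for N e
  proof (cases "0 \<le> real N * (e (Suc 0) - e 0)")
    case False
    moreover have "0 \<le> T * real N powr (- \<beta>)" using T by simp
    ultimately show ?thesis by linarith
  next
    case True
    define \<epsilon> where "\<epsilon> = real N powr (- \<beta>)"
    define z where "z = (\<lambda>k. real N * (e (Suc k) - e k))"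
    have \<epsilon>: "0 \<le> \<epsilon>" by (simp add: \<epsilon>_def)
    have "0 \<le> R * \<epsilon>" using assms \<epsilon> by simp
    from super[OF N this \<open>0 \<le> R\<close>, folded \<epsilon>_def]
    obtain Z where Z: "mono Z" "R * \<epsilon> \<le> Z 0" "Z N \<le> C0 * (R * \<epsilon> + R * \<epsilon>)"
      "\<forall>j. 1 \<le> j \<longrightarrow> j < N \<longrightarrow>
        (B + 2 * Cc) * Z (j - 1) + R * real j powr (- \<beta>) \<le> real N powr \<beta> / G * dcaputo \<beta> Z j"
      by blast
    have bc: "\<bar>e 0 - \<alpha>0 * z 0\<bar> \<le> R * \<epsilon>" "\<bar>e N + \<alpha>1 * z (N - 1)\<bar> \<le> R * \<epsilon>"
      using sys unfolding error_system_def z_def Let_def \<epsilon>_def by blast+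
    have z0: "0 \<le> z 0" using True by (simp add: z_def)
    have e0: "- (R * \<epsilon>) \<le> e 0"
      using bc(1) mult_nonneg_nonneg[of \<alpha>0 "z 0"] z0 assms(1) by linarith
    define S where "S = C0 * (R * \<epsilon> + R * \<epsilon>)"
    have S: "0 \<le> S" using C0 assms \<epsilon> by (simp add: S_def)
    have "- Z j \<le> z j" if "j < N" for j
      unfolding z_def
      by (rule error_lower_bound[OF sys N \<open>0 < G\<close> \<open>0 \<le> B\<close> Z(1,2) _ Z(4) _ e0 that])
         (use z0 assms \<epsilon> in \<open>auto simp: z_def intro: order_trans[of _ 0]\<close>)
    moreover have "Z j \<le> S" if "j < N" for j
      using Z(3) monoD[OF Z(1), of j N] that by (simp add: S_def)
    ultimately have zS: "- z j \<le> S" if "j < N" for j using that by (metis minus_le_iff order_trans)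
    have "(\<Sum>k<N. - z k) / real N \<le> S" by (rule sum_le) (use N zS S in auto)
    then have "e 0 - S \<le> e N" using tele[OF N, of e N] by (simp add: z_def sum_negf)
    moreover have "- (\<alpha>1 * z (N - 1)) \<le> \<alpha>1 * S"
      using mult_left_mono[OF zS[of "N - 1"] assms(2)] N by simp
    ultimately have "\<alpha>0 * z 0 \<le> 2 * (R * \<epsilon>) + S + \<alpha>1 * S" using bc by linarith
    also have "\<dots> = (\<alpha>0 * T) * \<epsilon>" unfolding \<alpha>T S_def by algebra
    finally have "\<alpha>0 * z 0 \<le> \<alpha>0 * (T * \<epsilon>)" by (simp only: mult.assoc)
    then have "z 0 \<le> T * \<epsilon>" using assms(1) by (rule mult_left_le_imp_le)
    then show ?thesis unfolding z_def \<epsilon>_def .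
  qed
  have main: "\<bar>e j\<bar> \<le> C * real N powr (- \<beta>)"
    if N: "1 \<le> N" and sys: "error_system \<beta> G \<alpha>0 \<alpha>1 B Cc R N e" and "j \<le> N" for N e j
  proof -
    define \<epsilon> where "\<epsilon> = real N powr (- \<beta>)"
    define z where "z = (\<lambda>k. real N * (e (Suc k) - e k))"
    have \<epsilon>: "0 \<le> \<epsilon>" by (simp add: \<epsilon>_def)
    have sys': "error_system \<beta> G \<alpha>0 \<alpha>1 B Cc R N (\<lambda>k. - e k)" by (rule error_system_minus[OF sys])
    have neg: "real N * (- e (Suc k) - - e k) = - z k" for k by (simp add: z_def algebra_simps)
    have z0: "\<bar>z 0\<bar> \<le> T * \<epsilon>"
      using shoot[OF N sys, folded \<epsilon>_def] shoot[OF N sys', folded \<epsilon>_def, unfolded neg]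
      unfolding abs_le_iff z_def by blast
    have "\<bar>e 0 - \<alpha>0 * z 0\<bar> \<le> R * \<epsilon>"
      using sys unfolding error_system_def z_def Let_def \<epsilon>_def by blast
    moreover have "\<bar>\<alpha>0 * z 0\<bar> \<le> \<alpha>0 * (T * \<epsilon>)"
      using z0 assms(1) by (simp add: abs_mult)
    ultimately have e0': "\<bar>e 0\<bar> \<le> R * \<epsilon> + \<alpha>0 * (T * \<epsilon>)" by linarith
    have "0 \<le> T * \<epsilon>" "0 \<le> R * \<epsilon> + \<alpha>0 * (T * \<epsilon>)" using assms T \<epsilon> by simp_all
    then have e0: "\<bar>e 0\<bar> \<le> A1 * \<epsilon>" and z0': "\<bar>z 0\<bar> \<le> A1 * \<epsilon>"
      using z0 e0' by (simp_all add: A1_def algebra_simps)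
    have A: "0 \<le> A1 * \<epsilon>" using A1 \<epsilon> by simp
    from super[OF N A \<open>0 \<le> R\<close>, folded \<epsilon>_def]
    obtain Z where Z: "mono Z" "A1 * \<epsilon> \<le> Z 0" "Z N \<le> C0 * (A1 * \<epsilon> + R * \<epsilon>)"
      "\<forall>j. 1 \<le> j \<longrightarrow> j < N \<longrightarrow>
        (B + 2 * Cc) * Z (j - 1) + R * real j powr (- \<beta>) \<le> real N powr \<beta> / G * dcaputo \<beta> Z j"
      by blast
    define S where "S = C0 * (A1 * \<epsilon> + R * \<epsilon>)"
    have S: "0 \<le> S" using C0 assms \<epsilon> A1 by (simp add: S_def)
    have init: "- (A1 * \<epsilon>) \<le> real N * (e (Suc 0) - e 0)" "- (A1 * \<epsilon>) \<le> e 0"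
      "- (A1 * \<epsilon>) \<le> real N * (- e (Suc 0) - - e 0)" "- (A1 * \<epsilon>) \<le> - e 0"
      unfolding neg using z0' e0 unfolding abs_le_iff z_def by linarith+
    have "- Z k \<le> z k" if "k < N" for k
      unfolding z_def
      by (rule error_lower_bound[OF sys N \<open>0 < G\<close> \<open>0 \<le> B\<close> Z(1,2) A Z(4) init(1,2) that])
    moreover have Z': "- Z k \<le> - z k" if "k < N" for k
      unfolding neg[symmetric]
      by (rule error_lower_bound[OF sys' N \<open>0 < G\<close> \<open>0 \<le> B\<close> Z(1,2) A Z(4) init(3,4) that])
    have "z k \<le> Z k" if "k < N" for k using Z'[OF that] by simp
    moreover have "Z k \<le> S" if "k < N" for k
      using Z(3) monoD[OF Z(1), of k N] that by (simp add: S_def)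
    ultimately have zS: "z k \<le> S" "- z k \<le> S" if "k < N" for k
      unfolding atomize_conj using that by (metis minus_le_iff order_trans)
    have "(\<Sum>k<j. - z k) / real N \<le> S" by (rule sum_le) (use N zS S \<open>j \<le> N\<close> in auto)
    moreover have "(\<Sum>k<j. z k) / real N \<le> S" by (rule sum_le) (use N zS S \<open>j \<le> N\<close> in auto)
    ultimately have "\<bar>e j\<bar> \<le> \<bar>e 0\<bar> + S"
      using tele[OF N, of e j] unfolding z_def by (simp add: sum_negf)
    also have "\<dots> \<le> A1 * \<epsilon> + C0 * (A1 * \<epsilon> + R * \<epsilon>)" using e0 unfolding S_def by simp
    also have "\<dots> = C * \<epsilon>" unfolding C_def by algebra
    finally show ?thesis unfolding \<epsilon>_def .
  qed
  show ?thesis using main by blast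
qed

end

section \<open>Fractional integrals\<close>

lemma continuous_on_bounded:
  fixes \<phi> :: "real \<Rightarrow> real"
  assumes "continuous_on {a..b} \<phi>"
  obtains M where "0 \<le> M" "\<And>t. t \<in> {a..b} \<Longrightarrow> \<bar>\<phi> t\<bar> \<le> M"
proof -
  have "bounded (\<phi> ` {a..b})"
    using assms by (intro compact_imp_bounded compact_continuous_image) auto
  then obtain M where "\<forall>x\<in>\<phi> ` {a..b}. norm x \<le> M" unfolding bounded_iff by blast
  then show ?thesis by (intro that[of "max 0 M"]) (auto simp: max_def)
qed

lemma Gamma_add_1: "0 < a \<Longrightarrow> Gamma (a + 1) = a * Gamma (a :: real)"
  using Gamma_plus1[of a] nonpos_Ints_nonpos[of a] by force

text \<open>
  The Riemann--Liouville integral \<open>I\<^sup>a\<close>. The kernel takes the harmless value \<open>0\<close> at \<open>t = x\<close>.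
\<close>

definition frac_int :: "real \<Rightarrow> (real \<Rightarrow> real) \<Rightarrow> real \<Rightarrow> real" where
  "frac_int a \<phi> x = integral {0..x} (\<lambda>t. (x - t) powr (a - 1) * \<phi> t) / Gamma a"

lemma kernel_has_integral:
  fixes a c d x :: real
  assumes "0 < a" "c \<le> d" "d \<le> x"
  shows "((\<lambda>t. (x - t) powr (a - 1)) has_integral ((x - c) powr a - (x - d) powr a) / a) {c..d}"
proof -
  have "((\<lambda>t. (x - t) powr (a - 1)) has_integral (- ((x - d) powr a / a) - - ((x - c) powr a / a))) {c..d}"
  proof (rule fundamental_theorem_of_calculus_interior[OF assms(2)])
    show "continuous_on {c..d} (\<lambda>t. - ((x - t) powr a / a))"
      using assms by (intro continuous_intros continuous_on_powr') auto
    fix t assume "t \<in> {c<..<d}"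
    then have "((\<lambda>t. - ((x - t) powr a / a)) has_real_derivative (x - t) powr (a - 1)) (at t)"
      using assms by (auto intro!: derivative_eq_intros)
    then show "((\<lambda>t. - ((x - t) powr a / a)) has_vector_derivative (x - t) powr (a - 1)) (at t)"
      by (simp add: has_real_derivative_iff_has_vector_derivative)
  qed
  then show ?thesis by (simp add: diff_divide_distrib)
qed

lemma kernel_abs_integrable:
  fixes a c d x :: real
  assumes "0 < a" "d \<le> x" "continuous_on {c..d} \<phi>"
  shows "(\<lambda>t. (x - t) powr (a - 1) * \<phi> t) absolutely_integrable_on {c..d}"
proof (cases "c \<le> d")
  case True
  have "(\<lambda>t. \<phi> t * (x - t) powr (a - 1)) absolutely_integrable_on {c..d}"
  proof (rule absolutely_integrable_bounded_measurable_product_real)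
    show "\<phi> \<in> borel_measurable (lebesgue_on {c..d})"
      by (rule continuous_imp_measurable_on_sets_lebesgue[OF assms(3)]) auto
    show "bounded (\<phi> ` {c..d})"
      using assms(3) by (intro compact_imp_bounded compact_continuous_image) auto
    show "(\<lambda>t. (x - t) powr (a - 1)) absolutely_integrable_on {c..d}"
      using kernel_has_integral[OF assms(1) True assms(2)]
      by (intro nonnegative_absolutely_integrable_1) (auto simp: integrable_on_def)
  qed auto
  then show ?thesis by (simp add: mult.commute)
qed auto

lemma kernel_integrable:
  fixes a c d x :: real
  assumes "0 < a" "d \<le> x" "continuous_on {c..d} \<phi>"
  shows "(\<lambda>t. (x - t) powr (a - 1) * \<phi> t) integrable_on {c..d}"
  using kernel_abs_integrable[OF assms] by (simp add: absolutely_integrable_on_def)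

lemma kernel_bound:
  fixes a c d x M :: real
  assumes "0 < a" "c \<le> d" "d \<le> x" "continuous_on {c..d} \<phi>" "\<And>t. t \<in> {c..d} \<Longrightarrow> \<bar>\<phi> t\<bar> \<le> M"
  shows "\<bar>integral {c..d} (\<lambda>t. (x - t) powr (a - 1) * \<phi> t)\<bar> \<le> M * (((x - c) powr a - (x - d) powr a) / a)"
proof -
  have K: "((\<lambda>t. (x - t) powr (a - 1) * M) has_integral ((x - c) powr a - (x - d) powr a) / a * M) {c..d}"
    by (intro has_integral_mult_left kernel_has_integral assms)
  have "norm (integral {c..d} (\<lambda>t. (x - t) powr (a - 1) * \<phi> t)) \<le>
        integral {c..d} (\<lambda>t. (x - t) powr (a - 1) * M)"
    using K assms
    by (intro integral_norm_bound_integral kernel_integrable)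
       (auto simp: integrable_on_def abs_mult intro!: mult_left_mono)
  then show ?thesis using integral_unique[OF K] by (simp add: mult.commute)
qed

lemma frac_int_bound:
  assumes "0 < a" "0 \<le> x" "continuous_on {0..x} \<phi>" "\<And>t. t \<in> {0..x} \<Longrightarrow> \<bar>\<phi> t\<bar> \<le> M"
  shows "\<bar>frac_int a \<phi> x\<bar> \<le> M * x powr a / Gamma (a + 1)"
proof -
  have "\<bar>integral {0..x} (\<lambda>t. (x - t) powr (a - 1) * \<phi> t)\<bar> / Gamma a \<le> (M * (x powr a / a)) / Gamma a"
    using kernel_bound[OF assms(1,2) order_refl assms(3,4)] assms(1)
    by (intro divide_right_mono) auto
  then show ?thesis
    using assms(1) Gamma_real_pos[OF assms(1)] by (simp add: frac_int_def Gamma_add_1 abs_mult)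
qed

lemmas integral_split = Henstock_Kurzweil_Integration.integral_combine[symmetric]

lemma frac_int_add:
  assumes "0 < a" "continuous_on {0..x} \<phi>" "continuous_on {0..x} \<psi>"
  shows "frac_int a (\<lambda>t. \<phi> t + \<psi> t) x = frac_int a \<phi> x + frac_int a \<psi> x"
  using kernel_integrable[OF assms(1) order_refl assms(2)] kernel_integrable[OF assms(1) order_refl assms(3)]
  by (simp add: frac_int_def integral_add algebra_simps add_divide_distrib)

lemma frac_int_diff:
  assumes "0 < a" "continuous_on {0..x} \<phi>" "continuous_on {0..x} \<psi>"
  shows "frac_int a (\<lambda>t. \<phi> t - \<psi> t) x = frac_int a \<phi> x - frac_int a \<psi> x"
  using kernel_integrable[OF assms(1) order_refl assms(2)] kernel_integrable[OF assms(1) order_refl assms(3)]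
  by (simp add: frac_int_def integral_diff algebra_simps diff_divide_distrib)

lemma frac_int_const:
  assumes "0 < a" "0 \<le> x"
  shows "frac_int a (\<lambda>t. M) x = M * x powr a / Gamma (a + 1)"
proof -
  have "((\<lambda>t. (x - t) powr (a - 1) * M) has_integral x powr a / a * M) {0..x}"
    using has_integral_mult_left[OF kernel_has_integral[OF assms(1,2) order_refl], of M] assms by simp
  from integral_unique[OF this] show ?thesis
    using assms(1) Gamma_real_pos[OF assms(1)] by (simp add: frac_int_def Gamma_add_1 mult.commute del: integral_mult_left integral_mult_right)
qed

lemma frac_int_cong:
  assumes "\<And>t. t \<in> {0..x} \<Longrightarrow> \<phi> t = \<psi> t"
  shows "frac_int a \<phi> x = frac_int a \<psi> x"
  unfolding frac_int_def using assms by (metis (mono_tags, lifting) integral_cong)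

lemma frac_int_0 [simp]: "frac_int a \<phi> 0 = 0"
  by (simp add: frac_int_def)

lemma frac_int_1: "frac_int 1 \<phi> x = integral {0..x} \<phi>"
proof -
  have "integral {0..x} (\<lambda>t. (x - t) powr (1 - 1) * \<phi> t) = integral {0..x} \<phi>"
    by (rule integral_spike[of "{x}"]) auto
  then show ?thesis by (simp add: frac_int_def)
qed

text \<open>
  Dilations commute with \<open>I\<^sup>a\<close> up to a power. This replaces differentiation under the singular integral:
  continuity of \<open>I\<^sup>a \<phi>\<close> and regularity of solutions are read off from it.
\<close>

lemma frac_int_scale:
  assumes "0 < \<sigma>" "0 \<le> x"
  shows "frac_int a \<phi> (\<sigma> * x) = \<sigma> powr a * frac_int a (\<lambda>t. \<phi> (\<sigma> * t)) x"
proof -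
  have "integral {0..x} (\<lambda>t. (\<sigma> * x - \<sigma> * t) powr (a - 1) * \<phi> (\<sigma> * t))
      = integral {0..\<sigma> * x} (\<lambda>t. (\<sigma> * x - t) powr (a - 1) * \<phi> t) / \<sigma>"
    using integral_stretch_real[of \<sigma> 0 "\<sigma> * x" "\<lambda>t. (\<sigma> * x - t) powr (a - 1) * \<phi> t"] assms by simp
  moreover have "integral {0..x} (\<lambda>t. (\<sigma> * x - \<sigma> * t) powr (a - 1) * \<phi> (\<sigma> * t)) =
      integral {0..x} (\<lambda>t. \<sigma> powr (a - 1) * ((x - t) powr (a - 1) * \<phi> (\<sigma> * t)))"
    using assms by (intro integral_cong) (simp add: right_diff_distrib[symmetric] powr_mult)
  ultimately have "\<sigma> powr (a - 1) * integral {0..x} (\<lambda>t. (x - t) powr (a - 1) * \<phi> (\<sigma> * t))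
      = integral {0..\<sigma> * x} (\<lambda>t. (\<sigma> * x - t) powr (a - 1) * \<phi> t) / \<sigma>" by simp
  then have "(\<sigma> * \<sigma> powr (a - 1)) * integral {0..x} (\<lambda>t. (x - t) powr (a - 1) * \<phi> (\<sigma> * t))
      = integral {0..\<sigma> * x} (\<lambda>t. (\<sigma> * x - t) powr (a - 1) * \<phi> t)"
    using assms(1) by (simp add: eq_divide_eq mult_ac)
  moreover have "\<sigma> * \<sigma> powr (a - 1) = \<sigma> powr a"
    using powr_mult_base[of \<sigma> "a - 1"] assms(1) by simp
  ultimately show ?thesis by (simp add: frac_int_def)
qed

lemma frac_int_scale_unit:
  assumes "0 \<le> x"
  shows "frac_int a \<phi> x = x powr a * frac_int a (\<lambda>t. \<phi> (x * t)) 1"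
  using frac_int_scale[of x 1 a \<phi>] assms by (cases "x = 0") auto

lemma continuous_on_frac_int:
  assumes "0 < a" "continuous_on {0..1} \<phi>"
  shows "continuous_on {0..1} (frac_int a \<phi>)"
proof -
  have unif: "uniformly_continuous_on {0..1} \<phi>"
    by (rule compact_uniformly_continuous[OF assms(2)]) auto
  have cont: "continuous_on {0..1} (\<lambda>t. \<phi> (x * t))" if "x \<in> {0..1}" for x
    using that by (intro continuous_on_compose2[OF assms(2)] continuous_intros)
       (auto simp: mult_le_one)
  have "continuous_on {0..1} (\<lambda>x. frac_int a (\<lambda>t. \<phi> (x * t)) 1)"
  proof (rule continuous_on_iff[THEN iffD2], intro ballI allI impI)
    fix x e :: real assume x: "x \<in> {0..1}" and "0 < e"
    define e' where "e' = e * Gamma (a + 1) / 2"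
    have G: "0 < Gamma (a + 1)" using assms(1) by (intro Gamma_real_pos) auto
    then have "0 < e'" using \<open>0 < e\<close> by (simp add: e'_def)
    then obtain d where d: "0 < d" "\<And>s t. s \<in> {0..1} \<Longrightarrow> t \<in> {0..1} \<Longrightarrow> dist s t < d \<Longrightarrow> dist (\<phi> s) (\<phi> t) < e'"
      using unif unfolding uniformly_continuous_on_def by metis
    show "\<exists>d>0. \<forall>y\<in>{0..1}. dist y x < d \<longrightarrow>
        dist (frac_int a (\<lambda>t. \<phi> (y * t)) 1) (frac_int a (\<lambda>t. \<phi> (x * t)) 1) < e"
    proof (intro exI[of _ d] conjI ballI impI d(1))
      fix y assume y: "y \<in> {0..1}" "dist y x < d"
      have "\<bar>frac_int a (\<lambda>t. \<phi> (y * t) - \<phi> (x * t)) 1\<bar> \<le> e' * 1 powr a / Gamma (a + 1)"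
      proof (rule frac_int_bound[OF assms(1)])
        show "continuous_on {0..1} (\<lambda>t. \<phi> (y * t) - \<phi> (x * t))"
          using cont x y by (intro continuous_intros) auto
        fix t :: real assume t: "t \<in> {0..1}"
        have "dist (y * t) (x * t) = dist y x * t"
          using t by (simp add: dist_real_def left_diff_distrib[symmetric] abs_mult)
        also have "\<dots> \<le> dist y x" using t by (simp add: mult_left_le)
        finally have "dist (\<phi> (y * t)) (\<phi> (x * t)) < e'"
          using x y t by (intro d(2)) (auto simp: mult_le_one)
        then show "\<bar>\<phi> (y * t) - \<phi> (x * t)\<bar> \<le> e'" by (simp add: dist_real_def)
      qed simp
      also have "e' * 1 powr a / Gamma (a + 1) < e" using G \<open>0 < e\<close> by (simp add: e'_def)
      finally show "dist (frac_int a (\<lambda>t. \<phi> (y * t)) 1) (frac_int a (\<lambda>t. \<phi> (x * t)) 1) < e"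
        using frac_int_diff[OF assms(1) cont[OF y(1)] cont[OF x]] by (simp add: dist_real_def)
    qed
  qed
  then have "continuous_on {0..1} (\<lambda>x. x powr a * frac_int a (\<lambda>t. \<phi> (x * t)) 1)"
    using assms(1) by (intro continuous_intros continuous_on_powr') auto
  then show ?thesis
    by (rule continuous_on_cong[THEN iffD1, rotated -1]) (auto simp: frac_int_scale_unit[symmetric])
qed


lemma abs_integrable_lborel:
  fixes f :: "real \<Rightarrow> real"
  assumes "f absolutely_integrable_on S" "(\<lambda>x. indicator S x * f x) \<in> borel_measurable borel"
  shows "integrable lborel (\<lambda>x. indicator S x * f x)"
    and "(LBINT x. indicator S x * f x) = integral S f"
proof -
  have "integrable lebesgue (\<lambda>x. indicator S x * f x)"
    using assms(1) by (simp add: set_integrable_def)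
  then show *: "integrable lborel (\<lambda>x. indicator S x * f x)"
    using assms(2) by (subst (asm) integrable_completion) auto
  then show "(LBINT x. indicator S x * f x) = integral S f"
    using set_borel_integral_eq_integral(2)[of S f]
    by (simp add: set_integrable_def set_lebesgue_integral_def)
qed

lemma beta_kernel_has_integral:
  fixes a b s x :: real
  assumes "0 < a" "0 < b" "s < x"
  shows "((\<lambda>t. (x - t) powr (a - 1) * (t - s) powr (b - 1)) has_integral
      (Gamma a * Gamma b / Gamma (a + b)) * (x - s) powr (a + b - 1)) {s..x}"
proof -
  define m where "m = x - s"
  have m: "0 < m" using assms by (simp add: m_def)
  have mx: "m * (1 + s / m) = x" using m by (simp add: distrib_left m_def)
  have "((\<lambda>t. t powr (b - 1) * (1 - t) powr (a - 1)) has_integral Beta b a) (cbox 0 1)"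
    using has_integral_Beta_real[OF assms(2,1)] by simp
  from has_integral_affinity'[OF this, of "1 / m" "- s / m"] m
  have "((\<lambda>t. ((t - s) / m) powr (b - 1) * (1 - (t - s) / m) powr (a - 1)) has_integral (m * Beta b a)) {s..x}"
    by (simp add: diff_divide_distrib mult.commute mx)
  from has_integral_mult_right[OF this, of "m powr (a + b - 2)"]
  have "((\<lambda>t. m powr (a + b - 2) * (((t - s) / m) powr (b - 1) * (1 - (t - s) / m) powr (a - 1)))
      has_integral (m powr (a + b - 2) * (m * Beta b a))) {s..x}" .
  moreover have "m powr (a + b - 2) * (m * Beta b a) = (Gamma a * Gamma b / Gamma (a + b)) * (x - s) powr (a + b - 1)"
  proof -
    have "m powr (a + b - 2) * m = m powr (a + b - 1)"
      using powr_mult_base[of m "a + b - 2"] m by (simp add: mult.commute)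
    then show ?thesis by (simp add: Beta_def m_def mult_ac add.commute)
  qed
  moreover have "m powr (a + b - 2) * (((t - s) / m) powr (b - 1) * (1 - (t - s) / m) powr (a - 1))
      = (x - t) powr (a - 1) * (t - s) powr (b - 1)" if "t \<in> {s..x}" for t
  proof -
    have "1 - (t - s) / m = (x - t) / m" using m by (simp add: field_simps m_def)
    moreover have "m powr (a + b - 2) = m powr (a - 1) * m powr (b - 1)"
      by (simp add: powr_add[symmetric])
    ultimately show ?thesis using that m by (simp add: powr_divide)
  qed
  ultimately show ?thesis by (metis (no_types, lifting) has_integral_cong)
qed

text \<open>
  Fubini on the triangle \<open>s \<le> t \<le> x\<close>; the inner integral over \<open>t\<close> is a Beta integral.
\<close>

lemma frac_int_semigroup:
  assumes "0 < a" "0 < b" "continuous_on {0..1} \<phi>" "x \<in> {0..1}"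
  shows "frac_int a (frac_int b \<phi>) x = frac_int (a + b) \<phi> x"
proof -
  define k where "k t s = indicator {0..x} t * (x - t) powr (a - 1) * (indicator {0..t} s * (t - s) powr (b - 1))"
    for t s :: real
  define \<psi> where "\<psi> s = indicator {0..1} s * \<phi> s" for s :: real
  have x: "0 \<le> x" "x \<le> 1" using assms(4) by auto
  have \<psi>[measurable]: "\<psi> \<in> borel_measurable borel"
    using borel_measurable_continuous_on_indicator[OF _ assms(3)] by (simp add: \<psi>_def[abs_def])
  obtain M where "0 \<le> M" and M: "\<And>t. t \<in> {0..1} \<Longrightarrow> \<bar>\<phi> t\<bar> \<le> M"
    using continuous_on_bounded[OF assms(3)] by blast
  have \<psi>M: "\<bar>\<psi> t\<bar> \<le> M" for t using M \<open>0 \<le> M\<close> by (auto simp: \<psi>_def indicator_def)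
  have [measurable]: "(\<lambda>(t::real, s). indicator {0..t} s :: real) \<in> borel_measurable (borel \<Otimes>\<^sub>M borel)"
  proof -
    have "(\<lambda>(t::real, s). indicator {0..t} s :: real) = (\<lambda>p. if 0 \<le> snd p \<and> snd p \<le> fst p then 1 else 0)"
      by (auto simp: indicator_def fun_eq_iff)
    also have "\<dots> \<in> borel_measurable (borel \<Otimes>\<^sub>M borel)" by measurable
    finally show ?thesis .
  qed
  have meas[measurable]: "case_prod k \<in> borel_measurable (borel \<Otimes>\<^sub>M borel)"
  proof -
    have "case_prod k = (\<lambda>p. indicator {0..x} (fst p) * (x - fst p) powr (a - 1) *
        ((case p of (t, s) \<Rightarrow> indicator {0..t} s) * (fst p - snd p) powr (b - 1)))"
      by (auto simp: k_def fun_eq_iff)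
    then show ?thesis by simp
  qed
  have inner_s: "integrable lborel (\<lambda>s. indicator {0..t} s * ((t - s) powr (b - 1) * \<eta> s))"
    "(LBINT s. indicator {0..t} s * ((t - s) powr (b - 1) * \<eta> s)) = Gamma b * frac_int b \<eta> t"
    if "continuous_on {0..1} \<eta>" "t \<in> {0..x}" for \<eta> t
  proof -
    have c: "continuous_on {0..t} \<eta>" using that x by (auto intro: continuous_on_subset)
    have m: "(\<lambda>s. indicator {0..t} s * ((t - s) powr (b - 1) * \<eta> s)) \<in> borel_measurable borel"
    proof -
      have [measurable]: "(\<lambda>s. indicator {0..t} s * \<eta> s) \<in> borel_measurable borel"
        using borel_measurable_continuous_on_indicator[OF _ c] by simp
      have "(\<lambda>s. indicator {0..t} s * ((t - s) powr (b - 1) * \<eta> s))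
          = (\<lambda>s. (t - s) powr (b - 1) * (indicator {0..t} s * \<eta> s))" by (auto simp: fun_eq_iff)
      then show ?thesis by simp
    qed
    show "integrable lborel (\<lambda>s. indicator {0..t} s * ((t - s) powr (b - 1) * \<eta> s))"
      "(LBINT s. indicator {0..t} s * ((t - s) powr (b - 1) * \<eta> s)) = Gamma b * frac_int b \<eta> t"
      using abs_integrable_lborel[OF kernel_abs_integrable[OF assms(2) order_refl c] m]
        Gamma_real_pos[OF assms(2)] by (auto simp: frac_int_def)
  qed
  have int_t: "(\<lambda>t. indicator {0..x} t * ((x - t) powr (a - 1) * \<eta> t)) \<in> borel_measurable borel"
    "integrable lborel (\<lambda>t. indicator {0..x} t * ((x - t) powr (a - 1) * \<eta> t))"
    "(LBINT t. indicator {0..x} t * ((x - t) powr (a - 1) * \<eta> t)) = Gamma a * frac_int a \<eta> x"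
    if "0 < a" "continuous_on {0..1} \<eta>" for \<eta> a
  proof -
    have c: "continuous_on {0..x} \<eta>" using that x by (auto intro: continuous_on_subset)
    have [measurable]: "(\<lambda>s. indicator {0..x} s * \<eta> s) \<in> borel_measurable borel"
      using borel_measurable_continuous_on_indicator[OF _ c] by simp
    have "(\<lambda>t. indicator {0..x} t * ((x - t) powr (a - 1) * \<eta> t))
        = (\<lambda>t. (x - t) powr (a - 1) * (indicator {0..x} t * \<eta> t))" by (auto simp: fun_eq_iff)
    then show m: "(\<lambda>t. indicator {0..x} t * ((x - t) powr (a - 1) * \<eta> t)) \<in> borel_measurable borel" by simp
    show "integrable lborel (\<lambda>t. indicator {0..x} t * ((x - t) powr (a - 1) * \<eta> t))"
      "(LBINT t. indicator {0..x} t * ((x - t) powr (a - 1) * \<eta> t)) = Gamma a * frac_int a \<eta> x"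
      using abs_integrable_lborel[OF kernel_abs_integrable[OF that(1) order_refl c] m]
        Gamma_real_pos[OF that(1)] by (auto simp: frac_int_def)
  qed
  have one: "continuous_on {0..1} (\<lambda>t. 1 :: real)" by simp
  have intk: "integrable (lborel \<Otimes>\<^sub>M lborel) (case_prod k)"
  proof (rule lborel_pair.Fubini_integrable)
    show "case_prod k \<in> borel_measurable (lborel \<Otimes>\<^sub>M lborel)" using meas by simp
    have ks: "k t s = indicator {0..x} t * (x - t) powr (a - 1) * (indicator {0..t} s * ((t - s) powr (b - 1) * 1))"
      for t s by (simp add: k_def)
    have "integrable lborel (k t)" for t
      unfolding ks[abs_def] using inner_s(1)[OF one, of t]
      by (cases "t \<in> {0..x}") (auto intro!: integrable_mult_right)
    then show "AE t in lborel. integrable lborel (\<lambda>s. case_prod k (t, s))" by simp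
    have kpos: "0 \<le> k t s" for t s by (simp add: k_def)
    have "(LBINT s. k t s) = indicator {0..x} t * ((x - t) powr (a - 1) * (Gamma b * frac_int b (\<lambda>t. 1) t))" for t
      unfolding ks using inner_s(2)[OF one, of t] by (cases "t \<in> {0..x}") auto
    moreover have "integrable lborel (\<lambda>t. indicator {0..x} t * ((x - t) powr (a - 1) * (Gamma b * frac_int b (\<lambda>t. 1) t)))"
      by (intro int_t(2) assms(1) continuous_intros continuous_on_frac_int[OF assms(2) one])
    ultimately show "integrable lborel (\<lambda>t. LBINT s. norm (case_prod k (t, s)))"
      using kpos by simp
  qed
  define f where "f t s = k t s * \<psi> s" for t s
  have intf: "integrable (lborel \<Otimes>\<^sub>M lborel) (case_prod f)"
  proof (rule Bochner_Integration.integrable_bound)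
    show "integrable (lborel \<Otimes>\<^sub>M lborel) (\<lambda>p. M * case_prod k p)" using intk by simp
    have "case_prod f = (\<lambda>p. case_prod k p * \<psi> (snd p))" by (auto simp: f_def fun_eq_iff)
    then show "case_prod f \<in> borel_measurable (lborel \<Otimes>\<^sub>M lborel)" using meas by simp
    show "AE p in lborel \<Otimes>\<^sub>M lborel. norm (case_prod f p) \<le> norm (M * case_prod k p)"
      using \<psi>M \<open>0 \<le> M\<close> by (auto simp: f_def abs_mult mult.commute intro!: AE_I2 mult_right_mono split: prod.split)
  qed
  have "Gamma a * frac_int a (\<lambda>t. Gamma b * frac_int b \<phi> t) x
      = (LBINT t. indicator {0..x} t * ((x - t) powr (a - 1) * (Gamma b * frac_int b \<phi> t)))"
    by (intro int_t(3)[symmetric] assms(1) continuous_intros continuous_on_frac_int[OF assms(2,3)])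
  also have "\<dots> = (LBINT t. LBINT s. f t s)"
  proof (rule Bochner_Integration.integral_cong[OF refl])
    fix t :: real
    show "indicator {0..x} t * ((x - t) powr (a - 1) * (Gamma b * frac_int b \<phi> t)) = (LBINT s. f t s)"
    proof (cases "t \<in> {0..x}")
      case True
      have "f t s = (x - t) powr (a - 1) * (indicator {0..t} s * ((t - s) powr (b - 1) * \<phi> s))" for s
        using True x by (auto simp: f_def k_def \<psi>_def indicator_def)
      then show ?thesis using inner_s(2)[OF assms(3) True] True by simp
    qed (simp add: f_def k_def)
  qed
  also have "\<dots> = (LBINT s. LBINT t. f t s)"
    using lborel_pair.Fubini_integral[OF intf] ..
  finally have eq1: "Gamma a * frac_int a (\<lambda>t. Gamma b * frac_int b \<phi> t) x = (LBINT s. LBINT t. f t s)" .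
  have m1: "(\<lambda>s. LBINT t. f t s) \<in> borel_measurable lborel"
    by (rule borel_measurable_integrable, rule lborel_pair.integrable_snd, rule intf)
  have m2: "(\<lambda>s. indicator {0..x} s * ((x - s) powr (a + b - 1) * \<phi> s)) \<in> borel_measurable lborel"
    unfolding measurable_lborel1 measurable_lborel2 by (rule int_t(1)[OF add_pos_pos[OF assms(1,2)] assms(3)])
  have m3: "(\<lambda>s. Gamma a * Gamma b / Gamma (a + b) * (indicator {0..x} s * ((x - s) powr (a + b - 1) * \<phi> s)))
        \<in> borel_measurable lborel"
    by (rule borel_measurable_times[OF borel_measurable_const m2])
  note eq1
  also have "(LBINT s. LBINT t. f t s) = (LBINT s. Gamma a * Gamma b / Gamma (a + b) *
      (indicator {0..x} s * ((x - s) powr (a + b - 1) * \<phi> s)))"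
  proof (rule integral_cong_AE[OF m1 m3])
    have "(LBINT t. f t s) = Gamma a * Gamma b / Gamma (a + b) *
      (indicator {0..x} s * ((x - s) powr (a + b - 1) * \<phi> s))" if "s \<noteq> x" for s
    proof (cases "s \<in> {0..<x}")
      case True
      have "f t s = \<phi> s * (indicator {s..x} t * ((x - t) powr (a - 1) * (t - s) powr (b - 1)))" for t
        using True x by (auto simp: f_def k_def \<psi>_def indicator_def)
      moreover have "(LBINT t. indicator {s..x} t * ((x - t) powr (a - 1) * (t - s) powr (b - 1)))
          = (Gamma a * Gamma b / Gamma (a + b)) * (x - s) powr (a + b - 1)"
        using beta_kernel_has_integral[OF assms(1,2), of s x] True
        by (subst abs_integrable_lborel(2))
           (auto simp: integral_unique integrable_on_def intro!: nonnegative_absolutely_integrable_1)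
      ultimately show ?thesis using True by simp
    next
      case False
      then have "f t s = 0" for t using that by (auto simp: f_def k_def \<psi>_def indicator_def)
      then show ?thesis using False that by auto
    qed
    note off_diag = this
    show "AE s in lborel. (LBINT t. f t s) = Gamma a * Gamma b / Gamma (a + b) *
      (indicator {0..x} s * ((x - s) powr (a + b - 1) * \<phi> s))"
      by (rule eventually_mono[OF AE_lborel_singleton[of x]]) (rule off_diag)
  qed
  also have "\<dots> = Gamma a * Gamma b / Gamma (a + b) * (Gamma (a + b) * frac_int (a + b) \<phi> x)"
    unfolding int_t(3)[OF add_pos_pos[OF assms(1,2)] assms(3), symmetric]
    by (rule integral_mult_right_zero)
  also have "\<dots> = Gamma a * Gamma b * frac_int (a + b) \<phi> x"
    using Gamma_real_pos[OF add_pos_pos[OF assms(1,2)]] by simp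
  finally have "Gamma a * frac_int a (\<lambda>t. Gamma b * frac_int b \<phi> t) x = Gamma a * Gamma b * frac_int (a + b) \<phi> x" .
  moreover have "frac_int a (\<lambda>t. Gamma b * frac_int b \<phi> t) x = Gamma b * frac_int a (frac_int b \<phi>) x"
    unfolding frac_int_def by (simp add: mult.left_commute)
  ultimately show ?thesis
    using Gamma_real_pos[OF assms(1)] Gamma_real_pos[OF assms(2)] by simp
qed

section \<open>Lipschitz functions with a weight at the origin\<close>

text \<open>
  The increments allowed to a function on \<open>[0,1]\<close> whose derivative is \<open>O(x\<^sup>\<beta>\<^sup>-\<^sup>1)\<close> at the origin. Putting
  \<open>t = \<sigma> x\<close>, it says that \<open>g x - g (\<sigma> x)\<close> is at most \<open>H (1 - \<sigma>) x\<^sup>\<beta>\<close>: Lipschitz continuity under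
  dilations, a form that suits fractional integrals.
\<close>

definition wlip :: "real \<Rightarrow> real \<Rightarrow> (real \<Rightarrow> real) \<Rightarrow> bool" where
  "wlip \<beta> H g \<longleftrightarrow> (\<forall>t x. 0 \<le> t \<longrightarrow> t \<le> x \<longrightarrow> x \<le> 1 \<longrightarrow> \<bar>g x - g t\<bar> \<le> H * ((x - t) * x powr (\<beta> - 1)))"

lemma wlipD:
  "wlip \<beta> H g \<Longrightarrow> 0 \<le> t \<Longrightarrow> t \<le> x \<Longrightarrow> x \<le> 1 \<Longrightarrow> \<bar>g x - g t\<bar> \<le> H * ((x - t) * x powr (\<beta> - 1))"
  unfolding wlip_def by blast

lemma wlip_nonneg: "wlip \<beta> H g \<Longrightarrow> 0 \<le> H"
  using wlipD[of \<beta> H g 0 1] by simp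

lemma wlip_add:
  assumes "wlip \<beta> H1 f" "wlip \<beta> H2 g"
  shows "wlip \<beta> (H1 + H2) (\<lambda>x. f x + g x)"
  unfolding wlip_def
proof (intro allI impI)
  fix t x :: real assume tx: "0 \<le> t" "t \<le> x" "x \<le> 1"
  show "\<bar>f x + g x - (f t + g t)\<bar> \<le> (H1 + H2) * ((x - t) * x powr (\<beta> - 1))"
    using wlipD[OF assms(1) tx] wlipD[OF assms(2) tx] unfolding distrib_right by linarith
qed

lemma wlip_minus: "wlip \<beta> H f \<Longrightarrow> wlip \<beta> H (\<lambda>x. - f x)"
  unfolding wlip_def by (auto simp: abs_minus_commute)

lemma wlip_mult:
  assumes "wlip \<beta> H1 f" "wlip \<beta> H2 g"
    and "\<And>x. x \<in> {0..1} \<Longrightarrow> \<bar>f x\<bar> \<le> M1" "\<And>x. x \<in> {0..1} \<Longrightarrow> \<bar>g x\<bar> \<le> M2"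
  shows "wlip \<beta> (H1 * M2 + M1 * H2) (\<lambda>x. f x * g x)"
  unfolding wlip_def
proof (intro allI impI)
  fix t x :: real assume tx: "0 \<le> t" "t \<le> x" "x \<le> 1"
  define w where "w = (x - t) * x powr (\<beta> - 1)"
  have w: "0 \<le> w" using tx by (simp add: w_def)
  have M1: "0 \<le> M1" using assms(3)[of 0] by auto
  have "f x * g x - f t * g t = (f x - f t) * g x + f t * (g x - g t)" by algebra
  also have "\<bar>\<dots>\<bar> \<le> \<bar>f x - f t\<bar> * \<bar>g x\<bar> + \<bar>f t\<bar> * \<bar>g x - g t\<bar>"
    using abs_triangle_ineq by (simp only: abs_mult[symmetric])
  also have "\<dots> \<le> (H1 * w) * M2 + M1 * (H2 * w)"
    using wlipD[OF assms(1) tx] wlipD[OF assms(2) tx] assms(3)[of t] assms(4)[of x] tx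
      wlip_nonneg[OF assms(1)] w M1
    by (intro add_mono mult_mono) (auto simp: w_def)
  finally show "\<bar>f x * g x - f t * g t\<bar> \<le> (H1 * M2 + M1 * H2) * ((x - t) * x powr (\<beta> - 1))"
    unfolding w_def[symmetric] by (simp add: algebra_simps)
qed

context
  fixes \<beta> :: real
  assumes \<beta>: "0 < \<beta>" "\<beta> < 1"
begin

lemma wlip_holder:
  assumes "wlip \<beta> H g" "0 \<le> t" "t \<le> x" "x \<le> 1"
  shows "\<bar>g x - g t\<bar> \<le> H * (x - t) powr \<beta>"
proof (cases "t = x")
  case False
  have "x powr (\<beta> - 1) \<le> (x - t) powr (\<beta> - 1)"
    using assms False \<beta> by (intro powr_mono2') auto
  then have "(x - t) * x powr (\<beta> - 1) \<le> (x - t) * (x - t) powr (\<beta> - 1)"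
    using assms by (intro mult_left_mono) auto
  also have "\<dots> = (x - t) powr \<beta>" using assms False by (simp add: powr_mult_base)
  finally show ?thesis
    using wlipD[OF assms] wlip_nonneg[OF assms(1)] by (meson mult_left_mono order_trans)
qed simp

text \<open>
  The functions \<open>(C/\<beta>) x\<^sup>\<beta> \<plusminus> g x\<close> are nondecreasing.
\<close>

lemma wlip_of_deriv:
  assumes cont: "continuous_on {0..1} g"
    and der: "\<And>x. x \<in> {0<..<1} \<Longrightarrow> (g has_real_derivative g' x) (at x)"
    and bound: "\<And>x. x \<in> {0<..<1} \<Longrightarrow> \<bar>g' x\<bar> \<le> C * x powr (\<beta> - 1)"
  shows "wlip \<beta> (C / \<beta>) g"
  unfolding wlip_def
proof (intro allI impI)
  fix t x :: real assume tx: "0 \<le> t" "t \<le> x" "x \<le> 1"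
  have "0 \<le> \<bar>g' (1 / 2)\<bar>" by simp
  also have "\<dots> \<le> C * (1 / 2) powr (\<beta> - 1)" by (rule bound) simp
  finally have "0 \<le> C" by (simp add: zero_le_mult_iff)
  have 1: "C / \<beta> * t powr \<beta> + s * g t \<le> C / \<beta> * x powr \<beta> + s * g x" if s: "\<bar>s\<bar> = 1" for s
  proof (rule DERIV_nonneg_imp_increasing_open[OF tx(2)])
    show "continuous_on {t..x} (\<lambda>x. C / \<beta> * x powr \<beta> + s * g x)"
      using tx \<beta> by (intro continuous_intros continuous_on_powr' continuous_on_subset[OF cont]) auto
    fix y assume y: "t < y" "y < x"
    have "((\<lambda>x. C / \<beta> * x powr \<beta> + s * g x) has_real_derivative C / \<beta> * (\<beta> * y powr (\<beta> - 1)) + s * g' y) (at y)"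
      using y tx by (auto intro!: derivative_eq_intros der)
    moreover have "0 \<le> C / \<beta> * (\<beta> * y powr (\<beta> - 1)) + s * g' y"
    proof -
      have "\<bar>s * g' y\<bar> \<le> C * y powr (\<beta> - 1)" using bound[of y] y tx s by (simp add: abs_mult)
      then show ?thesis using \<beta> by simp
    qed
    ultimately show "\<exists>l. ((\<lambda>x. C / \<beta> * x powr \<beta> + s * g x) has_real_derivative l) (at y) \<and> 0 \<le> l" by blast
  qed
  have "\<bar>g x - g t\<bar> \<le> C / \<beta> * x powr \<beta> - C / \<beta> * t powr \<beta>"
    using 1[of 1] 1[of "-1"] by simp
  also have "\<dots> = C / \<beta> * (x powr \<beta> - t powr \<beta>)" by (simp add: algebra_simps)
  also have "\<dots> \<le> C / \<beta> * ((x - t) * x powr (\<beta> - 1))"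
    using \<open>0 \<le> C\<close> \<beta> powr_diff_le[of \<beta> t x] tx by (intro mult_left_mono) auto
  finally show "\<bar>g x - g t\<bar> \<le> C / \<beta> * ((x - t) * x powr (\<beta> - 1))" .
qed

section \<open>Regularity of solutions of the integral equation\<close>

lemma frac_int_mono:
  assumes "0 < a" "continuous_on {0..x} \<phi>" "continuous_on {0..x} \<psi>" "\<And>t. t \<in> {0..x} \<Longrightarrow> \<bar>\<phi> t\<bar> \<le> \<psi> t"
  shows "\<bar>frac_int a \<phi> x\<bar> \<le> frac_int a \<psi> x"
proof -
  have "norm (integral {0..x} (\<lambda>t. (x - t) powr (a - 1) * \<phi> t)) \<le>
        integral {0..x} (\<lambda>t. (x - t) powr (a - 1) * \<psi> t)"
    using assms
    by (intro integral_norm_bound_integral kernel_integrable) (auto simp: abs_mult intro!: mult_left_mono)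
  then show ?thesis
    using Gamma_real_pos[OF assms(1)] by (simp add: frac_int_def divide_right_mono)
qed

text \<open>
  Compare \<open>m\<close> with \<open>S exp (l x)\<close>, where \<open>S\<close> is the maximum of \<open>exp (- l x) m x\<close>. The operator \<open>C I\<^sup>\<beta>\<close> maps
  \<open>exp (l x)\<close> to at most half of itself: the part of the kernel within distance \<open>\<epsilon>\<close> of the diagonal is
  small because \<open>\<epsilon>\<close> is, the rest because \<open>l\<close> is large. Evaluating at the maximum gives \<open>S \<le> A + S/2\<close>.
\<close>

lemma singular_gronwall:
  assumes "0 \<le> C"
  shows "\<exists>K\<ge>0. \<forall>m A. continuous_on {0..1} m \<longrightarrow> (\<forall>x\<in>{0..1}. 0 \<le> m x) \<longrightarrow> 0 \<le> A \<longrightarrow>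
    (\<forall>x\<in>{0..1}. m x \<le> A + C * frac_int \<beta> m x) \<longrightarrow> (\<forall>x\<in>{0..1}. m x \<le> K * A)"
proof -
  define \<Gamma> where "\<Gamma> = Gamma \<beta>"
  have \<Gamma>: "0 < \<Gamma>" using \<beta> by (simp add: \<Gamma>_def)
  define \<epsilon> where "\<epsilon> = (\<beta> * \<Gamma> / (4 * (C + 1))) powr (1 / \<beta>)"
  have \<epsilon>: "0 < \<epsilon>" using \<beta> \<Gamma> assms by (simp add: \<epsilon>_def)
  define l where "l = 4 * (C + 1) * \<epsilon> powr (\<beta> - 1) / \<Gamma>"
  have l: "0 < l" using assms \<Gamma> \<epsilon> by (simp add: l_def)
  have eps1: "C * (\<epsilon> powr \<beta> / \<beta>) / \<Gamma> \<le> 1 / 4"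
  proof -
    have "\<epsilon> powr \<beta> = \<beta> * \<Gamma> / (4 * (C + 1))" using \<beta> \<Gamma> assms by (simp add: \<epsilon>_def powr_powr)
    then have "C * (\<epsilon> powr \<beta> / \<beta>) / \<Gamma> = C / (4 * (C + 1))" using \<beta> \<Gamma> by simp
    also have "\<dots> \<le> 1 / 4" using assms by (simp add: divide_simps)
    finally show ?thesis .
  qed
  have eps2: "C * (\<epsilon> powr (\<beta> - 1) / l) / \<Gamma> \<le> 1 / 4"
  proof -
    have "C * (\<epsilon> powr (\<beta> - 1) / l) / \<Gamma> = C / (4 * (C + 1))"
      using \<epsilon> \<Gamma> assms by (simp add: l_def)
    also have "\<dots> \<le> 1 / 4" using assms by (simp add: divide_simps)
    finally show ?thesis .
  qed
  have "m x \<le> (2 * exp l) * A"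
    if cont: "continuous_on {0..1} m" and pos: "\<And>x. x \<in> {0..1} \<Longrightarrow> 0 \<le> m x" and "0 \<le> A"
    and ineq: "\<And>x. x \<in> {0..1} \<Longrightarrow> m x \<le> A + C * frac_int \<beta> m x" and x: "x \<in> {0..1}" for m A x
  proof -
    have "continuous_on {0..1} (\<lambda>x. exp (- l * x) * m x)" by (intro continuous_intros cont)
    then obtain y where y: "y \<in> {0..1}" and ymax: "\<And>t. t \<in> {0..1} \<Longrightarrow> exp (- l * t) * m t \<le> exp (- l * y) * m y"
      using continuous_attains_sup[of "{0..1}" "\<lambda>x. exp (- l * x) * m x"] by auto
    define S where "S = exp (- l * y) * m y"
    have S: "0 \<le> S" using pos y by (simp add: S_def)
    have mS: "m t \<le> S * exp (l * t)" if "t \<in> {0..1}" for t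
      using ymax[OF that] by (simp add: S_def exp_minus field_simps)
    define c where "c = max 0 (y - \<epsilon>)"
    have c: "0 \<le> c" "c \<le> y" "y - c \<le> \<epsilon>" using y \<epsilon> by (auto simp: c_def)
    have contc: "continuous_on {0..c} m" "continuous_on {c..y} m" "continuous_on {0..y} m"
      using c y by (auto intro: continuous_on_subset[OF cont])
    let ?k = "\<lambda>t. (y - t) powr (\<beta> - 1) * m t"
    have "integral {0..y} ?k = integral {0..c} ?k + integral {c..y} ?k"
      using c \<beta> contc by (intro integral_split kernel_integrable) auto
    also have "integral {c..y} ?k \<le> S * exp (l * y) * (\<epsilon> powr \<beta> / \<beta>)"
    proof -
      have "\<bar>m t\<bar> \<le> S * exp (l * y)" if "t \<in> {c..y}" for t
      proof -
        have "\<bar>m t\<bar> \<le> S * exp (l * t)" using mS[of t] pos[of t] that c y by auto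
        also have "\<dots> \<le> S * exp (l * y)" using that l S by (intro mult_left_mono) auto
        finally show ?thesis .
      qed
      from kernel_bound[OF \<beta>(1) c(2) order_refl contc(2) this]
      have "integral {c..y} ?k \<le> S * exp (l * y) * ((y - c) powr \<beta> / \<beta>)" by simp
      also have "\<dots> \<le> S * exp (l * y) * (\<epsilon> powr \<beta> / \<beta>)"
        using S c \<beta> by (intro mult_left_mono divide_right_mono powr_mono2) auto
      finally show ?thesis .
    qed
    also have "integral {0..c} ?k \<le> S * exp (l * y) * (\<epsilon> powr (\<beta> - 1) / l)"
    proof (cases "c = 0")
      case False
      then have ce: "c = y - \<epsilon>" by (auto simp: c_def max_def split: if_splits)
      have I: "((\<lambda>t. (\<epsilon> powr (\<beta> - 1) * S) * exp (l * t)) has_integral (\<epsilon> powr (\<beta> - 1) * S) * (exp (l * c) / l - exp (l * 0) / l)) {0..c}"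
        using c l by (intro has_integral_mult_right fundamental_theorem_of_calculus)
          (auto intro!: derivative_eq_intros simp: has_real_derivative_iff_has_vector_derivative[symmetric])
      have "norm (integral {0..c} ?k) \<le> integral {0..c} (\<lambda>t. (\<epsilon> powr (\<beta> - 1) * S) * exp (l * t))"
      proof (rule integral_norm_bound_integral)
        show "?k integrable_on {0..c}" using c \<beta> contc by (intro kernel_integrable) auto
        show "(\<lambda>t. (\<epsilon> powr (\<beta> - 1) * S) * exp (l * t)) integrable_on {0..c}"
          using I by (auto simp: integrable_on_def)
        fix t assume t: "t \<in> {0..c}"
        have "(y - t) powr (\<beta> - 1) \<le> \<epsilon> powr (\<beta> - 1)"
          using t ce \<epsilon> \<beta> by (intro powr_mono2') auto
        moreover have "0 \<le> m t" "m t \<le> S * exp (l * t)" using mS[of t] pos[of t] t c y by auto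
        ultimately have "(y - t) powr (\<beta> - 1) * m t \<le> \<epsilon> powr (\<beta> - 1) * (S * exp (l * t))"
          by (intro mult_mono) auto
        then show "norm (?k t) \<le> (\<epsilon> powr (\<beta> - 1) * S) * exp (l * t)"
          using \<open>0 \<le> m t\<close> by (simp add: abs_mult)
      qed
      also have "\<dots> = (\<epsilon> powr (\<beta> - 1) * S) * (exp (l * c) / l - exp (l * 0) / l)"
        by (rule integral_unique[OF I])
      also have "\<dots> \<le> (\<epsilon> powr (\<beta> - 1) * S) * (exp (l * y) / l)"
      proof (rule mult_left_mono)
        have "exp (l * c) \<le> exp (l * y)" using c l by simp
        then have "exp (l * c) / l \<le> exp (l * y) / l" using l by (intro divide_right_mono) auto
        moreover have "0 \<le> exp (l * 0) / l" using l by simp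
        ultimately show "exp (l * c) / l - exp (l * 0) / l \<le> exp (l * y) / l" by linarith
      qed (use S in simp)
      also have "\<dots> = S * exp (l * y) * (\<epsilon> powr (\<beta> - 1) / l)" by simp
      finally show ?thesis by simp
    qed (use S l in simp)
    finally have "integral {0..y} ?k \<le> S * exp (l * y) * (\<epsilon> powr (\<beta> - 1) / l + \<epsilon> powr \<beta> / \<beta>)"
      by (simp add: distrib_left)
    then have "C * (integral {0..y} ?k / \<Gamma>) \<le> C * (S * exp (l * y) * (\<epsilon> powr (\<beta> - 1) / l + \<epsilon> powr \<beta> / \<beta>) / \<Gamma>)"
      using assms \<Gamma> by (intro mult_left_mono divide_right_mono) auto
    also have "\<dots> = S * exp (l * y) * (C * (\<epsilon> powr (\<beta> - 1) / l) / \<Gamma> + C * (\<epsilon> powr \<beta> / \<beta>) / \<Gamma>)"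
      by (simp add: algebra_simps add_divide_distrib)
    also have "\<dots> \<le> S * exp (l * y) * (1 / 2)"
    proof (rule mult_left_mono)
      show "C * (\<epsilon> powr (\<beta> - 1) / l) / \<Gamma> + C * (\<epsilon> powr \<beta> / \<beta>) / \<Gamma> \<le> 1 / 2"
        using eps1 eps2 by linarith
    qed (use S in simp)
    finally have "C * frac_int \<beta> m y \<le> S * exp (l * y) * (1 / 2)" by (simp add: frac_int_def \<Gamma>_def)
    then have "m y \<le> A + S * exp (l * y) / 2" using ineq[OF y] by simp
    then have "exp (- l * y) * m y \<le> exp (- l * y) * (A + S * exp (l * y) / 2)"
      by (intro mult_left_mono) auto
    also have "\<dots> = exp (- l * y) * A + S / 2"
    proof -
      have "exp (- l * y) * exp (l * y) = 1" by (simp add: exp_add[symmetric])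
      then show ?thesis by (simp add: distrib_left)
    qed
    also have "exp (- l * y) * A \<le> 1 * A" using l y \<open>0 \<le> A\<close> by (intro mult_right_mono) auto
    finally have "S \<le> 2 * A" by (simp add: S_def)
    have "m x \<le> S * exp (l * x)" by (rule mS[OF x])
    also have "\<dots> \<le> (2 * A) * exp l" using \<open>S \<le> 2 * A\<close> S l x by (intro mult_mono) auto
    finally show ?thesis by (simp add: mult_ac)
  qed
  then show ?thesis by (intro exI[of _ "2 * exp l"]) auto
qed

lemma one_minus_powr_le:
  assumes "0 \<le> \<sigma>" "\<sigma> \<le> 1"
  shows "1 - \<sigma> powr \<beta> \<le> 1 - \<sigma>"
  using powr_diff_le[of \<beta> \<sigma> 1] assms \<beta> by simp

text \<open>
  Fix \<open>\<sigma> < 1\<close> and compare \<open>y\<close> with its dilate: \<open>E x = \<bar>y x - y (\<sigma> x)\<bar>\<close>. Because \<open>I\<^sup>\<beta>\<close> commutes with dilations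
  up to \<open>\<sigma>\<^sup>\<beta>\<close>, the equation gives \<open>E \<le> C (1 - \<sigma>) x\<^sup>\<beta> + B I\<^sup>\<beta> E\<close>, and Gronwall's inequality yields
  \<open>E = O(1 - \<sigma>)\<close>. Inserted once more into the right-hand side this improves to \<open>O((1 - \<sigma>) x\<^sup>\<beta>)\<close>. The argument
  starts from the mere continuity of \<open>y\<close>.
\<close>

lemma fractional_regularity:
  assumes cont: "continuous_on {0..1} b" "continuous_on {0..1} y" "continuous_on {0..1} G"
    and b: "wlip \<beta> H1 b" and G: "wlip \<beta> H2 G"
    and eq: "\<And>x. x \<in> {0..1} \<Longrightarrow> y x = y0 + frac_int \<beta> (\<lambda>t. b t * y t + G t) x"
  shows "\<exists>H. wlip \<beta> H y"
proof -
  define g where "g = (\<lambda>t. b t * y t + G t)"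
  have cg: "continuous_on {0..1} g" unfolding g_def by (intro continuous_intros cont)
  obtain B where B: "0 \<le> B" "\<And>t. t \<in> {0..1} \<Longrightarrow> \<bar>b t\<bar> \<le> B" using continuous_on_bounded[OF cont(1)] by blast
  obtain My where My: "0 \<le> My" "\<And>t. t \<in> {0..1} \<Longrightarrow> \<bar>y t\<bar> \<le> My" using continuous_on_bounded[OF cont(2)] by blast
  obtain Mg where Mg: "0 \<le> Mg" "\<And>t. t \<in> {0..1} \<Longrightarrow> \<bar>g t\<bar> \<le> Mg" using continuous_on_bounded[OF cg] by blast
  have H: "0 \<le> H1" "0 \<le> H2" using b G by (auto dest: wlip_nonneg)
  define \<Gamma>' where "\<Gamma>' = Gamma (\<beta> + 1)"
  have \<Gamma>': "0 < \<Gamma>'" using \<beta> by (simp add: \<Gamma>'_def)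
  define M where "M = My * H1 + H2"
  have M: "0 \<le> M" using My H by (simp add: M_def)
  obtain K where "0 \<le> K" and K: "\<forall>m A. continuous_on {0..1} m \<longrightarrow> (\<forall>x\<in>{0..1}. 0 \<le> m x) \<longrightarrow> 0 \<le> A \<longrightarrow>
    (\<forall>x\<in>{0..1}. m x \<le> A + B * frac_int \<beta> m x) \<longrightarrow> (\<forall>x\<in>{0..1}. m x \<le> K * A)"
    using singular_gronwall[OF B(1)] by blast
  define A0 where "A0 = (Mg + M) / \<Gamma>'"
  have A0: "0 \<le> A0" using Mg M \<Gamma>' by (simp add: A0_def)
  define H where "H = A0 + B * (K * A0) / \<Gamma>'"
  have gb: "\<bar>frac_int \<beta> g x\<bar> \<le> Mg * x powr \<beta> / \<Gamma>'" if "x \<in> {0..1}" for x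
    unfolding \<Gamma>'_def using that Mg \<beta>
    by (intro frac_int_bound continuous_on_subset[OF cg]) auto
  have main: "\<bar>y x - y (\<sigma> * x)\<bar> \<le> H * ((1 - \<sigma>) * x powr \<beta>)"
    if \<sigma>: "0 < \<sigma>" "\<sigma> < 1" and "x \<in> {0..1}" for \<sigma> x
  proof -
    have \<sigma>x: "\<sigma> * x \<in> {0..1}" if "x \<in> {0..1}" for x using that \<sigma> by (auto simp: mult_le_one)
    have c\<sigma>: "continuous_on {0..1} (\<lambda>t. \<phi> (\<sigma> * t))" if "continuous_on {0..1} \<phi>" for \<phi> :: "real \<Rightarrow> real"
      using \<sigma>x by (intro continuous_on_compose2[OF that] continuous_intros) auto
    define E where "E x = \<bar>y x - y (\<sigma> * x)\<bar>" for x
    have cE: "continuous_on {0..1} E" unfolding E_def by (intro continuous_intros cont c\<sigma>)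
    have \<sigma>w: "\<bar>f x - f (\<sigma> * x)\<bar> \<le> H * (1 - \<sigma>)" if "wlip \<beta> H f" "x \<in> {0..1}" for f H x
    proof -
      have "\<bar>f x - f (\<sigma> * x)\<bar> \<le> H * ((x - \<sigma> * x) * x powr (\<beta> - 1))"
        using that \<sigma> by (intro wlipD) (auto simp: mult_left_le_one_le)
      also have "(x - \<sigma> * x) * x powr (\<beta> - 1) = (1 - \<sigma>) * x powr \<beta>"
        using powr_mult_base[of x "\<beta> - 1"] that by (cases "x = 0") (auto simp: algebra_simps)
      also have "H * ((1 - \<sigma>) * x powr \<beta>) \<le> H * ((1 - \<sigma>) * 1)"
        using that wlip_nonneg[OF that(1)] \<sigma> \<beta> by (intro mult_left_mono powr_le1) auto
      finally show ?thesis by simp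
    qed
    have gd: "\<bar>g x - g (\<sigma> * x)\<bar> \<le> B * E x + M * (1 - \<sigma>)" if x: "x \<in> {0..1}" for x
    proof -
      have "g x - g (\<sigma> * x) = b x * (y x - y (\<sigma> * x)) + y (\<sigma> * x) * (b x - b (\<sigma> * x)) + (G x - G (\<sigma> * x))"
        unfolding g_def by algebra
      then have "\<bar>g x - g (\<sigma> * x)\<bar> \<le> \<bar>b x\<bar> * \<bar>y x - y (\<sigma> * x)\<bar> + \<bar>y (\<sigma> * x)\<bar> * \<bar>b x - b (\<sigma> * x)\<bar> + \<bar>G x - G (\<sigma> * x)\<bar>"
        unfolding abs_mult[symmetric] by linarith
      also have "\<dots> \<le> B * E x + My * (H1 * (1 - \<sigma>)) + H2 * (1 - \<sigma>)"
        using B My \<sigma>w[OF b x] \<sigma>w[OF G x] x \<sigma>x[OF x] unfolding E_def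
        by (intro add_mono mult_mono) auto
      finally show ?thesis by (simp add: M_def algebra_simps)
    qed
    have step: "E x \<le> (1 - \<sigma>) * A0 * x powr \<beta> + B * frac_int \<beta> E x" if x: "x \<in> {0..1}" for x
    proof -
      have x0: "0 \<le> x" and sub: "{0..x} \<subseteq> {0..1}" using x by auto
      have cg': "continuous_on {0..x} g" "continuous_on {0..x} (\<lambda>t. g (\<sigma> * t))" "continuous_on {0..x} E"
        using continuous_on_subset[OF _ sub] cg c\<sigma>[OF cg] cE by blast+
      have d: "\<bar>frac_int \<beta> (\<lambda>t. g t - g (\<sigma> * t)) x\<bar> \<le> frac_int \<beta> (\<lambda>t. B * E t + M * (1 - \<sigma>)) x"
        using gd sub by (intro frac_int_mono continuous_intros cg' \<beta>) auto
      also have "\<dots> = B * frac_int \<beta> E x + M * (1 - \<sigma>) * x powr \<beta> / \<Gamma>'"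
      proof -
        have "frac_int \<beta> (\<lambda>t. B * E t) x = B * frac_int \<beta> E x"
          by (simp add: frac_int_def mult.left_commute)
        then show ?thesis
          using frac_int_add[OF \<beta>(1), of x "\<lambda>t. B * E t" "\<lambda>t. M * (1 - \<sigma>)"] cg'(3)
            frac_int_const[OF \<beta>(1) x0, of "M * (1 - \<sigma>)"]
          by (simp add: continuous_on_mult_left \<Gamma>'_def)
      qed
      finally have d: "\<bar>frac_int \<beta> (\<lambda>t. g t - g (\<sigma> * t)) x\<bar> \<le> B * frac_int \<beta> E x + M * (1 - \<sigma>) * x powr \<beta> / \<Gamma>'" .
      have "y x - y (\<sigma> * x) = frac_int \<beta> g x - \<sigma> powr \<beta> * frac_int \<beta> (\<lambda>t. g (\<sigma> * t)) x"
        using eq[OF x] eq[OF \<sigma>x[OF x]] frac_int_scale[OF \<sigma>(1) x0, of \<beta> g] by (simp add: g_def)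
      also have "\<dots> = (1 - \<sigma> powr \<beta>) * frac_int \<beta> g x + \<sigma> powr \<beta> * frac_int \<beta> (\<lambda>t. g t - g (\<sigma> * t)) x"
        unfolding frac_int_diff[OF \<beta>(1) cg'(1,2)] by algebra
      finally have "E x \<le> \<bar>1 - \<sigma> powr \<beta>\<bar> * \<bar>frac_int \<beta> g x\<bar> + \<bar>\<sigma> powr \<beta>\<bar> * \<bar>frac_int \<beta> (\<lambda>t. g t - g (\<sigma> * t)) x\<bar>"
        unfolding E_def abs_mult[symmetric] by linarith
      also have "\<dots> \<le> (1 - \<sigma>) * (Mg * x powr \<beta> / \<Gamma>') + 1 * (B * frac_int \<beta> E x + M * (1 - \<sigma>) * x powr \<beta> / \<Gamma>')"
      proof (intro add_mono mult_mono)
        have "\<sigma> powr \<beta> \<le> 1" using \<sigma> \<beta> by (intro powr_le1) auto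
        then show "\<bar>1 - \<sigma> powr \<beta>\<bar> \<le> 1 - \<sigma>" "\<bar>\<sigma> powr \<beta>\<bar> \<le> 1"
          using one_minus_powr_le[of \<sigma>] \<sigma> by auto
      qed (use gb[OF x] d \<sigma> in auto)
      also have "\<dots> = (1 - \<sigma>) * A0 * x powr \<beta> + B * frac_int \<beta> E x"
        by (simp add: A0_def algebra_simps add_divide_distrib)
      finally show ?thesis .
    qed
    have EK: "E x \<le> K * ((1 - \<sigma>) * A0)" if "x \<in> {0..1}" for x
    proof (rule K[rule_format, OF cE _ _ _ that])
      fix x :: real assume x: "x \<in> {0..1}"
      have "(1 - \<sigma>) * A0 * x powr \<beta> \<le> (1 - \<sigma>) * A0 * 1"
        using x \<sigma> A0 \<beta> by (intro mult_left_mono powr_le1) auto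
      then show "E x \<le> (1 - \<sigma>) * A0 + B * frac_int \<beta> E x" using step[OF x] by linarith
    qed (use \<sigma> A0 in \<open>auto simp: E_def\<close>)
    have x: "x \<in> {0..1}" by fact
    have "\<bar>frac_int \<beta> E x\<bar> \<le> K * ((1 - \<sigma>) * A0) * x powr \<beta> / \<Gamma>'"
      unfolding \<Gamma>'_def
    proof (rule frac_int_bound[OF \<beta>(1)])
      show "continuous_on {0..x} E" using x by (intro continuous_on_subset[OF cE]) auto
      show "\<bar>E t\<bar> \<le> K * ((1 - \<sigma>) * A0)" if "t \<in> {0..x}" for t
        using EK[of t] that x by (auto simp: E_def)
    qed (use x in auto)
    then have "B * frac_int \<beta> E x \<le> B * (K * ((1 - \<sigma>) * A0) * x powr \<beta> / \<Gamma>')"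
      using B by (intro mult_left_mono) auto
    then have "E x \<le> (1 - \<sigma>) * A0 * x powr \<beta> + B * (K * ((1 - \<sigma>) * A0) * x powr \<beta> / \<Gamma>')"
      using step[OF x] by linarith
    also have "\<dots> = H * ((1 - \<sigma>) * x powr \<beta>)" by (simp add: H_def algebra_simps add_divide_distrib diff_divide_distrib)
    finally show ?thesis by (simp add: E_def)
  qed
  have "wlip \<beta> (max H (Mg / \<Gamma>')) y"
    unfolding wlip_def
  proof (intro allI impI)
    fix t x :: real assume tx: "0 \<le> t" "t \<le> x" "x \<le> 1"
    define w where "w = (x - t) * x powr (\<beta> - 1)"
    have w: "0 \<le> w" using tx by (simp add: w_def)
    consider "t = x" | "t = 0" "0 < x" | "0 < t" "t < x" using tx by linarith
    then have "\<bar>y x - y t\<bar> \<le> H * w \<or> \<bar>y x - y t\<bar> \<le> Mg / \<Gamma>' * w"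
    proof cases
      case 1 then show ?thesis by (simp add: w_def)
    next
      case 2
      have "y x - y t = frac_int \<beta> g x" using eq[of x] eq[of 0] 2 tx by (simp add: g_def)
      moreover have "w = x powr \<beta>" using 2 powr_mult_base[of x "\<beta> - 1"] by (simp add: w_def)
      ultimately show ?thesis using gb[of x] tx 2 by simp
    next
      case 3
      have "(1 - t / x) * x powr \<beta> = w"
        using 3 powr_mult_base[of x "\<beta> - 1"] by (simp add: w_def field_simps)
      then show ?thesis using main[of "t / x" x] 3 tx by simp
    qed
    then show "\<bar>y x - y t\<bar> \<le> max H (Mg / \<Gamma>') * ((x - t) * x powr (\<beta> - 1))"
      unfolding w_def[symmetric]
      using mult_right_mono[OF max.cobounded1[of H "Mg / \<Gamma>'"] w] mult_right_mono[OF max.cobounded2[of "Mg / \<Gamma>'" H] w]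
      by linarith
  qed
  then show ?thesis by blast
qed

section \<open>Second differences of fractional integrals\<close>

lemma kernel_diff_bound:
  assumes "0 < t" "t \<le> s"
  shows "t powr (\<beta> - 1) - s powr (\<beta> - 1) \<le> (s - t) * t powr (\<beta> - 2)"
proof (cases "t = s")
  case False
  then have ts: "t < s" using assms by simp
  have "\<exists>z>t. z < s \<and> s powr (\<beta> - 1) - t powr (\<beta> - 1) = (s - t) * ((\<beta> - 1) * z powr (\<beta> - 2))"
    using assms by (intro MVT2[OF ts]) (auto intro!: derivative_eq_intros)
  then obtain z where z: "t < z" "s powr (\<beta> - 1) - t powr (\<beta> - 1) = (s - t) * ((\<beta> - 1) * z powr (\<beta> - 2))" by blast
  have "(1 - \<beta>) * z powr (\<beta> - 2) \<le> 1 * t powr (\<beta> - 2)"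
    using z \<beta> assms by (intro mult_mono powr_mono2') auto
  then have "(s - t) * ((1 - \<beta>) * z powr (\<beta> - 2)) \<le> (s - t) * t powr (\<beta> - 2)"
    using ts by (intro mult_left_mono) auto
  moreover have "(s - t) * ((1 - \<beta>) * z powr (\<beta> - 2)) = - (s powr (\<beta> - 1) - t powr (\<beta> - 1))"
    unfolding z(2) by algebra
  ultimately show ?thesis by linarith
qed simp

lemma powr_half_le:
  assumes "0 < x"
  shows "(x / 2) powr (\<beta> - 1) \<le> 2 * x powr (\<beta> - 1)" "(x / 2) powr (\<beta> - 2) \<le> 4 * x powr (\<beta> - 2)"
proof -
  have "(1 / 2) powr (\<beta> - 1) \<le> (1 / 2 :: real) powr (- 1)" "(1 / 2) powr (\<beta> - 2) \<le> (1 / 2 :: real) powr (- 2)"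
    using \<beta> by (intro powr_mono'; simp)+
  then have "(1 / 2) powr (\<beta> - 1) * x powr (\<beta> - 1) \<le> 2 * x powr (\<beta> - 1)"
    "(1 / 2) powr (\<beta> - 2) * x powr (\<beta> - 2) \<le> 4 * x powr (\<beta> - 2)"
    by (intro mult_right_mono; simp add: powr_minus powr_numeral power2_eq_square)+
  then show "(x / 2) powr (\<beta> - 1) \<le> 2 * x powr (\<beta> - 1)" "(x / 2) powr (\<beta> - 2) \<le> 4 * x powr (\<beta> - 2)"
    using assms by (simp_all add: powr_mult[symmetric])
qed

text \<open>
  The difference of two singular kernels has the wrong sign at the endpoint, where the kernels are set to
  \<open>0\<close>; so the pointwise bound must be allowed to fail there.
\<close>

lemma integral_bound_except_point:
  fixes f g :: "real \<Rightarrow> real"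
  assumes "f integrable_on S" "(g has_integral I) S" "\<And>t. t \<in> S \<Longrightarrow> t \<noteq> p \<Longrightarrow> \<bar>f t\<bar> \<le> g t"
  shows "\<bar>integral S f\<bar> \<le> I"
proof -
  define f' where "f' t = (if t = p then g p else f t)" for t
  define g' where "g' t = (if t = p then \<bar>g p\<bar> else g t)" for t
  have I: "(g' has_integral I) S"
    by (rule has_integral_spike[OF _ _ assms(2), of "{p}"]) (auto simp: g'_def)
  have f: "f' integrable_on S"
    by (rule integrable_spike[OF assms(1), of "{p}"]) (auto simp: f'_def)
  have "norm (integral S f') \<le> integral S g'"
    using I assms(3) by (intro integral_norm_bound_integral f) (auto simp: integrable_on_def f'_def g'_def)
  moreover have "integral S f = integral S f'" by (rule integral_spike[of "{p}"]) (auto simp: f'_def)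
  ultimately show ?thesis using integral_unique[OF I] by simp
qed

text \<open>
  One difference with step \<open>h\<close> is moved onto \<open>g\<close>: \<open>I\<^sup>\<beta> g (x + h) - I\<^sup>\<beta> g x\<close> is the contribution of the first
  interval \<open>[0,h]\<close> plus \<open>I\<^sup>\<beta> \<phi> x\<close> with \<open>\<phi> t = g (t + h) - g t\<close>. The first has a smooth kernel, giving
  \<open>h\<^sup>2 x\<^sup>\<beta>\<^sup>-\<^sup>2\<close>. In the second, the difference between \<open>x\<close> and \<open>x'\<close> falls on the kernel, which gives a factor \<open>h\<^sup>\<beta>\<close>, while
  \<open>\<phi> t = O(h t\<^sup>\<beta>\<^sup>-\<^sup>1)\<close>; for \<open>t \<le> x/2\<close> the bound \<open>\<phi> t = O(h\<^sup>\<beta>)\<close> suffices, since the kernels are smooth there.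
  The second term is the price for controlling only first differences of \<open>g\<close>.
\<close>

lemma second_difference_frac_int:
  assumes cont: "continuous_on {0..1} g" and lip: "wlip \<beta> H g"
    and M: "\<And>t. t \<in> {0..1} \<Longrightarrow> \<bar>g t\<bar> \<le> M"
    and h: "0 < h" "h \<le> x" "x \<le> x'" "x' \<le> x + h" "x' + h \<le> 1"
  shows "\<bar>(frac_int \<beta> g (x' + h) - frac_int \<beta> g x') - (frac_int \<beta> g (x + h) - frac_int \<beta> g x)\<bar>
    \<le> (M + 4 * H + 3 * H / \<beta>) / Gamma \<beta> * (h\<^sup>2 * x powr (\<beta> - 2) + h powr (1 + \<beta>) * x powr (\<beta> - 1))"
proof -
  define \<phi> where "\<phi> t = g (t + h) - g t" for t
  define P where "P = h\<^sup>2 * x powr (\<beta> - 2)"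
  define Q where "Q = h powr (1 + \<beta>) * x powr (\<beta> - 1)"
  have H: "0 \<le> H" by (rule wlip_nonneg[OF lip])
  have M0: "0 \<le> M" using M[of 0] by auto
  have x: "0 < x" "x \<le> 1" using h by auto
  have PQ: "0 \<le> P" "0 \<le> Q" by (auto simp: P_def Q_def)
  have sub: "continuous_on {a..b} g" if "0 \<le> a" "b \<le> 1" for a b
    using that by (intro continuous_on_subset[OF cont]) auto
  have cs: "continuous_on {a..b} (\<lambda>t. g (t + h))" if "0 \<le> a" "b \<le> 1 - h" for a b
    using that h(1) by (intro continuous_on_compose2[OF cont] continuous_intros) auto
  have c\<phi>: "continuous_on {a..b} \<phi>" if "0 \<le> a" "b \<le> 1 - h" for a b
    unfolding \<phi>_def using that h(1) by (intro continuous_intros sub cs) auto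
  have \<phi>1: "\<bar>\<phi> t\<bar> \<le> H * h powr \<beta>" if "0 \<le> t" "t \<le> 1 - h" for t
    using wlip_holder[OF lip, of t "t + h"] that h by (simp add: \<phi>_def)
  have \<phi>2: "\<bar>\<phi> t\<bar> \<le> H * (h * s powr (\<beta> - 1))" if "0 < s" "s \<le> t" "t \<le> 1 - h" for s t
  proof -
    have "(t + h) powr (\<beta> - 1) \<le> s powr (\<beta> - 1)" using that h \<beta> by (intro powr_mono2') auto
    then have "H * (h * (t + h) powr (\<beta> - 1)) \<le> H * (h * s powr (\<beta> - 1))"
      using H h by (intro mult_left_mono) auto
    then show ?thesis using wlipD[OF lip, of t "t + h"] that h by (simp add: \<phi>_def)
  qed
  have split: "Gamma \<beta> * (frac_int \<beta> g (z + h) - frac_int \<beta> g z)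
      = integral {0..h} (\<lambda>t. (z + h - t) powr (\<beta> - 1) * g t) + integral {0..z} (\<lambda>t. (z - t) powr (\<beta> - 1) * \<phi> t)"
    if z: "0 \<le> z" "z + h \<le> 1" for z
  proof -
    have "integral {0..z+h} (\<lambda>t. (z + h - t) powr (\<beta> - 1) * g t)
      = integral {0..h} (\<lambda>t. (z + h - t) powr (\<beta> - 1) * g t) + integral {h..z+h} (\<lambda>t. (z + h - t) powr (\<beta> - 1) * g t)"
      using z h \<beta> by (intro integral_split kernel_integrable sub) auto
    also have "integral {h..z+h} (\<lambda>t. (z + h - t) powr (\<beta> - 1) * g t) = integral {0..z} (\<lambda>t. (z - t) powr (\<beta> - 1) * g (t + h))"
      using integral_shift_real_ivl[of h h "z + h" "\<lambda>t. (z + h - t) powr (\<beta> - 1) * g t"] by simp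
    finally have "integral {0..z+h} (\<lambda>t. (z + h - t) powr (\<beta> - 1) * g t) - integral {0..z} (\<lambda>t. (z - t) powr (\<beta> - 1) * g t)
      = integral {0..h} (\<lambda>t. (z + h - t) powr (\<beta> - 1) * g t) + (integral {0..z} (\<lambda>t. (z - t) powr (\<beta> - 1) * g (t + h))
       - integral {0..z} (\<lambda>t. (z - t) powr (\<beta> - 1) * g t))" by simp
    also have "integral {0..z} (\<lambda>t. (z - t) powr (\<beta> - 1) * g (t + h)) - integral {0..z} (\<lambda>t. (z - t) powr (\<beta> - 1) * g t)
      = integral {0..z} (\<lambda>t. (z - t) powr (\<beta> - 1) * g (t + h) - (z - t) powr (\<beta> - 1) * g t)"
      using z h \<beta> by (intro integral_diff[symmetric] kernel_integrable sub cs) auto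
    also have "\<dots> = integral {0..z} (\<lambda>t. (z - t) powr (\<beta> - 1) * \<phi> t)"
      by (simp add: \<phi>_def right_diff_distrib)
    finally show ?thesis using Gamma_real_pos[OF \<beta>(1)]
      by (simp add: frac_int_def diff_divide_distrib[symmetric])
  qed
  have "Gamma \<beta> * ((frac_int \<beta> g (x' + h) - frac_int \<beta> g x') - (frac_int \<beta> g (x + h) - frac_int \<beta> g x))
      = (integral {0..h} (\<lambda>t. (x' + h - t) powr (\<beta> - 1) * g t) - integral {0..h} (\<lambda>t. (x + h - t) powr (\<beta> - 1) * g t))
      + (integral {0..x'} (\<lambda>t. (x' - t) powr (\<beta> - 1) * \<phi> t) - integral {0..x} (\<lambda>t. (x - t) powr (\<beta> - 1) * \<phi> t))"
    using split[of x'] split[of x] h by (simp add: right_diff_distrib)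
  also have "integral {0..x'} (\<lambda>t. (x' - t) powr (\<beta> - 1) * \<phi> t) =
      integral {0..x} (\<lambda>t. (x' - t) powr (\<beta> - 1) * \<phi> t) + integral {x..x'} (\<lambda>t. (x' - t) powr (\<beta> - 1) * \<phi> t)"
    using h \<beta> by (intro integral_split kernel_integrable c\<phi>) auto
  finally have decomp: "Gamma \<beta> * ((frac_int \<beta> g (x' + h) - frac_int \<beta> g x') - (frac_int \<beta> g (x + h) - frac_int \<beta> g x))
      = (integral {0..h} (\<lambda>t. (x' + h - t) powr (\<beta> - 1) * g t) - integral {0..h} (\<lambda>t. (x + h - t) powr (\<beta> - 1) * g t))
      + (integral {0..x} (\<lambda>t. (x' - t) powr (\<beta> - 1) * \<phi> t) - integral {0..x} (\<lambda>t. (x - t) powr (\<beta> - 1) * \<phi> t))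
      + integral {x..x'} (\<lambda>t. (x' - t) powr (\<beta> - 1) * \<phi> t)" by simp
  have 1: "\<bar>integral {0..h} (\<lambda>t. (x' + h - t) powr (\<beta> - 1) * g t) - integral {0..h} (\<lambda>t. (x + h - t) powr (\<beta> - 1) * g t)\<bar> \<le> M * P"
  proof -
    have i: "(\<lambda>t. (x' + h - t) powr (\<beta> - 1) * g t) integrable_on {0..h}" "(\<lambda>t. (x + h - t) powr (\<beta> - 1) * g t) integrable_on {0..h}"
      using h \<beta> by (auto intro!: kernel_integrable sub)
    have "norm (integral {0..h} (\<lambda>t. (x' + h - t) powr (\<beta> - 1) * g t - (x + h - t) powr (\<beta> - 1) * g t))
        \<le> integral {0..h} (\<lambda>t. (h * x powr (\<beta> - 2)) * M)"
    proof (rule integral_norm_bound_integral)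
      fix t assume t: "t \<in> {0..h}"
      have "(x' + h - t) powr (\<beta> - 1) \<le> (x + h - t) powr (\<beta> - 1)" using t h \<beta> by (intro powr_mono2') auto
      moreover have "(x + h - t) powr (\<beta> - 1) - (x' + h - t) powr (\<beta> - 1) \<le> h * x powr (\<beta> - 2)"
      proof -
        have "(x + h - t) powr (\<beta> - 1) - (x' + h - t) powr (\<beta> - 1) \<le> (x' - x) * (x + h - t) powr (\<beta> - 2)"
          using kernel_diff_bound[of "x + h - t" "x' + h - t"] t h by simp
        also have "\<dots> \<le> h * x powr (\<beta> - 2)"
          using t h \<beta> by (intro mult_mono powr_mono2') auto
        finally show ?thesis .
      qed
      ultimately have "\<bar>(x' + h - t) powr (\<beta> - 1) - (x + h - t) powr (\<beta> - 1)\<bar> \<le> h * x powr (\<beta> - 2)" by simp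
      then show "norm ((x' + h - t) powr (\<beta> - 1) * g t - (x + h - t) powr (\<beta> - 1) * g t) \<le> (h * x powr (\<beta> - 2)) * M"
        unfolding left_diff_distrib[symmetric] real_norm_def abs_mult using M[of t] t h by (intro mult_mono) auto
    qed (use i in \<open>auto intro: integrable_diff\<close>)
    also have "\<dots> = M * P" using h by (simp add: P_def power2_eq_square)
    finally show ?thesis using integral_diff[OF i] by simp
  qed
  have 2: "\<bar>integral {x..x'} (\<lambda>t. (x' - t) powr (\<beta> - 1) * \<phi> t)\<bar> \<le> H / \<beta> * Q"
  proof -
    have "\<bar>integral {x..x'} (\<lambda>t. (x' - t) powr (\<beta> - 1) * \<phi> t)\<bar>
        \<le> H * (h * x powr (\<beta> - 1)) * (((x' - x) powr \<beta> - (x' - x') powr \<beta>) / \<beta>)"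
      using h x by (intro kernel_bound \<beta> c\<phi> \<phi>2) auto
    also have "\<dots> \<le> H * (h * x powr (\<beta> - 1)) * (h powr \<beta> / \<beta>)"
    proof (rule mult_left_mono)
      have "(x' - x) powr \<beta> \<le> h powr \<beta>" using h \<beta> by (intro powr_mono2) auto
      then show "((x' - x) powr \<beta> - (x' - x') powr \<beta>) / \<beta> \<le> h powr \<beta> / \<beta>"
        using \<beta> by (intro divide_right_mono) auto
    qed (use H h in simp)
    also have "\<dots> = H / \<beta> * Q" using h by (simp add: Q_def powr_add)
    finally show ?thesis .
  qed
  have 3: "\<bar>integral {0..x} (\<lambda>t. (x' - t) powr (\<beta> - 1) * \<phi> t) - integral {0..x} (\<lambda>t. (x - t) powr (\<beta> - 1) * \<phi> t)\<bar>
      \<le> 4 * H * Q + 2 * H / \<beta> * Q"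
  proof -
    define k where "k t = (x - t) powr (\<beta> - 1) - (x' - t) powr (\<beta> - 1)" for t
    have i: "(\<lambda>t. (x' - t) powr (\<beta> - 1) * \<phi> t) integrable_on {0..x}" "(\<lambda>t. (x - t) powr (\<beta> - 1) * \<phi> t) integrable_on {0..x}"
      using h \<beta> by (auto intro!: kernel_integrable c\<phi>)
    have K: "(k has_integral (x powr \<beta> / \<beta> - (x' powr \<beta> - (x' - x) powr \<beta>) / \<beta>)) {0..x}"
      unfolding k_def using kernel_has_integral[OF \<beta>(1), of 0 x x] kernel_has_integral[OF \<beta>(1), of 0 x x'] x h
      by (intro has_integral_diff) auto
    define c1 where "c1 = (h * (4 * x powr (\<beta> - 2))) * (H * h powr \<beta>)"
    define c2 where "c2 = H * (h * (2 * x powr (\<beta> - 1)))"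
    have c: "0 \<le> c1" "0 \<le> c2" using H h by (auto simp: c1_def c2_def)
    have "((\<lambda>t. c1 + c2 * k t) has_integral (c1 * x + c2 * (x powr \<beta> / \<beta> - (x' powr \<beta> - (x' - x) powr \<beta>) / \<beta>))) {0..x}"
      using has_integral_const_real[of c1 0 x] x
      by (intro has_integral_add has_integral_mult_right K) (auto simp: mult.commute)
    then have "\<bar>integral {0..x} (\<lambda>t. (x' - t) powr (\<beta> - 1) * \<phi> t - (x - t) powr (\<beta> - 1) * \<phi> t)\<bar>
        \<le> c1 * x + c2 * (x powr \<beta> / \<beta> - (x' powr \<beta> - (x' - x) powr \<beta>) / \<beta>)"
    proof (rule integral_bound_except_point[where p = x, rotated])
      fix t assume t: "t \<in> {0..x}" "t \<noteq> x"
      have kpos: "0 \<le> k t" unfolding k_def using powr_mono2'[of "\<beta> - 1" "x - t" "x' - t"] t h \<beta> by simp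
      have "\<bar>k t * \<phi> t\<bar> \<le> c1 + c2 * k t"
      proof (cases "t \<le> x / 2")
        case True
        have "k t \<le> (x' - x) * (x - t) powr (\<beta> - 2)"
          unfolding k_def using kernel_diff_bound[of "x - t" "x' - t"] t h by simp
        also have "\<dots> \<le> h * (x / 2) powr (\<beta> - 2)"
          using True h \<beta> x by (intro mult_mono powr_mono2') auto
        also have "\<dots> \<le> h * (4 * x powr (\<beta> - 2))"
          using powr_half_le(2)[OF x(1)] h by (intro mult_left_mono) auto
        finally have "\<bar>k t\<bar> * \<bar>\<phi> t\<bar> \<le> (h * (4 * x powr (\<beta> - 2))) * (H * h powr \<beta>)"
          using kpos \<phi>1[of t] t h by (intro mult_mono) auto
        then show ?thesis using c kpos by (simp add: abs_mult c1_def add_increasing2)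
      next
        case False
        have "\<bar>\<phi> t\<bar> \<le> H * (h * (x / 2) powr (\<beta> - 1))" using \<phi>2[of "x / 2" t] False x t h by simp
        also have "\<dots> \<le> c2" unfolding c2_def using powr_half_le(1)[OF x(1)] h H by (intro mult_left_mono) auto
        finally have "\<bar>k t\<bar> * \<bar>\<phi> t\<bar> \<le> k t * c2" using kpos by (intro mult_mono) auto
        then show ?thesis using c by (simp add: abs_mult mult.commute add_increasing)
      qed
      then show "\<bar>(x' - t) powr (\<beta> - 1) * \<phi> t - (x - t) powr (\<beta> - 1) * \<phi> t\<bar> \<le> c1 + c2 * k t"
        unfolding k_def left_diff_distrib[symmetric] by (simp add: abs_mult abs_minus_commute)
    qed (use i in \<open>auto intro: integrable_diff\<close>)
    also have "\<dots> \<le> c1 * x + c2 * (h powr \<beta> / \<beta>)"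
    proof -
      have "x powr \<beta> \<le> x' powr \<beta>" "(x' - x) powr \<beta> \<le> h powr \<beta>" using h x \<beta> by (intro powr_mono2; simp)+
      then have "x powr \<beta> / \<beta> - (x' powr \<beta> - (x' - x) powr \<beta>) / \<beta> \<le> h powr \<beta> / \<beta>"
        unfolding diff_divide_distrib[symmetric] using \<beta> by (intro divide_right_mono) auto
      then show ?thesis using c by (intro add_left_mono mult_left_mono)
    qed
    also have "c1 * x = 4 * H * Q"
    proof -
      have "x * x powr (\<beta> - 2) = x powr (\<beta> - 1)" using powr_mult_base[of x "\<beta> - 2"] x by simp
      then have "c1 * x = 4 * H * (h * h powr \<beta>) * x powr (\<beta> - 1)" unfolding c1_def by (metis (no_types, opaque_lifting) mult.assoc mult.commute mult.left_commute)
      then show ?thesis using h by (simp add: Q_def powr_add)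
    qed
    also have "c2 * (h powr \<beta> / \<beta>) = 2 * H / \<beta> * Q" using h by (simp add: c2_def Q_def powr_add)
    finally show ?thesis using integral_diff[OF i] by simp
  qed
  have "Gamma \<beta> * \<bar>(frac_int \<beta> g (x' + h) - frac_int \<beta> g x') - (frac_int \<beta> g (x + h) - frac_int \<beta> g x)\<bar>
      = \<bar>Gamma \<beta> * ((frac_int \<beta> g (x' + h) - frac_int \<beta> g x') - (frac_int \<beta> g (x + h) - frac_int \<beta> g x))\<bar>"
    using Gamma_real_pos[OF \<beta>(1)] by (simp add: abs_mult)
  also have "\<dots> \<le> M * P + (4 * H * Q + 2 * H / \<beta> * Q) + H / \<beta> * Q"
    unfolding decomp using 1 2 3 by linarith
  also have "\<dots> \<le> (M + 4 * H + 3 * H / \<beta>) * (P + Q)"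
  proof -
    have "(M + 4 * H + 3 * H / \<beta>) * (P + Q) - (M * P + (4 * H * Q + 2 * H / \<beta> * Q) + H / \<beta> * Q)
        = M * Q + (4 * H + 3 * (H / \<beta>)) * P" by (simp add: algebra_simps add_divide_distrib)
    moreover have "0 \<le> M * Q + (4 * H + 3 * (H / \<beta>)) * P" using PQ M0 H \<beta> by simp
    ultimately show ?thesis by linarith
  qed
  finally show ?thesis
    using Gamma_real_pos[OF \<beta>(1)] by (simp add: P_def Q_def field_simps)
qed

end

section \<open>The truncation error\<close>

text \<open>
  One of the factors may be frozen at \<open>j/2\<close>, according to which of \<open>k\<close> and \<open>j - k\<close> is larger.
\<close>

lemma powr_product_split:
  fixes j k p \<gamma> :: real
  assumes "0 < k" "k < j" "0 \<le> p" "0 \<le> \<gamma>"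
  shows "(j - k) powr (- p) * k powr (- \<gamma>)
    \<le> 2 powr p * j powr (- p) * k powr (- \<gamma>) + 2 powr \<gamma> * j powr (- \<gamma>) * (j - k) powr (- p)"
proof -
  have half: "(j / 2) powr (- a) = 2 powr a * j powr (- a)" for a
    using assms by (simp add: powr_divide powr_minus field_simps)
  show ?thesis
  proof (cases "k \<le> j / 2")
    case True
    then have "(j - k) powr (- p) \<le> (j / 2) powr (- p)" using assms by (intro powr_mono2') auto
    then have "(j - k) powr (- p) * k powr (- \<gamma>) \<le> 2 powr p * j powr (- p) * k powr (- \<gamma>)"
      unfolding half by (intro mult_right_mono) auto
    then show ?thesis by (simp add: add_increasing2)
  next
    case False
    then have "k powr (- \<gamma>) \<le> (j / 2) powr (- \<gamma>)" using assms by (intro powr_mono2') auto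
    then have "k powr (- \<gamma>) * (j - k) powr (- p) \<le> 2 powr \<gamma> * j powr (- \<gamma>) * (j - k) powr (- p)"
      unfolding half by (intro mult_right_mono) auto
    then show ?thesis by (simp add: add_increasing mult.commute)
  qed
qed

lemma sum_powr_convolution_split:
  fixes p \<gamma> :: real
  assumes "0 \<le> p" "0 \<le> \<gamma>"
  shows "(\<Sum>k=1..<j. real (j - k) powr (- p) * real k powr (- \<gamma>))
    \<le> 2 powr p * real j powr (- p) * (\<Sum>k=1..<j. real k powr (- \<gamma>))
      + 2 powr \<gamma> * real j powr (- \<gamma>) * (\<Sum>k=1..<j. real k powr (- p))"
proof -
  have "(\<Sum>k=1..<j. real (j - k) powr (- p) * real k powr (- \<gamma>))
    \<le> (\<Sum>k=1..<j. 2 powr p * real j powr (- p) * real k powr (- \<gamma>) + 2 powr \<gamma> * real j powr (- \<gamma>) * real (j - k) powr (- p))"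
  proof (rule sum_mono)
    fix k assume "k \<in> {1..<j}"
    then show "real (j - k) powr (- p) * real k powr (- \<gamma>)
      \<le> 2 powr p * real j powr (- p) * real k powr (- \<gamma>) + 2 powr \<gamma> * real j powr (- \<gamma>) * real (j - k) powr (- p)"
      using powr_product_split[of "real k" "real j" p \<gamma>] assms by (simp add: of_nat_diff)
  qed
  also have "\<dots> = 2 powr p * real j powr (- p) * (\<Sum>k=1..<j. real k powr (- \<gamma>))
      + 2 powr \<gamma> * real j powr (- \<gamma>) * (\<Sum>k=1..<j. real (j - k) powr (- p))"
    by (simp add: sum.distrib sum_distrib_left)
  also have "(\<Sum>k=1..<j. real (j - k) powr (- p)) = (\<Sum>k=1..<j. real k powr (- p))"
    by (rule sum.reindex_bij_witness[of _ "\<lambda>k. j - k" "\<lambda>k. j - k"]) auto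
  finally show ?thesis .
qed

lemma sum_powr_le:
  assumes "0 < p" "p < 1"
  shows "(\<Sum>k=1..<j. real k powr (- p)) \<le> real j powr (1 - p) / (1 - p)"
proof (cases "1 \<le> j")
  case True
  have "(1 - p) * (\<Sum>k=1..<j. real k powr (- p)) \<le> (\<Sum>k=1..<j. wgt p k)"
    unfolding sum_distrib_left by (intro sum_mono wgt_ge assms) auto
  also have "(\<Sum>k=1..<j. wgt p k) = real (j - 1) powr (1 - p)"
    using True by (induction j rule: dec_induct) (auto simp: wgt_def)
  also have "\<dots> \<le> real j powr (1 - p)" using assms by (intro powr_mono2) auto
  finally show ?thesis using assms by (simp add: field_simps)
qed (use assms in simp)

context
  fixes \<beta> :: real
  assumes \<beta>: "0 < \<beta>" "\<beta> < 1"
begin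

lemma convolution_sums_bounded:
  "\<exists>S\<ge>0. \<forall>j\<ge>1. (\<Sum>k=1..<j. real (j - k) powr (- \<beta>) * real k powr (\<beta> - 2)) \<le> S * real j powr (- \<beta>)
      \<and> (\<Sum>k=1..<j. real (j - k) powr (- \<beta>) * real k powr (\<beta> - 1)) \<le> S"
proof -
  let ?A = "\<lambda>j. \<Sum>k=1..<j. real (j - k) powr (- \<beta>) * real k powr (\<beta> - 2)"
  let ?B = "\<lambda>j. \<Sum>k=1..<j. real (j - k) powr (- \<beta>) * real k powr (\<beta> - 1)"
  have summ: "summable (\<lambda>n. real n powr (\<beta> - 2))" using \<beta> by (subst summable_real_powr_iff) auto
  define Z where "Z = (\<Sum>n. real n powr (\<beta> - 2))"
  have Z: "(\<Sum>k=1..<j. real k powr (\<beta> - 2)) \<le> Z" for j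
    unfolding Z_def by (intro sum_le_suminf summ) auto
  have Z0: "0 \<le> Z" using Z[of 1] by simp
  define S1 where "S1 = 2 powr \<beta> * Z + 2 powr (2 - \<beta>) / (1 - \<beta>)"
  define S2 where "S2 = 2 powr \<beta> / \<beta> + 2 powr (1 - \<beta>) / (1 - \<beta>)"
  have S0: "0 \<le> S1" "0 \<le> S2" using Z0 \<beta> by (auto simp: S1_def S2_def)
  have "?A j \<le> S1 * real j powr (- \<beta>)
      \<and> ?B j \<le> S2" if j: "1 \<le> j" for j
  proof
    have "?A j
      \<le> 2 powr \<beta> * real j powr (- \<beta>) * (\<Sum>k=1..<j. real k powr (\<beta> - 2))
        + 2 powr (2 - \<beta>) * real j powr (\<beta> - 2) * (\<Sum>k=1..<j. real k powr (- \<beta>))"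
      using sum_powr_convolution_split[of \<beta> "2 - \<beta>" j] \<beta> by simp
    also have "\<dots> \<le> 2 powr \<beta> * real j powr (- \<beta>) * Z
        + 2 powr (2 - \<beta>) * real j powr (\<beta> - 2) * (real j powr (1 - \<beta>) / (1 - \<beta>))"
      using Z sum_powr_le[OF \<beta>] by (intro add_mono mult_left_mono) auto
    also have "\<dots> = 2 powr \<beta> * real j powr (- \<beta>) * Z + 2 powr (2 - \<beta>) / (1 - \<beta>) * (real j powr (\<beta> - 2) * real j powr (1 - \<beta>))"
      by simp
    also have "real j powr (\<beta> - 2) * real j powr (1 - \<beta>) = real j powr (- 1)"
      unfolding powr_add[symmetric] by simp
    also have "2 powr \<beta> * real j powr (- \<beta>) * Z + 2 powr (2 - \<beta>) / (1 - \<beta>) * real j powr (- 1) \<le> 2 powr \<beta> * real j powr (- \<beta>) * Z + 2 powr (2 - \<beta>) / (1 - \<beta>) * real j powr (- \<beta>)"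
      using j \<beta> by (intro add_left_mono mult_left_mono powr_mono) auto
    finally show "?A j \<le> S1 * real j powr (- \<beta>)"
      by (simp add: S1_def algebra_simps)
    have "?B j
      \<le> 2 powr \<beta> * real j powr (- \<beta>) * (\<Sum>k=1..<j. real k powr (\<beta> - 1))
        + 2 powr (1 - \<beta>) * real j powr (\<beta> - 1) * (\<Sum>k=1..<j. real k powr (- \<beta>))"
      using sum_powr_convolution_split[of \<beta> "1 - \<beta>" j] \<beta> by simp
    also have "\<dots> \<le> 2 powr \<beta> * real j powr (- \<beta>) * (real j powr \<beta> / \<beta>)
        + 2 powr (1 - \<beta>) * real j powr (\<beta> - 1) * (real j powr (1 - \<beta>) / (1 - \<beta>))"
      using sum_powr_le[OF \<beta>] sum_powr_le[of "1 - \<beta>" j] \<beta> by (intro add_mono mult_left_mono) auto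
    also have "\<dots> = 2 powr \<beta> / \<beta> * (real j powr (- \<beta>) * real j powr \<beta>)
        + 2 powr (1 - \<beta>) / (1 - \<beta>) * (real j powr (\<beta> - 1) * real j powr (1 - \<beta>))" by simp
    also have "\<dots> = S2" using j unfolding powr_add[symmetric] by (simp add: S2_def)
    finally show "?B j \<le> S2" .
  qed
  note bounds = this
  show ?thesis
  proof (intro exI[of _ "S1 + S2"] conjI allI impI)
    fix j :: nat assume j: "1 \<le> j"
    have "S1 * real j powr (- \<beta>) \<le> (S1 + S2) * real j powr (- \<beta>)" using S0 by (intro mult_right_mono) auto
    then show "?A j \<le> (S1 + S2) * real j powr (- \<beta>)"
      using bounds[OF j] by linarith
    show "?B j \<le> S1 + S2"
      using bounds[OF j] S0 by linarith
  qed (use S0 in simp)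
qed

lemma integral_mesh:
  fixes f :: "real \<Rightarrow> real"
  assumes "0 \<le> h" "f integrable_on {0..real j * h}"
  shows "integral {0..real j * h} f = (\<Sum>k<j. integral {0..h} (\<lambda>s. f (real k * h + s)))"
  using assms(2)
proof (induction j)
  case (Suc j)
  have le: "real j * h \<le> real (Suc j) * h" using assms(1) by (intro mult_right_mono) auto
  have "f integrable_on {0..real j * h}"
    by (rule integrable_on_subinterval[OF Suc.prems]) (use le in auto)
  from Suc.IH[OF this] have IH: "integral {0..real j * h} f = (\<Sum>k<j. integral {0..h} (\<lambda>s. f (real k * h + s)))" .
  have "integral {0..real (Suc j) * h} f = integral {0..real j * h} f + integral {real j * h..real (Suc j) * h} f"
    using le assms(1) Suc.prems
    by (intro integral_split) auto
  also have "integral {real j * h..real (Suc j) * h} f = integral {0..h} (\<lambda>s. f (real j * h + s))"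
    using integral_shift_real_ivl[of "real j * h" "real j * h" "real (Suc j) * h" f]
    by (simp add: algebra_simps)
  finally show ?case using IH by simp
qed simp

text \<open>
  Let \<open>V = I\<^sup>1\<^sup>-\<^sup>\<beta> W\<close> and \<open>K\<^sub>r s = (r h - s)\<^sup>-\<^sup>\<beta>\<close> on the reference cell \<open>[0,h]\<close>. Cutting the integral into cells,
  \<open>\<Gamma>(1 - \<beta>) (V x\<^sub>j\<^sub>+\<^sub>1 - V x\<^sub>j)\<close> is \<open>\<integral> K\<^sub>j\<^sub>+\<^sub>1 W\<close> plus the sum of \<open>\<integral> K\<^sub>j\<^sub>-\<^sub>k D\<^sub>k\<close>, where
  \<open>D\<^sub>k s = W (x\<^sub>k\<^sub>+\<^sub>1 + s) - W (x\<^sub>k + s)\<close>. Since \<open>\<integral> K\<^sub>r\<close> is a multiple of \<open>d\<^sub>r\<close>, the discrete operator is the same sum with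
  \<open>D\<^sub>k\<close> replaced by its mean \<open>a\<^sub>k\<close> over the cell. So the discrete operator differs from the mean of \<open>g = V'\<close> over
  \<open>[x\<^sub>j, x\<^sub>j\<^sub>+\<^sub>1]\<close> only by the oscillation of \<open>D\<^sub>k\<close>, a second difference of \<open>W\<close>, and by the first term, which
  is \<open>O(j\<^sup>-\<^sup>\<beta>)\<close>. After scaling, the oscillation is \<open>O(k\<^sup>\<beta>\<^sup>-\<^sup>2 + h\<^sup>\<beta> k\<^sup>\<beta>\<^sup>-\<^sup>1)\<close>, and its convolution with
  \<open>d\<^sub>r = O(r\<^sup>-\<^sup>\<beta>)\<close> is \<open>O(j\<^sup>-\<^sup>\<beta> + h\<^sup>\<beta>)\<close>; finally \<open>h \<le> 1/j\<close>, and
  the mean of \<open>g\<close> differs from \<open>g x\<^sub>j\<close> by \<open>O(h\<^sup>\<beta>)\<close>.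

  In the application \<open>U k\<close> is the difference quotient of the solution on the \<open>k\<close>-th cell.
\<close>

lemma truncation_error:
  assumes cW: "continuous_on {0..1} W" and cg: "continuous_on {0..1} g"
    and W0: "W 0 = 0" and lW: "wlip \<beta> HW W" and lg: "wlip \<beta> Hg g"
    and V: "\<And>x. x \<in> {0..1} \<Longrightarrow> frac_int (1 - \<beta>) W x = integral {0..x} g"
    and "0 \<le> C2"
    and W2: "\<And>h x x'. 0 < h \<Longrightarrow> h \<le> x \<Longrightarrow> x \<le> x' \<Longrightarrow> x' \<le> x + h \<Longrightarrow> x' + h \<le> 1 \<Longrightarrow>
      \<bar>(W (x' + h) - W x') - (W (x + h) - W x)\<bar> \<le> C2 * (h\<^sup>2 * x powr (\<beta> - 2) + h powr (1 + \<beta>) * x powr (\<beta> - 1))"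
  shows "\<exists>C\<ge>0. \<forall>N j U. 1 \<le> j \<longrightarrow> j < N \<longrightarrow>
    (\<forall>k\<le>j. U k = U0 + real N * integral {0..1 / real N} (\<lambda>s. W (real k * (1 / real N) + s))) \<longrightarrow>
    \<bar>real N powr \<beta> / Gamma (2 - \<beta>) * dcaputo \<beta> U j - g (real j * (1 / real N))\<bar> \<le> C * real j powr (- \<beta>)"
proof -
  let ?A = "\<lambda>j. \<Sum>k=1..<j. real (j - k) powr (- \<beta>) * real k powr (\<beta> - 2)"
  let ?B = "\<lambda>j. \<Sum>k=1..<j. real (j - k) powr (- \<beta>) * real k powr (\<beta> - 1)"
  obtain S where S: "0 \<le> S" and S1: "\<And>j. 1 \<le> j \<Longrightarrow> ?A j \<le> S * real j powr (- \<beta>)"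
    and S2: "\<And>j. 1 \<le> j \<Longrightarrow> ?B j \<le> S"
    using convolution_sums_bounded by blast
  have H: "0 \<le> HW" "0 \<le> Hg" using lW lg by (auto dest: wlip_nonneg)
  define \<Gamma> where "\<Gamma> = Gamma (1 - \<beta>)"
  have \<Gamma>: "0 < \<Gamma>" using \<beta> by (simp add: \<Gamma>_def)
  have \<Gamma>2: "Gamma (2 - \<beta>) = (1 - \<beta>) * \<Gamma>" using Gamma_add_1[of "1 - \<beta>"] \<beta> by (simp add: \<Gamma>_def)
  define C where "C = (3 * HW + 2 * C2 * S) / ((1 - \<beta>) * \<Gamma>) + Hg"
  have C: "0 \<le> C" using H \<open>0 \<le> C2\<close> S \<Gamma> \<beta> by (simp add: C_def)
  have "\<bar>real N powr \<beta> / Gamma (2 - \<beta>) * dcaputo \<beta> U j - g (real j * (1 / real N))\<bar> \<le> C * real j powr (- \<beta>)"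
    if j: "1 \<le> j" "j < N"
    and U: "\<And>k. k \<le> j \<Longrightarrow> U k = U0 + real N * integral {0..1 / real N} (\<lambda>s. W (real k * (1 / real N) + s))" for N j U
  proof -
    define h where "h = 1 / real N"
    have h: "0 < h" "h \<le> 1" "real N * h = 1" using j by (auto simp: h_def)
    have kh: "real k * h \<le> 1" if "k \<le> N" for k using that j by (simp add: h_def field_simps)
    define p where "p r s = (real r * h - s) powr ((1 - \<beta>) - 1)" for r s
    define D where "D k s = W (real (Suc k) * h + s) - W (real k * h + s)" for k s
    have khs: "real k * h + s \<in> {0..1}" if "k < N" "s \<in> {0..h}" for k s
    proof -
      have "real (Suc k) * h \<le> 1" using that by (intro kh) auto
      then have "real k * h + h \<le> 1" by (simp add: algebra_simps)
      then show ?thesis using that h by auto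
    qed
    have cWk: "continuous_on {0..h} (\<lambda>s. W (real k * h + s))" if "k < N" for k
    proof -
      have "(\<lambda>s. real k * h + s) ` {0..h} \<subseteq> {0..1}" using khs[OF that] by blast
      then show ?thesis by (intro continuous_on_compose2[OF cW] continuous_intros)
    qed
    have cD: "continuous_on {0..h} (D k)" if "k < j" for k
      unfolding D_def[abs_def] using that j by (intro continuous_intros cWk) auto
    have h\<beta>: "h powr \<beta> \<le> real j powr (- \<beta>)"
    proof -
      have "h powr \<beta> = real N powr (- \<beta>)" using j by (simp add: h_def powr_divide powr_minus field_simps)
      also have "\<dots> \<le> real j powr (- \<beta>)" using j \<beta> by (intro powr_mono2') auto
      finally show ?thesis .
    qed
    have pint: "((p r) has_integral (h powr (1 - \<beta>) * wgt \<beta> r / (1 - \<beta>))) {0..h}" if r: "1 \<le> r" for r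
    proof -
      have "1 * h \<le> real r * h" using r h by (intro mult_right_mono) auto
      from kernel_has_integral[of "1 - \<beta>" 0 h "real r * h"] this \<beta> h have
        "((p r) has_integral ((real r * h) powr (1 - \<beta>) - (real r * h - h) powr (1 - \<beta>)) / (1 - \<beta>)) {0..h}"
        unfolding p_def by simp
      moreover have "real r * h - h = real (r - 1) * h" using r by (simp add: of_nat_diff algebra_simps)
      ultimately show ?thesis using h by (simp add: powr_mult wgt_def algebra_simps)
    qed
    have pprod: "(\<lambda>s. p r s * \<phi> s) integrable_on {0..h}"
      and pbound: "(\<And>s. s \<in> {0..h} \<Longrightarrow> \<bar>\<phi> s\<bar> \<le> K) \<Longrightarrow>
        \<bar>integral {0..h} (\<lambda>s. p r s * \<phi> s)\<bar> \<le> K * (h powr (1 - \<beta>) * wgt \<beta> r / (1 - \<beta>))"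
      if r: "1 \<le> r" and c: "continuous_on {0..h} \<phi>" for r \<phi> K
    proof -
      have rh: "h \<le> real r * h" using mult_right_mono[of 1 "real r" h] r h by simp
      show "(\<lambda>s. p r s * \<phi> s) integrable_on {0..h}"
        unfolding p_def using \<beta> rh c by (intro kernel_integrable) auto
      assume "\<And>s. s \<in> {0..h} \<Longrightarrow> \<bar>\<phi> s\<bar> \<le> K"
      then have "\<bar>integral {0..h} (\<lambda>s. p r s * \<phi> s)\<bar> \<le> K * (((real r * h - 0) powr (1 - \<beta>) - (real r * h - h) powr (1 - \<beta>)) / (1 - \<beta>))"
        unfolding p_def using \<beta> rh c h by (intro kernel_bound) auto
      moreover have "((real r * h - 0) powr (1 - \<beta>) - (real r * h - h) powr (1 - \<beta>)) / (1 - \<beta>) = h powr (1 - \<beta>) * wgt \<beta> r / (1 - \<beta>)"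
        using has_integral_unique[OF pint[OF r]] kernel_has_integral[of "1 - \<beta>" 0 h "real r * h"] \<beta> h rh
        unfolding p_def by simp
      ultimately show "\<bar>integral {0..h} (\<lambda>s. p r s * \<phi> s)\<bar> \<le> K * (h powr (1 - \<beta>) * wgt \<beta> r / (1 - \<beta>))" by (simp only:)
    qed
    have frac: "\<Gamma> * frac_int (1 - \<beta>) W (real n * h) = (\<Sum>k<n. integral {0..h} (\<lambda>s. p (n - k) s * W (real k * h + s)))"
      if n: "n \<le> N" for n
    proof -
      have "\<Gamma> * frac_int (1 - \<beta>) W (real n * h) = integral {0..real n * h} (\<lambda>t. (real n * h - t) powr ((1 - \<beta>) - 1) * W t)"
        using \<Gamma> by (simp add: frac_int_def \<Gamma>_def)
      also have "\<dots> = (\<Sum>k<n. integral {0..h} (\<lambda>s. (real n * h - (real k * h + s)) powr ((1 - \<beta>) - 1) * W (real k * h + s)))"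
        using \<beta> h kh[OF n] by (intro integral_mesh kernel_integrable continuous_on_subset[OF cW]) auto
      also have "\<dots> = (\<Sum>k<n. integral {0..h} (\<lambda>s. p (n - k) s * W (real k * h + s)))"
        by (intro sum.cong refl) (simp add: p_def of_nat_diff algebra_simps)
      finally show ?thesis .
    qed
    have "\<Gamma> * frac_int (1 - \<beta>) W (real (Suc j) * h) - \<Gamma> * frac_int (1 - \<beta>) W (real j * h)
      = integral {0..h} (\<lambda>s. p (Suc j) s * W s)
        + (\<Sum>k<j. integral {0..h} (\<lambda>s. p (j - k) s * W (real (Suc k) * h + s)) - integral {0..h} (\<lambda>s. p (j - k) s * W (real k * h + s)))"
      using j by (subst (1 2) frac) (auto simp: sum.lessThan_Suc_shift sum_subtractf simp del: sum.lessThan_Suc of_nat_Suc)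
    also have "(\<Sum>k<j. integral {0..h} (\<lambda>s. p (j - k) s * W (real (Suc k) * h + s)) - integral {0..h} (\<lambda>s. p (j - k) s * W (real k * h + s)))
      = (\<Sum>k<j. integral {0..h} (\<lambda>s. p (j - k) s * D k s))"
    proof (intro sum.cong refl)
      fix k assume "k \<in> {..<j}"
      then have k: "k < j" "Suc k < N" "k < N" using j by auto
      show "integral {0..h} (\<lambda>s. p (j - k) s * W (real (Suc k) * h + s)) - integral {0..h} (\<lambda>s. p (j - k) s * W (real k * h + s))
        = integral {0..h} (\<lambda>s. p (j - k) s * D k s)"
        unfolding D_def right_diff_distrib
        using k by (intro integral_diff[symmetric] pprod cWk) auto
    qed
    finally have fracdiff: "\<Gamma> * frac_int (1 - \<beta>) W (real (Suc j) * h) - \<Gamma> * frac_int (1 - \<beta>) W (real j * h)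
      = integral {0..h} (\<lambda>s. p (Suc j) s * W s) + (\<Sum>k<j. integral {0..h} (\<lambda>s. p (j - k) s * D k s))" .
    define a where "a k = U (Suc k) - U k" for k
    have a: "a k = real N * integral {0..h} (D k)" if k: "k < j" for k
    proof -
      have "integral {0..h} (D k) = integral {0..h} (\<lambda>s. W (real (Suc k) * h + s)) - integral {0..h} (\<lambda>s. W (real k * h + s))"
        unfolding D_def[abs_def] using k j
        by (intro integral_diff integrable_continuous_real cWk) auto
      then show ?thesis using U[of k] U[of "Suc k"] k by (simp add: a_def h_def right_diff_distrib)
    qed
    have osc: "\<bar>D k s - a k\<bar> \<le> K" if k: "k < j" and s: "s \<in> {0..h}"
      and K: "\<And>s s'. s \<in> {0..h} \<Longrightarrow> s' \<in> {0..h} \<Longrightarrow> \<bar>D k s - D k s'\<bar> \<le> K" for k s K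
    proof -
      have "integral {0..h} (\<lambda>s'. D k s - D k s') = h * D k s - integral {0..h} (D k)"
        using h integral_diff[of "\<lambda>_. D k s" "{0..h}" "D k", OF integrable_const_ivl integrable_continuous_real[OF cD[OF k]]]
        by simp
      moreover have "\<bar>integral {0..h} (\<lambda>s'. D k s - D k s')\<bar> \<le> K * (h - 0)"
        unfolding real_norm_def[symmetric] using h K s
        by (intro integral_bound continuous_intros cD k) auto
      ultimately have "\<bar>h * D k s - integral {0..h} (D k)\<bar> \<le> K * h" by simp
      moreover have "h * (D k s - a k) = h * D k s - integral {0..h} (D k)"
        using a[OF k] h by (simp add: right_diff_distrib mult.assoc[symmetric] mult.commute)
      ultimately have "h * \<bar>D k s - a k\<bar> \<le> h * K" using h by (metis abs_mult abs_of_pos mult.commute)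
      then show ?thesis using h by simp
    qed
    define o' where "o' k = (if k = 0 then 2 * HW else C2 * (real k powr (\<beta> - 2) + h powr \<beta> * real k powr (\<beta> - 1)))" for k :: nat
    have oscb: "\<bar>D k s - a k\<bar> \<le> o' k * h powr \<beta>" if k: "k < j" and s: "s \<in> {0..h}" for k s
    proof (rule osc[OF k s])
      fix s s' assume s: "s \<in> {0..h}" "s' \<in> {0..h}"
      show "\<bar>D k s - D k s'\<bar> \<le> o' k * h powr \<beta>"
      proof (cases "k = 0")
        case True
        have "1 < N" using j by simp
        then have "\<bar>D 0 s\<bar> \<le> HW * h powr \<beta>" if "s \<in> {0..h}" for s
          using wlip_holder[OF \<beta> lW, of s "h + s"] that khs[of 1 s] by (simp add: D_def)
        from this[OF s(1)] this[OF s(2)] show ?thesis using True by (simp add: o'_def)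
      next
        case False
        have main: "\<bar>D k s' - D k s\<bar> \<le> o' k * h powr \<beta>" if s: "s \<in> {0..h}" "s' \<in> {0..h}" "s \<le> s'" for s s'
        proof -
          define x where "x = real k * h"
          have x: "h \<le> x" using mult_right_mono[of 1 "real k" h] False h by (simp add: x_def)
          have x1: "real k * h + s' + h \<le> 1"
          proof -
            have "real k * h + (h + h) = real (Suc (Suc k)) * h" by (simp add: algebra_simps)
            also have "\<dots> \<le> 1" using k j by (intro kh) auto
            finally show ?thesis using s by auto
          qed
          have "\<bar>D k s' - D k s\<bar> \<le> C2 * (h\<^sup>2 * (x + s) powr (\<beta> - 2) + h powr (1 + \<beta>) * (x + s) powr (\<beta> - 1))"
          proof -
            have "D k s' - D k s = (W (x + s' + h) - W (x + s')) - (W (x + s + h) - W (x + s))"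
              by (simp add: D_def x_def algebra_simps)
            then show ?thesis using W2[of h "x + s" "x + s'"] s x x1[folded x_def] h by simp
          qed
          also have "\<dots> \<le> C2 * (h\<^sup>2 * x powr (\<beta> - 2) + h powr (1 + \<beta>) * x powr (\<beta> - 1))"
            using s x h \<beta> \<open>0 \<le> C2\<close> by (intro mult_left_mono add_mono powr_mono2') auto
          also have "h\<^sup>2 * x powr (\<beta> - 2) = h powr \<beta> * real k powr (\<beta> - 2)"
          proof -
            have "h\<^sup>2 * h powr (\<beta> - 2) = h powr 2 * h powr (\<beta> - 2)" using h by (simp add: powr_numeral)
            also have "\<dots> = h powr \<beta>" unfolding powr_add[symmetric] by simp
            finally show ?thesis using h by (simp add: x_def powr_mult)
          qed
          also have "h powr (1 + \<beta>) * x powr (\<beta> - 1) = (h powr \<beta> * h powr \<beta>) * real k powr (\<beta> - 1)"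
          proof -
            have "h powr (1 + \<beta>) * h powr (\<beta> - 1) = h powr \<beta> * h powr \<beta>" unfolding powr_add[symmetric] by simp
            then show ?thesis using h by (simp add: x_def powr_mult)
          qed
          finally show ?thesis using False by (simp add: o'_def algebra_simps)
        qed
        show ?thesis using main[of s s'] main[of s' s] s by (cases "s \<le> s'") (auto simp: abs_minus_commute)
      qed
    qed
    define c where "c = h powr (1 - \<beta>) / (1 - \<beta>)"
    have c: "0 \<le> c" "c * h powr \<beta> = h / (1 - \<beta>)"
      using \<beta> h by (auto simp: c_def powr_add[symmetric])
    have "c * dcaputo \<beta> U j = (\<Sum>k<j. integral {0..h} (\<lambda>s. p (j - k) s * a k))"
      unfolding dcaputo_def sum_distrib_left
    proof (intro sum.cong refl)
      fix k assume "k \<in> {..<j}"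
      then have "((\<lambda>s. p (j - k) s * a k) has_integral (h powr (1 - \<beta>) * wgt \<beta> (j - k) / (1 - \<beta>) * a k)) {0..h}"
        by (intro has_integral_mult_left pint) auto
      from integral_unique[OF this] show "c * (wgt \<beta> (j - k) * (U (Suc k) - U k)) = integral {0..h} (\<lambda>s. p (j - k) s * a k)"
        by (simp add: c_def a_def)
    qed
    then have "\<Gamma> * frac_int (1 - \<beta>) W (real (Suc j) * h) - \<Gamma> * frac_int (1 - \<beta>) W (real j * h) - c * dcaputo \<beta> U j
      = integral {0..h} (\<lambda>s. p (Suc j) s * W s)
        + (\<Sum>k<j. integral {0..h} (\<lambda>s. p (j - k) s * D k s) - integral {0..h} (\<lambda>s. p (j - k) s * a k))"
      unfolding fracdiff by (simp add: sum_subtractf)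
    also have "(\<Sum>k<j. integral {0..h} (\<lambda>s. p (j - k) s * D k s) - integral {0..h} (\<lambda>s. p (j - k) s * a k))
        = (\<Sum>k<j. integral {0..h} (\<lambda>s. p (j - k) s * (D k s - a k)))"
    proof (intro sum.cong refl)
      fix k assume "k \<in> {..<j}"
      then show "integral {0..h} (\<lambda>s. p (j - k) s * D k s) - integral {0..h} (\<lambda>s. p (j - k) s * a k)
        = integral {0..h} (\<lambda>s. p (j - k) s * (D k s - a k))"
        unfolding right_diff_distrib by (intro integral_diff[symmetric] pprod cD continuous_intros) auto
    qed
    also have "\<bar>integral {0..h} (\<lambda>s. p (Suc j) s * W s) + \<dots>\<bar>
      \<le> \<bar>integral {0..h} (\<lambda>s. p (Suc j) s * W s)\<bar> + (\<Sum>k<j. \<bar>integral {0..h} (\<lambda>s. p (j - k) s * (D k s - a k))\<bar>)"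
      by (intro order_trans[OF abs_triangle_ineq] add_left_mono sum_abs)
    also have "\<dots> \<le> (HW * h powr \<beta>) * (c * wgt \<beta> (Suc j)) + (\<Sum>k<j. (o' k * h powr \<beta>) * (c * wgt \<beta> (j - k)))"
    proof (intro add_mono sum_mono)
      show "\<bar>integral {0..h} (\<lambda>s. p (Suc j) s * W s)\<bar> \<le> (HW * h powr \<beta>) * (c * wgt \<beta> (Suc j))"
      proof -
        have "\<bar>W s\<bar> \<le> HW * h powr \<beta>" if "s \<in> {0..h}" for s
        proof -
          have "\<bar>W s\<bar> \<le> HW * s powr \<beta>" using wlip_holder[OF \<beta> lW, of 0 s] that h W0 by simp
          also have "\<dots> \<le> HW * h powr \<beta>" using that \<beta> H by (intro mult_left_mono powr_mono2) auto
          finally show ?thesis .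
        qed
        moreover have "continuous_on {0..h} W" using h by (intro continuous_on_subset[OF cW]) auto
        ultimately show ?thesis using pbound[of "Suc j" W "HW * h powr \<beta>"] by (simp add: c_def)
      qed
      fix k assume "k \<in> {..<j}"
      then have k: "k < j" by simp
      show "\<bar>integral {0..h} (\<lambda>s. p (j - k) s * (D k s - a k))\<bar> \<le> (o' k * h powr \<beta>) * (c * wgt \<beta> (j - k))"
        using pbound[of "j - k" "\<lambda>s. D k s - a k" "o' k * h powr \<beta>"] oscb[OF k] cD[OF k] k
        by (simp add: c_def continuous_on_diff)
    qed
    also have "\<dots> = (c * h powr \<beta>) * (HW * wgt \<beta> (Suc j) + (\<Sum>k<j. o' k * wgt \<beta> (j - k)))"
      by (simp add: sum_distrib_left algebra_simps)
    also have "\<dots> \<le> (c * h powr \<beta>) * ((3 * HW + 2 * C2 * S) * real j powr (- \<beta>))"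
    proof (rule mult_left_mono)
      have 1: "HW * wgt \<beta> (Suc j) \<le> HW * real j powr (- \<beta>)"
        using wgt_antimono_Suc[OF \<beta> j(1)] wgt_le[OF \<beta> j(1)] H by (intro mult_left_mono) auto
      have "(\<Sum>k<j. o' k * wgt \<beta> (j - k)) = o' 0 * wgt \<beta> j + (\<Sum>k=1..<j. o' k * wgt \<beta> (j - k))"
        using j by (simp add: lessThan_atLeast0 sum.atLeast_Suc_lessThan)
      also have "\<dots> \<le> 2 * HW * real j powr (- \<beta>) + (\<Sum>k=1..<j. C2 * (real (j - k) powr (- \<beta>) * real k powr (\<beta> - 2)
          + h powr \<beta> * (real (j - k) powr (- \<beta>) * real k powr (\<beta> - 1))))"
      proof (intro add_mono sum_mono)
        show "o' 0 * wgt \<beta> j \<le> 2 * HW * real j powr (- \<beta>)"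
          unfolding o'_def using wgt_le[OF \<beta> j(1)] H by (simp add: mult_left_mono)
        fix k assume k: "k \<in> {1..<j}"
        then have "o' k * wgt \<beta> (j - k) \<le> o' k * real (j - k) powr (- \<beta>)"
          using \<open>0 \<le> C2\<close> by (intro mult_left_mono wgt_le \<beta>) (auto simp: o'_def)
        also have "\<dots> = C2 * (real (j - k) powr (- \<beta>) * real k powr (\<beta> - 2)
          + h powr \<beta> * (real (j - k) powr (- \<beta>) * real k powr (\<beta> - 1)))"
          using k by (simp add: o'_def algebra_simps)
        finally show "o' k * wgt \<beta> (j - k) \<le> C2 * (real (j - k) powr (- \<beta>) * real k powr (\<beta> - 2)
          + h powr \<beta> * (real (j - k) powr (- \<beta>) * real k powr (\<beta> - 1)))" .
      qed
      also have "\<dots> = 2 * HW * real j powr (- \<beta>) + C2 * (?A j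
          + h powr \<beta> * ?B j)"
        by (simp add: sum_distrib_left sum.distrib distrib_left)
      also have "\<dots> \<le> 2 * HW * real j powr (- \<beta>) + C2 * (S * real j powr (- \<beta>) + real j powr (- \<beta>) * S)"
        using S1[OF j(1)] S2[OF j(1)] h\<beta> \<open>0 \<le> C2\<close> S
        by (intro add_left_mono mult_left_mono add_mono mult_mono sum_nonneg) auto
      finally show "HW * wgt \<beta> (Suc j) + (\<Sum>k<j. o' k * wgt \<beta> (j - k)) \<le> (3 * HW + 2 * C2 * S) * real j powr (- \<beta>)"
        using 1 by (simp add: algebra_simps)
    qed (use c h \<beta> in simp)
    finally have est: "\<bar>\<Gamma> * frac_int (1 - \<beta>) W (real (Suc j) * h) - \<Gamma> * frac_int (1 - \<beta>) W (real j * h) - c * dcaputo \<beta> U j\<bar>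
      \<le> (h / (1 - \<beta>)) * ((3 * HW + 2 * C2 * S) * real j powr (- \<beta>))" unfolding c(2) .
    define A where "A = integral {real j * h..real (Suc j) * h} g"
    have jh: "0 \<le> real j * h" "real j * h \<le> real (Suc j) * h" "real (Suc j) * h \<le> 1" "real (Suc j) * h = real j * h + h"
      using h kh[of "Suc j"] j by (auto simp: algebra_simps)
    have "frac_int (1 - \<beta>) W (real (Suc j) * h) - frac_int (1 - \<beta>) W (real j * h) = A"
    proof -
      have "integral {0..real (Suc j) * h} g = integral {0..real j * h} g + A"
        unfolding A_def using jh
        by (intro integral_split integrable_continuous_real continuous_on_subset[OF cg]) auto
      moreover have "real j * h \<in> {0..1}" "real (Suc j) * h \<in> {0..1}" using jh by auto
      ultimately show ?thesis using V by simp
    qed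
    with est have "\<bar>\<Gamma> * A - c * dcaputo \<beta> U j\<bar> \<le> (h / (1 - \<beta>)) * ((3 * HW + 2 * C2 * S) * real j powr (- \<beta>))"
      by (simp add: right_diff_distrib[symmetric])
    then have "\<bar>\<Gamma> * A - c * dcaputo \<beta> U j\<bar> / (h * \<Gamma>) \<le> (h / (1 - \<beta>)) * ((3 * HW + 2 * C2 * S) * real j powr (- \<beta>)) / (h * \<Gamma>)"
      using h \<Gamma> by (intro divide_right_mono) auto
    also have "\<dots> = (3 * HW + 2 * C2 * S) / ((1 - \<beta>) * \<Gamma>) * real j powr (- \<beta>)" using h by simp
    also have "\<bar>\<Gamma> * A - c * dcaputo \<beta> U j\<bar> / (h * \<Gamma>) = \<bar>A / h - real N powr \<beta> / Gamma (2 - \<beta>) * dcaputo \<beta> U j\<bar>"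
    proof -
      have "c / (h * \<Gamma>) = real N powr \<beta> / Gamma (2 - \<beta>)"
      proof -
        have "h powr (1 - \<beta>) / h = h powr (- \<beta>)" using h powr_diff[of h "1 - \<beta>" 1] by simp
        also have "\<dots> = real N powr \<beta>" using j by (simp add: h_def powr_divide powr_minus field_simps)
        finally have "h powr (1 - \<beta>) / h = real N powr \<beta>" .
        moreover have "c / (h * \<Gamma>) = (h powr (1 - \<beta>) / h) / ((1 - \<beta>) * \<Gamma>)"
          by (simp add: c_def mult_ac)
        ultimately show ?thesis by (simp only: \<Gamma>2)
      qed
      moreover have "(\<Gamma> * A - c * dcaputo \<beta> U j) / (h * \<Gamma>) = A / h - c / (h * \<Gamma>) * dcaputo \<beta> U j"
        using \<Gamma> h by (simp add: diff_divide_distrib)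
      ultimately have "(\<Gamma> * A - c * dcaputo \<beta> U j) / (h * \<Gamma>) = A / h - real N powr \<beta> / Gamma (2 - \<beta>) * dcaputo \<beta> U j"
        by (simp only:)
      moreover have "\<bar>\<Gamma> * A - c * dcaputo \<beta> U j\<bar> / (h * \<Gamma>) = \<bar>(\<Gamma> * A - c * dcaputo \<beta> U j) / (h * \<Gamma>)\<bar>"
        using h \<Gamma> unfolding abs_divide by simp
      ultimately show ?thesis by (simp only:)
    qed
    finally have e1: "\<bar>A / h - real N powr \<beta> / Gamma (2 - \<beta>) * dcaputo \<beta> U j\<bar> \<le> (3 * HW + 2 * C2 * S) / ((1 - \<beta>) * \<Gamma>) * real j powr (- \<beta>)" .
    have cgj: "continuous_on {real j * h..real (Suc j) * h} g" using jh by (intro continuous_on_subset[OF cg]) auto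
    have "\<bar>integral {real j * h..real (Suc j) * h} (\<lambda>t. g t - g (real j * h))\<bar> \<le> (Hg * h powr \<beta>) * (real (Suc j) * h - real j * h)"
      unfolding real_norm_def[symmetric]
    proof (rule integral_bound)
      fix t assume t: "t \<in> {real j * h..real (Suc j) * h}"
      have "\<bar>g t - g (real j * h)\<bar> \<le> Hg * (t - real j * h) powr \<beta>"
        using t jh by (intro wlip_holder[OF \<beta> lg]) auto
      also have "\<dots> \<le> Hg * h powr \<beta>" using t jh H \<beta> by (intro mult_left_mono powr_mono2) auto
      finally show "norm (g t - g (real j * h)) \<le> Hg * h powr \<beta>" by simp
    qed (use jh cgj in \<open>auto intro!: continuous_intros\<close>)
    moreover have "integral {real j * h..real (Suc j) * h} (\<lambda>t. g t - g (real j * h)) = A - h * g (real j * h)"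
      unfolding A_def using jh integral_diff[OF integrable_continuous_real[OF cgj] integrable_const_ivl] by simp
    ultimately have "\<bar>A - h * g (real j * h)\<bar> \<le> h * (Hg * h powr \<beta>)" using jh by (simp add: mult.commute)
    then have "\<bar>A - h * g (real j * h)\<bar> / h \<le> Hg * h powr \<beta>" using h by (simp add: field_simps)
    also have "\<bar>A - h * g (real j * h)\<bar> / h = \<bar>A / h - g (real j * h)\<bar>"
    proof -
      have "A / h - g (real j * h) = (A - h * g (real j * h)) / h" using h by (simp add: diff_divide_distrib)
      then show ?thesis using h by (simp add: abs_divide)
    qed
    finally have e2: "\<bar>A / h - g (real j * h)\<bar> \<le> Hg * real j powr (- \<beta>)"
      using mult_left_mono[OF h\<beta> H(2)] by linarith
    show ?thesis
      using e1 e2 unfolding C_def distrib_right h_def[symmetric] by linarith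
  qed
  then show ?thesis using C by blast
qed

end

section \<open>The differential equation as an integral equation\<close>

lemma D01_has_derivative:
  assumes "g differentiable (at x within {0..1})"
  shows "(g has_real_derivative D01 g x) (at x within {0..1})"
  using assms unfolding D01_def has_real_derivative_iff_has_vector_derivative
  by (simp add: vector_derivative_works[symmetric])

lemma D01_eq:
  assumes "(g has_real_derivative d) (at x within {0..1})" "x \<in> {0..1}"
  shows "D01 g x = d"
  using vector_derivative_within_cbox[of 0 1 x g d] assms
  unfolding D01_def has_real_derivative_iff_has_vector_derivative by simp

lemma has_derivative_cong_unit:
  fixes f g :: "real \<Rightarrow> real"
  assumes "x \<in> {0..1}" "\<And>t. t \<in> {0..1} \<Longrightarrow> f t = g t" "(f has_real_derivative d) (at x within {0..1})"
  shows "(g has_real_derivative d) (at x within {0..1})"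
  by (rule has_field_derivative_transform_within[OF assms(3), of 1]) (use assms in auto)

lemma has_derivative_interior:
  fixes g :: "real \<Rightarrow> real"
  assumes "(g has_real_derivative d) (at x within {0..1})" "x \<in> {0<..<1}"
  shows "(g has_real_derivative d) (at x)"
proof -
  have "at x within {0..1} = at x" using assms(2) by (intro at_within_Icc_at) auto
  then show ?thesis using assms(1) by simp
qed

lemma frac_int_1_has_derivative:
  assumes "continuous_on {0..1} V" "x \<in> {0..1}"
  shows "(frac_int 1 V has_real_derivative V x) (at x within {0..1})"
  using integral_has_real_derivative[OF assms] by (simp add: frac_int_1[abs_def])

text \<open>
  Apply \<open>I\<^sup>\<beta>\<close> to \<open>I\<^sup>1\<^sup>-\<^sup>\<beta> W = I\<^sup>1 g\<close>: by the semigroup law \<open>I\<^sup>1 W = I\<^sup>1 I\<^sup>\<beta> g\<close>, and differentiate.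
\<close>

lemma abel_inversion:
  assumes \<beta>: "0 < \<beta>" "\<beta> < 1" and cW: "continuous_on {0..1} W" and cg: "continuous_on {0..1} g"
    and V: "\<And>x. x \<in> {0..1} \<Longrightarrow> frac_int (1 - \<beta>) W x = integral {0..x} g" and x: "x \<in> {0..1}"
  shows "W x = frac_int \<beta> g x"
proof -
  have c: "continuous_on {0..1} (frac_int \<beta> g)" by (rule continuous_on_frac_int[OF \<beta>(1) cg])
  have eq: "frac_int 1 W t = frac_int 1 (frac_int \<beta> g) t" if t: "t \<in> {0..1}" for t
  proof -
    have "frac_int 1 W t = frac_int \<beta> (frac_int (1 - \<beta>) W) t"
      using frac_int_semigroup[of \<beta> "1 - \<beta>" W t] \<beta> cW t by simp
    also have "\<dots> = frac_int \<beta> (frac_int 1 g) t"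
      using V t by (intro frac_int_cong) (auto simp: frac_int_1)
    also have "\<dots> = frac_int (\<beta> + 1) g t" using frac_int_semigroup[of \<beta> 1 g t] \<beta> cg t by simp
    also have "\<dots> = frac_int 1 (frac_int \<beta> g) t"
      using frac_int_semigroup[of 1 \<beta> g t] \<beta> cg t by (simp add: add.commute)
    finally show ?thesis .
  qed
  have "(frac_int 1 W has_real_derivative frac_int \<beta> g x) (at x within {0..1})"
    by (rule has_derivative_cong_unit[OF x _ frac_int_1_has_derivative[OF c x]]) (use eq in auto)
  from D01_eq[OF this x] D01_eq[OF frac_int_1_has_derivative[OF cW x] x] show ?thesis by simp
qed

text \<open>
  The derivative of \<open>W\<close> may be arbitrarily large near the origin, so \<open>W\<close> is cut into a function \<open>W2\<close> that is
  continuously differentiable on all of \<open>[0,1]\<close> and agrees with \<open>W\<close> on \<open>[c,1]\<close>, and a continuous \<open>W1\<close> that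
  vanishes there. The first is \<open>A + I\<^sup>1 D\<close>, and \<open>I\<^sup>a I\<^sup>1 D = I\<^sup>1 I\<^sup>a D\<close> is differentiable; the integral of the
  second has a smooth kernel for \<open>x > c\<close>.

  The derivatives in the definition of the Caputo derivative are total operators, so that this
  differentiability is needed before the differential equation carries any information.
\<close>

lemma frac_int_differentiable:
  assumes a: "0 < a" and cW: "continuous_on {0..1} W"
    and dW: "\<And>x. x \<in> {0<..1} \<Longrightarrow> (W has_real_derivative W' x) (at x within {0..1})"
    and cW': "continuous_on {0<..1} W'" and x: "x \<in> {0<..<1}"
  shows "\<exists>d. (frac_int a W has_real_derivative d) (at x)"
proof -
  define c where "c = x / 2"
  have c: "0 < c" "c < x" "c < 1" using x by (auto simp: c_def)
  define D where "D t = W' (max c t)" for t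
  have cD: "continuous_on {0..1} D"
    unfolding D_def[abs_def] using c by (intro continuous_on_compose2[OF cW'] continuous_intros) auto
  define A where "A = W c - integral {0..c} D"
  define W2 where "W2 t = A + frac_int 1 D t" for t
  define W1 where "W1 t = W t - W2 t" for t
  have cW2: "continuous_on {0..1} W2" unfolding W2_def
    by (intro continuous_intros continuous_on_frac_int cD) simp
  have cW1: "continuous_on {0..1} W1" unfolding W1_def by (intro continuous_intros cW cW2)
  have W2eq: "W2 t = W t" if t: "t \<in> {c..1}" for t
  proof -
    have "(D has_integral (W t - W c)) {c..t}"
    proof (rule fundamental_theorem_of_calculus)
      fix s assume s: "s \<in> {c..t}"
      then have "(W has_real_derivative W' s) (at s within {c..t})"
        using t c by (intro DERIV_subset[OF dW]) auto
      then show "(W has_vector_derivative D s) (at s within {c..t})"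
        using s by (simp add: D_def max_def has_real_derivative_iff_has_vector_derivative)
    qed (use t in auto)
    moreover have "integral {0..t} D = integral {0..c} D + integral {c..t} D"
      using c t by (intro integral_split integrable_continuous_real
          continuous_on_subset[OF cD]) auto
    ultimately show ?thesis by (simp add: W2_def A_def frac_int_1 integral_unique)
  qed
  have split: "frac_int a W z = frac_int a W1 z + (A * z powr a / Gamma (a + 1) + frac_int 1 (frac_int a D) z)"
    if z: "z \<in> {0..1}" for z
  proof -
    have sub: "continuous_on {0..z} \<phi>" if "continuous_on {0..1} \<phi>" for \<phi> :: "real \<Rightarrow> real"
      using z by (intro continuous_on_subset[OF that]) auto
    have c1: "continuous_on {0..1} (frac_int 1 D)" by (intro continuous_on_frac_int cD) simp
    have "frac_int a W z = frac_int a (\<lambda>t. W1 t + W2 t) z" by (simp add: W1_def)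
    also have "\<dots> = frac_int a W1 z + frac_int a W2 z" by (intro frac_int_add a sub cW1 cW2)
    also have "frac_int a W2 z = frac_int a (\<lambda>t. A) z + frac_int a (frac_int 1 D) z"
      unfolding W2_def by (intro frac_int_add a sub c1 continuous_intros)
    also have "frac_int a (\<lambda>t. A) z = A * z powr a / Gamma (a + 1)"
      using z by (intro frac_int_const a) auto
    also have "frac_int a (frac_int 1 D) z = frac_int 1 (frac_int a D) z"
      using frac_int_semigroup[OF a _ cD z, of 1] frac_int_semigroup[OF _ a cD z, of 1] by (simp add: add.commute)
    finally show ?thesis .
  qed
  \<comment> \<open>Differentiation under the integral sign for the part supported away from the diagonal.\<close>
  define U where "U = {c<..<1}"
  have "((\<lambda>z. integral (cbox 0 c) (\<lambda>t. (z - t) powr (a - 1) * W1 t)) has_field_derivative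
      integral (cbox 0 c) (\<lambda>t. ((a - 1) * (x - t) powr (a - 2)) * W1 t)) (at x within U)"
  proof (rule leibniz_rule_field_derivative)
    fix z t assume zt: "z \<in> U" "t \<in> cbox 0 c"
    then have "0 < z - t" by (auto simp: U_def)
    then show "((\<lambda>z. (z - t) powr (a - 1) * W1 t) has_field_derivative ((a - 1) * (z - t) powr (a - 2)) * W1 t) (at z within U)"
      by (auto intro!: derivative_eq_intros)
  next
    fix z assume "z \<in> U"
    then show "(\<lambda>t. (z - t) powr (a - 1) * W1 t) integrable_on cbox 0 c"
      using c a by (simp add: U_def) (intro kernel_integrable continuous_on_subset[OF cW1]; auto)
  next
    have "continuous_on (U \<times> cbox 0 c) (\<lambda>p. ((a - 1) * (fst p - snd p) powr (a - 2)) * W1 (snd p))"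
      using c by (intro continuous_intros continuous_on_compose2[OF cW1]) (auto simp: U_def)
    then show "continuous_on (U \<times> cbox 0 c) (\<lambda>(z, t). ((a - 1) * (z - t) powr (a - 2)) * W1 t)"
      by (simp add: case_prod_unfold)
  qed (use c x in \<open>auto simp: U_def\<close>)
  moreover have "at x within U = at x" using c x by (intro at_within_open) (auto simp: U_def)
  ultimately obtain d where d: "((\<lambda>z. integral {0..c} (\<lambda>t. (z - t) powr (a - 1) * W1 t)) has_real_derivative d) (at x)"
    by auto
  have W1c: "frac_int a W1 z = integral {0..c} (\<lambda>t. (z - t) powr (a - 1) * W1 t) / Gamma a" if z: "z \<in> U" for z
  proof -
    have "integral {0..z} (\<lambda>t. (z - t) powr (a - 1) * W1 t) = integral {0..c} (\<lambda>t. (z - t) powr (a - 1) * W1 t)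
      + integral {c..z} (\<lambda>t. (z - t) powr (a - 1) * W1 t)"
      using c z a by (intro integral_split kernel_integrable
          continuous_on_subset[OF cW1]) (auto simp: U_def)
    also have "integral {c..z} (\<lambda>t. (z - t) powr (a - 1) * W1 t) = integral {c..z} (\<lambda>t. 0)"
      using z by (intro integral_cong) (auto simp: W1_def W2eq U_def)
    finally show ?thesis by (simp add: frac_int_def)
  qed
  have ca: "continuous_on {0..1} (frac_int a D)" by (intro continuous_on_frac_int a cD)
  have x01: "x \<in> {0..1}" using x by auto
  have "(frac_int 1 (frac_int a D) has_real_derivative frac_int a D x) (at x)"
    by (rule has_derivative_interior[OF frac_int_1_has_derivative[OF ca x01] x])
  then have "((\<lambda>z. integral {0..c} (\<lambda>t. (z - t) powr (a - 1) * W1 t) / Gamma a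
      + (A * z powr a / Gamma (a + 1) + frac_int 1 (frac_int a D) z)) has_real_derivative
      d / Gamma a + (A * (a * x powr (a - 1)) / Gamma (a + 1) + frac_int a D x)) (at x)"
    using x by (intro DERIV_add DERIV_cdivide d DERIV_cmult has_real_derivative_powr) auto
  then have "(frac_int a W has_real_derivative
      d / Gamma a + (A * (a * x powr (a - 1)) / Gamma (a + 1) + frac_int a D x)) (at x)"
  proof (rule has_field_derivative_transform_within_open[where S = U])
    fix z assume z: "z \<in> U"
    then have "z \<in> {0..1}" using c by (auto simp: U_def)
    then show "integral {0..c} (\<lambda>t. (z - t) powr (a - 1) * W1 t) / Gamma a
      + (A * z powr a / Gamma (a + 1) + frac_int 1 (frac_int a D) z) = frac_int a W z"
      using split W1c[OF z] by simp
  qed (use c x in \<open>auto simp: U_def\<close>)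
  then show ?thesis by blast
qed

text \<open>
  With \<open>W = u' - u' 0\<close> one has \<open>u - T\<^sub>1 u = I\<^sup>1 W\<close>, so \<open>I\<^sup>2\<^sup>-\<^sup>\<delta> (u - T\<^sub>1 u) = I\<^sup>1 V\<close> with \<open>V = I\<^sup>2\<^sup>-\<^sup>\<delta> W\<close>. The
  Caputo derivative is therefore \<open>V'\<close>, and \<open>V\<close> is recovered by integration because it is continuous with \<open>V 0 = 0\<close>.
\<close>

lemma caputo_integral_equation:
  assumes \<delta>: "1 < \<delta>" "\<delta> < 2"
    and u: "\<And>x. x \<in> {0..1} \<Longrightarrow> (u has_real_derivative y x) (at x within {0..1})"
    and cy: "continuous_on {0..1} y"
    and y: "\<And>x. x \<in> {0<..1} \<Longrightarrow> (y has_real_derivative y' x) (at x within {0..1})"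
    and cy': "continuous_on {0<..1} y'"
    and cg: "continuous_on {0..1} g"
    and eq: "\<And>x. x \<in> {0<..<1} \<Longrightarrow> caputo_deriv \<delta> u x = g x"
    and x: "x \<in> {0..1}"
  shows "frac_int (2 - \<delta>) (\<lambda>t. y t - y 0) x = integral {0..x} g"
proof -
  define W where "W t = y t - y 0" for t
  define V where "V = frac_int (2 - \<delta>) W"
  have a: "0 < 2 - \<delta>" using \<delta> by simp
  have cW: "continuous_on {0..1} W" unfolding W_def by (intro continuous_intros cy)
  have cV: "continuous_on {0..1} V" unfolding V_def by (rule continuous_on_frac_int[OF a cW])
  have D01u: "D01 u 0 = y 0" using D01_eq[OF u[of 0]] by simp
  have w: "u t - T1 u t = frac_int 1 W t" if t: "t \<in> {0..1}" for t
  proof -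
    have "(W has_integral (u t - y 0 * t) - (u 0 - y 0 * 0)) {0..t}"
    proof (rule fundamental_theorem_of_calculus)
      fix s assume s: "s \<in> {0..t}"
      then have "(u has_real_derivative y s) (at s within {0..t})"
        using t by (intro DERIV_subset[OF u]) auto
      then have "((\<lambda>t. u t - y 0 * t) has_real_derivative W s) (at s within {0..t})"
        by (auto intro!: derivative_eq_intros simp: W_def)
      then show "((\<lambda>t. u t - y 0 * t) has_vector_derivative W s) (at s within {0..t})"
        by (simp add: has_real_derivative_iff_has_vector_derivative)
    qed (use t in auto)
    then show ?thesis by (simp add: frac_int_1 integral_unique T1_def D01u)
  qed
  define F where "F = (\<lambda>z. 1 / Gamma (2 - \<delta>) * integral {0..z} (\<lambda>t. (z - t) powr (1 - \<delta>) * (u t - T1 u t)))"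
  have F: "F z = frac_int 1 V z" if z: "z \<in> {0..1}" for z
  proof -
    have "F z = frac_int (2 - \<delta>) (\<lambda>t. u t - T1 u t) z" by (simp add: F_def frac_int_def)
    also have "\<dots> = frac_int (2 - \<delta>) (frac_int 1 W) z"
      using w z by (intro frac_int_cong) auto
    also have "\<dots> = frac_int (2 - \<delta> + 1) W z" using frac_int_semigroup[OF a _ cW z, of 1] by simp
    also have "\<dots> = frac_int 1 V z"
      unfolding V_def using frac_int_semigroup[OF _ a cW z, of 1] by (simp add: add.commute)
    finally show ?thesis .
  qed
  have dF: "D01 F z = V z" if z: "z \<in> {0..1}" for z
    by (rule D01_eq[OF has_derivative_cong_unit[OF z _ frac_int_1_has_derivative[OF cV z]] z]) (use F in auto)
  have dV: "(V has_real_derivative g z) (at z)" if z: "z \<in> {0<..<1}" for z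
  proof -
    have z01: "z \<in> {0..1}" using z by auto
    have "(W has_real_derivative y' s) (at s within {0..1})" if "s \<in> {0<..1}" for s
      unfolding W_def using y[OF that] by (auto intro!: derivative_eq_intros)
    then obtain d where d: "(V has_real_derivative d) (at z)"
      unfolding V_def using frac_int_differentiable[OF a cW _ cy' z] by blast
    have "(D01 F has_real_derivative d) (at z within {0..1})"
      by (rule has_derivative_cong_unit[OF z01 _ has_field_derivative_at_within[OF d]]) (use dF in auto)
    then have "D01 (D01 F) z = d" by (rule D01_eq[OF _ z01])
    moreover have "caputo_deriv \<delta> u z = D01 (D01 F) z"
      by (simp add: caputo_deriv_def RL_deriv_def F_def numeral_2_eq_2)
    ultimately show ?thesis using d eq[OF z] by simp
  qed
  have "(g has_integral (V x - V 0)) {0..x}"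
  proof (rule fundamental_theorem_of_calculus_interior)
    show "continuous_on {0..x} V" using x by (intro continuous_on_subset[OF cV]) auto
    show "(V has_vector_derivative g t) (at t)" if "t \<in> {0<..<x}" for t
      using dV[of t] that x by (simp add: has_real_derivative_iff_has_vector_derivative)
  qed (use x in auto)
  then show ?thesis by (simp add: integral_unique V_def W_def[abs_def])
qed

section \<open>Functions in the weighted spaces\<close>

lemma abs_ln_le_powr:
  fixes x \<epsilon> :: real
  assumes "0 < \<epsilon>" "0 < x" "x \<le> 1"
  shows "\<bar>ln x\<bar> \<le> x powr (- \<epsilon>) / \<epsilon>"
proof -
  have "1 \<le> 1 / x" using assms(2,3) by simp
  from ln_powr_bound[OF this assms(1)] have "ln (1 / x) \<le> (1 / x) powr \<epsilon> / \<epsilon>" .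
  then show ?thesis using assms by (simp add: ln_div powr_divide powr_minus_divide ln_le_zero_iff)
qed

text \<open>
  For \<open>i = 1\<close> each of the three cases of the definition gives \<open>\<bar>b' x\<bar> = O(x\<^sup>\<beta>\<^sup>-\<^sup>1)\<close>, because
  \<open>- \<mu> \<ge> \<beta> - 1\<close> and the logarithm grows more slowly than any negative power of \<open>x\<close>.
\<close>

lemma Cq_weighted_wlip:
  assumes \<beta>: "0 < \<beta>" "\<beta> < 1" and q: "1 \<le> q" and \<mu>: "\<mu> \<le> 1 - \<beta>" and b: "b \<in> Cq_weighted q \<mu>"
  shows "continuous_on {0..1} b" "\<exists>H. wlip \<beta> H b"
proof -
  show cont: "continuous_on {0..1} b" using b by (simp add: Cq_weighted_def)
  have diff: "b differentiable (at x within {0..1})" if "x \<in> {0<..1}" for x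
  proof -
    have "\<forall>i<q. \<forall>x\<in>{0<..1}. (D01 ^^ i) b differentiable (at x within {0..1})"
      using b by (simp add: Cq_weighted_def Ck_def)
    from this[rule_format, of 0 x] show ?thesis using q that by simp
  qed
  obtain C where C: "\<forall>x\<in>{0<..1}. \<forall>i\<in>{1..q}.
        (real i < 1 - \<mu> \<longrightarrow> \<bar>(D01 ^^ i) b x\<bar> \<le> C) \<and>
        (real i = 1 - \<mu> \<longrightarrow> \<bar>(D01 ^^ i) b x\<bar> \<le> C * (1 + \<bar>ln x\<bar>)) \<and>
        (real i > 1 - \<mu> \<longrightarrow> \<bar>(D01 ^^ i) b x\<bar> \<le> C * x powr (1 - \<mu> - real i))"
    using b by (auto simp: Cq_weighted_def)
  define C' where "C' = \<bar>C\<bar> * (1 + 1 / (1 - \<beta>))"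
  have "\<bar>D01 b x\<bar> \<le> C' * x powr (\<beta> - 1)" if x: "x \<in> {0<..<1}" for x
  proof -
    have C1: "(1 < 1 - \<mu> \<longrightarrow> \<bar>D01 b x\<bar> \<le> C) \<and> (1 = 1 - \<mu> \<longrightarrow> \<bar>D01 b x\<bar> \<le> C * (1 + \<bar>ln x\<bar>)) \<and>
        (1 > 1 - \<mu> \<longrightarrow> \<bar>D01 b x\<bar> \<le> C * x powr (1 - \<mu> - 1))"
      using C[rule_format, of x 1] x q by simp
    have p1: "1 \<le> x powr (\<beta> - 1)" using powr_mono2'[of "\<beta> - 1" x 1] x \<beta> by simp
    have le: "r \<le> C' * x powr (\<beta> - 1)" if r: "r \<le> \<bar>C\<bar> * s" and s: "s \<le> (1 + 1 / (1 - \<beta>)) * x powr (\<beta> - 1)" for r s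
    proof -
      have "\<bar>C\<bar> * s \<le> \<bar>C\<bar> * ((1 + 1 / (1 - \<beta>)) * x powr (\<beta> - 1))" using s by (intro mult_left_mono) auto
      then show ?thesis using r by (simp add: C'_def mult.assoc)
    qed
    have p2: "x powr (\<beta> - 1) \<le> (1 + 1 / (1 - \<beta>)) * x powr (\<beta> - 1)"
      using \<beta> by (intro mult_le_cancel_right1[THEN iffD2]) auto
    consider "1 < 1 - \<mu>" | "1 = 1 - \<mu>" | "1 > 1 - \<mu>" by linarith
    then show ?thesis
    proof cases
      case 1
      then have "\<bar>D01 b x\<bar> \<le> \<bar>C\<bar> * 1" using C1 by linarith
      then show ?thesis by (rule le) (use p1 p2 in linarith)
    next
      case 2
      have "\<bar>D01 b x\<bar> \<le> C * (1 + \<bar>ln x\<bar>)" using C1 2 by blast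
      also have "\<dots> \<le> \<bar>C\<bar> * (1 + \<bar>ln x\<bar>)" by (intro mult_right_mono) auto
      finally show ?thesis
      proof (rule le)
        have "\<bar>ln x\<bar> \<le> x powr (- (1 - \<beta>)) / (1 - \<beta>)" using x \<beta> by (intro abs_ln_le_powr) auto
        then show "1 + \<bar>ln x\<bar> \<le> (1 + 1 / (1 - \<beta>)) * x powr (\<beta> - 1)"
          using p1 by (simp add: algebra_simps)
      qed
    next
      case 3
      have "\<bar>D01 b x\<bar> \<le> C * x powr (1 - \<mu> - 1)" using C1 3 by blast
      also have "\<dots> \<le> \<bar>C\<bar> * x powr (1 - \<mu> - 1)" by (intro mult_right_mono) auto
      finally show ?thesis
      proof (rule le)
        have "x powr (1 - \<mu> - 1) \<le> x powr (\<beta> - 1)" using x \<mu> by (intro powr_mono') auto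
        then show "x powr (1 - \<mu> - 1) \<le> (1 + 1 / (1 - \<beta>)) * x powr (\<beta> - 1)" using p2 by linarith
      qed
    qed
  qed
  then have "wlip \<beta> (C' / \<beta>) b"
    using D01_has_derivative[OF diff] has_derivative_interior
    by (intro wlip_of_deriv[OF \<beta> cont, where g' = "D01 b"]) auto
  then show "\<exists>H. wlip \<beta> H b" by blast
qed

section \<open>Convergence\<close>

text \<open>
  In the interior rows the scheme acts on the difference quotients of \<open>v\<close> only, apart from the term with \<open>c\<close>;
  \<open>Suc (j - 1)\<close> is \<open>j\<close>, written so that both upwind quotients have the same shape.
\<close>

lemma fd_op_interior:
  assumes "1 \<le> j" "j < N"
  shows "fd_op \<delta> b c \<alpha>0 \<alpha>1 N v j =
    - (real N powr (\<delta> - 1) / Gamma (3 - \<delta>)) * dcaputo (\<delta> - 1) (\<lambda>k. real N * (v (Suc k) - v k)) j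
    + b (mesh N j) * (if b (mesh N j) < 0 then real N * (v (Suc j) - v j) else real N * (v (Suc (j - 1)) - v (j - 1)))
    + c (mesh N j) * v j"
proof -
  have N: "0 < real N" using assms by simp
  define S where "S = (\<Sum>k<j. dcoef \<delta> (int j - int k) * (v (k + 2) - 2 * v (k + 1) + v k))"
  have "dcaputo (\<delta> - 1) (\<lambda>k. real N * (v (Suc k) - v k)) j = real N * S"
    unfolding dcaputo_def S_def sum_distrib_left
  proof (intro sum.cong refl)
    fix k assume "k \<in> {..<j}"
    then have "dcoef \<delta> (int j - int k) = wgt (\<delta> - 1) (j - k)"
      using dcoef_eq_wgt[of "j - k" \<delta>] by (simp add: of_nat_diff)
    then show "wgt (\<delta> - 1) (j - k) * (real N * (v (Suc (Suc k)) - v (Suc k)) - real N * (v (Suc k) - v k))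
      = real N * (dcoef \<delta> (int j - int k) * (v (k + 2) - 2 * v (k + 1) + v k))"
      by (simp add: algebra_simps)
  qed
  moreover have "1 / ((1 / real N) powr \<delta> * Gamma (3 - \<delta>)) = real N powr (\<delta> - 1) / Gamma (3 - \<delta>) * real N"
  proof -
    have "real N powr (\<delta> - 1) * real N = real N powr \<delta>"
      using powr_mult_base[of "real N" "\<delta> - 1"] by (simp add: mult.commute)
    then show ?thesis using N by (simp add: powr_divide)
  qed
  ultimately have "1 / ((1 / real N) powr \<delta> * Gamma (3 - \<delta>)) * S
      = real N powr (\<delta> - 1) / Gamma (3 - \<delta>) * dcaputo (\<delta> - 1) (\<lambda>k. real N * (v (Suc k) - v k)) j"
    by (simp only: mult.assoc)
  moreover have "upwind N (b (mesh N j)) v j = b (mesh N j) *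
      (if b (mesh N j) < 0 then real N * (v (Suc j) - v j) else real N * (v (Suc (j - 1)) - v (j - 1)))"
    using assms by (simp add: upwind_def mult_ac)
  ultimately show ?thesis
    using assms unfolding fd_op_def Let_def S_def[symmetric] by simp
qed

lemma mean_derivative:
  assumes "0 < h" "0 \<le> a" "a + h \<le> 1"
    and u: "\<And>x. x \<in> {0..1} \<Longrightarrow> (u has_real_derivative y x) (at x within {0..1})"
  shows "((\<lambda>s. y (a + s)) has_integral (u (a + h) - u a)) {0..h}"
proof -
  have "(y has_integral (u (a + h) - u a)) {a..a + h}"
  proof (rule fundamental_theorem_of_calculus)
    fix s assume s: "s \<in> {a..a + h}"
    then have "(u has_real_derivative y s) (at s within {a..a + h})"
      using assms by (intro DERIV_subset[OF u]) auto
    then show "(u has_vector_derivative y s) (at s within {a..a + h})"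
      by (simp add: has_real_derivative_iff_has_vector_derivative)
  qed (use assms in auto)
  from has_integral_shift_real_ivl[OF this, of a] show ?thesis by (simp add: add.commute)
qed

lemma difference_quotient_error:
  assumes \<beta>: "0 < \<beta>" "\<beta> < 1" and h: "0 < h" "0 \<le> a" "a + h \<le> 1"
    and u: "\<And>x. x \<in> {0..1} \<Longrightarrow> (u has_real_derivative y x) (at x within {0..1})"
    and y: "wlip \<beta> H y" and x: "a \<le> x" "x \<le> a + h"
  shows "\<bar>(u (a + h) - u a) / h - y x\<bar> \<le> H * h powr \<beta>"
proof -
  have H: "0 \<le> H" by (rule wlip_nonneg[OF y])
  have I: "((\<lambda>s. y (a + s) - y x) has_integral (u (a + h) - u a - h * y x)) {0..h}"
    using has_integral_diff[OF mean_derivative[OF h u] has_integral_const_real[of "y x" 0 h]] h by simp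
  have "norm (u (a + h) - u a - h * y x) \<le> (H * h powr \<beta>) * measure lborel (cbox 0 h)"
  proof (rule has_integral_bound)
    show "((\<lambda>s. y (a + s) - y x) has_integral (u (a + h) - u a - h * y x)) (cbox 0 h)" using I by simp
    fix s assume "s \<in> cbox 0 h"
    then have s: "0 \<le> s" "s \<le> h" by auto
    have le: "\<bar>y t - y t'\<bar> \<le> H * h powr \<beta>" if "a \<le> t'" "t' \<le> t" "t \<le> a + h" for t t'
    proof -
      have "\<bar>y t - y t'\<bar> \<le> H * (t - t') powr \<beta>" using that h by (intro wlip_holder[OF \<beta> y]) auto
      also have "\<dots> \<le> H * h powr \<beta>" using that H \<beta> by (intro mult_left_mono powr_mono2) auto
      finally show ?thesis .
    qed
    show "norm (y (a + s) - y x) \<le> H * h powr \<beta>"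
      using le[of x "a + s"] le[of "a + s" x] x s by (cases "x \<le> a + s") (auto simp: abs_minus_commute)
  qed (use H in simp)
  then have "\<bar>u (a + h) - u a - h * y x\<bar> / h \<le> H * h powr \<beta>" using h by (simp add: field_simps)
  moreover have "(u (a + h) - u a) / h - y x = (u (a + h) - u a - h * y x) / h" using h by (simp add: diff_divide_distrib)
  ultimately show ?thesis using h by (simp add: abs_divide)
qed

theorem theorem4p2:
  fixes \<delta> \<mu> \<alpha>0 \<alpha>1 \<gamma>0 \<gamma>1 :: real and q :: nat and b c f u :: "real \<Rightarrow> real"
  assumes "1 < \<delta>" and "\<delta> < 2"
    and "q \<ge> 2" and "\<mu> \<le> 2 - \<delta>"
    and "b \<in> Cq_weighted q \<mu>" and "c \<in> Cq_weighted q \<mu>" and "f \<in> Cq_weighted q \<mu>"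
    and "\<forall>x\<in>{0..1}. c x \<ge> 0"
    and "\<alpha>1 \<ge> 0" and "\<alpha>0 \<ge> 1 / (\<delta> - 1)"
    and "u \<in> Ck 1 {0..1}" and "u \<in> Ck (q + 1) {0<..1}"
    and "solves_bvp \<delta> b c f \<alpha>0 \<alpha>1 \<gamma>0 \<gamma>1 u"
  shows "\<exists>C. \<forall>N\<ge>1. \<forall>v.
           (\<forall>j\<le>N. fd_op \<delta> b c \<alpha>0 \<alpha>1 N v j = fd_rhs f \<gamma>0 \<gamma>1 N j) \<longrightarrow>
           (MAX j\<in>{0..N}. \<bar>u (mesh N j) - v j\<bar>) \<le> C * (1 / real N) powr (\<delta> - 1)"
proof -
  define \<beta> where "\<beta> = \<delta> - 1"
  have \<beta>: "0 < \<beta>" "\<beta> < 1" and \<delta>\<beta>: "2 - \<delta> = 1 - \<beta>" "3 - \<delta> = 2 - \<beta>" "\<delta> - 1 = \<beta>"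
    using assms(1,2) by (auto simp: \<beta>_def)
  have "0 < 1 / (\<delta> - 1)" using assms(1) by simp
  then have \<alpha>0: "0 < \<alpha>0" using assms(10) by linarith
  have \<mu>: "\<mu> \<le> 1 - \<beta>" and q: "1 \<le> q" using assms(3,4) \<delta>\<beta>(1) by linarith+
  define y where "y = D01 u"
  have du: "(u has_real_derivative y x) (at x within {0..1})" if "x \<in> {0..1}" for x
    using assms(11) that unfolding y_def by (intro D01_has_derivative) (simp add: Ck_def)
  have cy: "continuous_on {0..1} y" using assms(11) by (simp add: Ck_def y_def)
  have cu: "continuous_on {0..1} u"
    by (rule DERIV_continuous_on[OF du])
  have diffy: "(D01 ^^ i) u differentiable (at x within {0..1})" if "i < q + 1" "x \<in> {0<..1}" for i x
    using assms(12) that unfolding Ck_def by blast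
  have dy: "(y has_real_derivative D01 y x) (at x within {0..1})" if "x \<in> {0<..1}" for x
    using diffy[of 1 x] that q unfolding y_def by (intro D01_has_derivative) simp
  have cy': "continuous_on {0<..1} (D01 y)"
    unfolding continuous_on_eq_continuous_within
  proof
    fix x :: real assume x: "x \<in> {0<..1}"
    have "D01 y differentiable (at x within {0..1})"
      using diffy[of 2 x] x assms(3) by (simp add: numeral_2_eq_2 y_def)
    then have "continuous (at x within {0..1}) (D01 y)" by (rule differentiable_imp_continuous_within)
    then show "continuous (at x within {0<..1}) (D01 y)" by (rule continuous_within_subset) auto
  qed
  note cb = Cq_weighted_wlip(1)[OF \<beta> q \<mu> assms(5)]
  note cc = Cq_weighted_wlip(1)[OF \<beta> q \<mu> assms(6)]
  note cf = Cq_weighted_wlip(1)[OF \<beta> q \<mu> assms(7)]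
  obtain Hb where Hb: "wlip \<beta> Hb b" using Cq_weighted_wlip(2)[OF \<beta> q \<mu> assms(5)] ..
  obtain Hc where Hc: "wlip \<beta> Hc c" using Cq_weighted_wlip(2)[OF \<beta> q \<mu> assms(6)] ..
  obtain Hf where Hf: "wlip \<beta> Hf f" using Cq_weighted_wlip(2)[OF \<beta> q \<mu> assms(7)] ..
  obtain Mb where Mb: "0 \<le> Mb" "\<And>t. t \<in> {0..1} \<Longrightarrow> \<bar>b t\<bar> \<le> Mb" using continuous_on_bounded[OF cb] by blast
  obtain Mc where Mc: "0 \<le> Mc" "\<And>t. t \<in> {0..1} \<Longrightarrow> \<bar>c t\<bar> \<le> Mc" using continuous_on_bounded[OF cc] by blast
  obtain Mu where Mu: "0 \<le> Mu" "\<And>t. t \<in> {0..1} \<Longrightarrow> \<bar>u t\<bar> \<le> Mu" using continuous_on_bounded[OF cu] by blast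
  obtain My where My: "0 \<le> My" "\<And>t. t \<in> {0..1} \<Longrightarrow> \<bar>y t\<bar> \<le> My" using continuous_on_bounded[OF cy] by blast
  define G where "G t = c t * u t + - f t" for t
  define g where "g t = b t * y t + G t" for t
  have cG: "continuous_on {0..1} G" unfolding G_def by (intro continuous_intros cc cu cf)
  have cg: "continuous_on {0..1} g" unfolding g_def by (intro continuous_intros cb cy cG)
  have ode: "caputo_deriv \<delta> u x = g x" if "x \<in> {0<..<1}" for x
    using assms(13) that unfolding solves_bvp_def g_def G_def y_def by force
  define W where "W t = y t - y 0" for t
  have cW: "continuous_on {0..1} W" unfolding W_def by (intro continuous_intros cy)
  have V: "frac_int (1 - \<beta>) W x = integral {0..x} g" if "x \<in> {0..1}" for x
    using caputo_integral_equation[OF assms(1,2) du cy dy cy' cg ode that] by (simp add: \<delta>\<beta> W_def[abs_def])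
  have Wg: "W x = frac_int \<beta> g x" if "x \<in> {0..1}" for x by (rule abel_inversion[OF \<beta> cW cg V that])
  \<comment> \<open>The first derivative of the solution, then the right-hand side \<open>g\<close>, are shown to be regular; the
      equation \<open>W = I\<^sup>\<beta> g\<close> then gives second differences of \<open>W\<close>.\<close>
  have Hu: "wlip \<beta> (My / \<beta>) u"
  proof (rule wlip_of_deriv[OF \<beta> cu])
    fix x :: real assume x: "x \<in> {0<..<1}"
    then show "(u has_real_derivative y x) (at x)" by (intro has_derivative_interior[OF du]) auto
    have "1 \<le> x powr (\<beta> - 1)" using powr_mono2'[of "\<beta> - 1" x 1] x \<beta> by simp
    then have "My * 1 \<le> My * x powr (\<beta> - 1)" using My by (intro mult_left_mono) auto
    then show "\<bar>y x\<bar> \<le> My * x powr (\<beta> - 1)" using My(2)[of x] x by simp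
  qed
  obtain HG where HG: "wlip \<beta> HG G"
    unfolding G_def using wlip_add[OF wlip_mult[OF Hc Hu Mc(2) Mu(2)] wlip_minus[OF Hf]] by blast
  have "y x = y 0 + frac_int \<beta> (\<lambda>t. b t * y t + G t) x" if "x \<in> {0..1}" for x
    using Wg[OF that] by (simp add: W_def g_def[abs_def])
  then obtain Hy where Hy: "wlip \<beta> Hy y"
    using fractional_regularity[OF \<beta> cb cy cG Hb HG] by blast
  have HW: "wlip \<beta> Hy W" using Hy by (simp add: wlip_def W_def)
  obtain Hg where Hg: "wlip \<beta> Hg g"
    unfolding g_def using wlip_add[OF wlip_mult[OF Hb Hy Mb(2) My(2)] HG] by blast
  obtain Mg where Mg: "0 \<le> Mg" "\<And>t. t \<in> {0..1} \<Longrightarrow> \<bar>g t\<bar> \<le> Mg" using continuous_on_bounded[OF cg] by blast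
  have Hy0: "0 \<le> Hy" and Hg0: "0 \<le> Hg" using Hy Hg by (auto dest: wlip_nonneg)
  define C2 where "C2 = (Mg + 4 * Hg + 3 * Hg / \<beta>) / Gamma \<beta>"
  have C2: "0 \<le> C2" using Mg Hg0 \<beta> by (simp add: C2_def)
  have W2: "\<bar>(W (x' + h) - W x') - (W (x + h) - W x)\<bar> \<le> C2 * (h\<^sup>2 * x powr (\<beta> - 2) + h powr (1 + \<beta>) * x powr (\<beta> - 1))"
    if "0 < h" "h \<le> x" "x \<le> x'" "x' \<le> x + h" "x' + h \<le> 1" for h x x'
    using second_difference_frac_int[OF \<beta> cg Hg Mg(2) that] that by (simp add: Wg C2_def)
  obtain Ct where Ct: "0 \<le> Ct" and trunc: "\<forall>N j U. 1 \<le> j \<longrightarrow> j < N \<longrightarrow>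
    (\<forall>k\<le>j. U k = y 0 + real N * integral {0..1 / real N} (\<lambda>s. W (real k * (1 / real N) + s))) \<longrightarrow>
    \<bar>real N powr \<beta> / Gamma (2 - \<beta>) * dcaputo \<beta> U j - g (real j * (1 / real N))\<bar> \<le> Ct * real j powr (- \<beta>)"
    using truncation_error[OF \<beta> cW cg _ HW Hg V C2 W2, of "y 0"] by (auto simp: W_def)
  define R where "R = Ct + Mb * Hy + \<alpha>0 * Hy + \<alpha>1 * Hy"
  have nonneg: "0 \<le> Mb * Hy" "0 \<le> \<alpha>0 * Hy" "0 \<le> \<alpha>1 * Hy" using Mb Hy0 \<alpha>0 assms(9) by auto
  then have R: "0 \<le> R" using Ct by (simp add: R_def)
  have sys: "error_system \<beta> (Gamma (2 - \<beta>)) \<alpha>0 \<alpha>1 Mb Mc R N (\<lambda>j. u (mesh N j) - v j)"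
    if N: "1 \<le> N" and v: "\<And>j. j \<le> N \<Longrightarrow> fd_op \<delta> b c \<alpha>0 \<alpha>1 N v j = fd_rhs f \<gamma>0 \<gamma>1 N j" for N v
  proof -
    define h where "h = 1 / real N"
    have h: "0 < h" "real N * h = 1" using N by (auto simp: h_def)
    have mesh: "mesh N k = real k * h" for k by (simp add: mesh_def h_def)
    have meshS: "mesh N (Suc k) = real k * h + h" for k by (simp add: mesh algebra_simps)
    have m1: "real k * h + h \<le> 1" if "k < N" for k
    proof -
      have "(real k + 1) * h \<le> real N * h" using that h by (intro mult_right_mono) auto
      then show ?thesis using h by (simp add: algebra_simps)
    qed
    have m01: "mesh N j \<in> {0..1}" if "j \<le> N" for j
      using that h(1) mult_right_mono[of "real j" "real N" h] h(2) by (simp add: mesh)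
    have hN: "h powr \<beta> = real N powr (- \<beta>)" using N by (simp add: h_def powr_divide powr_minus field_simps)
    define U where "U k = real N * (u (mesh N (Suc k)) - u (mesh N k))" for k
    define Zv where "Zv k = real N * (v (Suc k) - v k)" for k
    define z where "z = (\<lambda>k. real N * ((u (mesh N (Suc k)) - v (Suc k)) - (u (mesh N k) - v k)))"
    have z: "z = (\<lambda>k. U k + - Zv k)" by (auto simp: z_def U_def Zv_def algebra_simps)
    have Uq: "U k = (u (real k * h + h) - u (real k * h)) / h" for k
      unfolding U_def meshS unfolding mesh by (simp add: h_def)
    have Uy: "\<bar>U k - y x\<bar> \<le> Hy * h powr \<beta>" if "k < N" "real k * h \<le> x" "x \<le> real k * h + h" for k x
      unfolding Uq using that m1[OF that(1)] h by (intro difference_quotient_error[OF \<beta> _ _ _ du Hy]) auto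
    have UW: "U k = y 0 + real N * integral {0..1 / real N} (\<lambda>s. W (real k * (1 / real N) + s))" if "k < N" for k
    proof -
      have "((\<lambda>s. W (real k * h + s)) has_integral (u (real k * h + h) - u (real k * h) - h * y 0)) {0..h}"
        unfolding W_def
        using has_integral_diff[OF mean_derivative[OF h(1) _ m1[OF that] du] has_integral_const_real[of "y 0" 0 h]] h by simp
      note I = integral_unique[OF this]
      have dh: "X / h = real N * X" for X by (simp add: h_def)
      show ?thesis
        unfolding h_def[symmetric] Uq I dh using h(2) by (simp add: right_diff_distrib mult.assoc[symmetric])
    qed
    define r where "r j = real N powr \<beta> / Gamma (2 - \<beta>) * dcaputo \<beta> z j
        - b (mesh N j) * (if b (mesh N j) < 0 then z j else z (j - 1)) - c (mesh N j) * (u (mesh N j) - v j)" for j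
    have int: "b (mesh N j) \<le> Mb \<and> 0 \<le> c (mesh N j) \<and> c (mesh N j) \<le> Mc \<and> \<bar>r j\<bar> \<le> R * real j powr (- \<beta>) \<and>
        real N powr \<beta> / Gamma (2 - \<beta>) * dcaputo \<beta> z j
          = b (mesh N j) * (if b (mesh N j) < 0 then z j else z (j - 1)) + c (mesh N j) * (u (mesh N j) - v j) + r j"
      if j: "1 \<le> j" "j < N" for j
    proof -
      define x where "x = mesh N j"
      have x: "x \<in> {0..1}" using m01[of j] j by (simp add: x_def)
      define U' where "U' = (if b x < 0 then U j else U (j - 1))"
      define Z' where "Z' = (if b x < 0 then Zv j else Zv (j - 1))"
      have zU: "(if b x < 0 then z j else z (j - 1)) = U' - Z'" by (simp add: z U'_def Z'_def)
      have "fd_op \<delta> b c \<alpha>0 \<alpha>1 N v j = f x" using v[of j] j by (simp add: fd_rhs_def x_def)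
      then have Zeq: "real N powr \<beta> / Gamma (2 - \<beta>) * dcaputo \<beta> Zv j = b x * Z' + c x * v j - f x"
        unfolding fd_op_interior[OF j] \<delta>\<beta> Z'_def x_def Zv_def[abs_def] by linarith
      have T: "\<bar>real N powr \<beta> / Gamma (2 - \<beta>) * dcaputo \<beta> U j - g x\<bar> \<le> Ct * real j powr (- \<beta>)"
        using trunc[rule_format, OF j] UW j by (simp add: x_def mesh_def)
      have "\<bar>U' - y x\<bar> \<le> Hy * h powr \<beta>"
      proof (cases "b x < 0")
        case True
        then show ?thesis using Uy[of j x] j h by (simp add: U'_def x_def mesh)
      next
        case False
        have "real (j - 1) * h + h = x" using j by (simp add: x_def mesh of_nat_diff algebra_simps)
        then show ?thesis using Uy[of "j - 1" x] j h False by (simp add: U'_def)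
      qed
      also have "\<dots> \<le> Hy * real j powr (- \<beta>)"
        unfolding hN using j \<beta> Hy0 by (intro mult_left_mono powr_mono2') auto
      finally have "\<bar>b x\<bar> * \<bar>U' - y x\<bar> \<le> Mb * (Hy * real j powr (- \<beta>))"
        using Mb x by (intro mult_mono) auto
      then have bU: "\<bar>b x * (U' - y x)\<bar> \<le> Mb * Hy * real j powr (- \<beta>)" by (simp add: abs_mult mult.assoc)
      have "dcaputo \<beta> z j = dcaputo \<beta> U j - dcaputo \<beta> Zv j" unfolding z dcaputo_add dcaputo_minus by simp
      then have "r j = real N powr \<beta> / Gamma (2 - \<beta>) * dcaputo \<beta> U j - real N powr \<beta> / Gamma (2 - \<beta>) * dcaputo \<beta> Zv j
          - b x * (U' - Z') - c x * (u x - v j)"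
        unfolding r_def x_def[symmetric] zU by (simp add: right_diff_distrib)
      also have "\<dots> = (real N powr \<beta> / Gamma (2 - \<beta>) * dcaputo \<beta> U j - g x) - b x * (U' - y x)"
        unfolding Zeq g_def G_def by algebra
      finally have "\<bar>r j\<bar> \<le> (Ct + Mb * Hy) * real j powr (- \<beta>)" using T bU unfolding distrib_right by linarith
      also have "\<dots> \<le> R * real j powr (- \<beta>)" using nonneg by (intro mult_right_mono) (auto simp: R_def)
      finally have "\<bar>r j\<bar> \<le> R * real j powr (- \<beta>)" .
      moreover have "b x \<le> Mb" "0 \<le> c x" "c x \<le> Mc"
        using Mb(2)[OF x] Mc(2)[OF x] assms(8) x by auto
      ultimately show ?thesis by (simp add: r_def x_def[symmetric])
    qed
    have bvp: "u 0 - \<alpha>0 * y 0 = \<gamma>0" "u 1 + \<alpha>1 * y 1 = \<gamma>1"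
      using assms(13) by (auto simp: solves_bvp_def y_def)
    have m0: "mesh N 0 = 0" "mesh N N = 1" using N by (auto simp: mesh_def)
    have left: "\<bar>(u (mesh N 0) - v 0) - \<alpha>0 * z 0\<bar> \<le> R * real N powr (- \<beta>)"
    proof -
      have "v 0 - \<alpha>0 * Zv 0 = \<gamma>0"
        using v[of 0] by (simp add: fd_op_def fd_rhs_def Zv_def mult_ac)
      then have "(u (mesh N 0) - v 0) - \<alpha>0 * z 0 = - (\<alpha>0 * (U 0 - y 0))"
        using bvp m0 by (simp add: z algebra_simps)
      then have "\<bar>(u (mesh N 0) - v 0) - \<alpha>0 * z 0\<bar> \<le> \<alpha>0 * (Hy * h powr \<beta>)"
        using Uy[of 0 0] N h \<alpha>0 by (simp add: abs_mult)
      also have "\<dots> \<le> R * real N powr (- \<beta>)"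
        unfolding hN mult.assoc[symmetric] using Ct nonneg by (intro mult_right_mono) (auto simp: R_def)
      finally show ?thesis .
    qed
    have right: "\<bar>(u (mesh N N) - v N) + \<alpha>1 * z (N - 1)\<bar> \<le> R * real N powr (- \<beta>)"
    proof -
      have "v N + \<alpha>1 * Zv (N - 1) = \<gamma>1"
        using v[of N] N by (simp add: fd_op_def fd_rhs_def Zv_def mult_ac)
      then have "(u (mesh N N) - v N) + \<alpha>1 * z (N - 1) = \<alpha>1 * (U (N - 1) - y 1)"
        using bvp m0 by (simp add: z algebra_simps)
      moreover have "real (N - 1) * h + h = 1" using N h by (simp add: of_nat_diff algebra_simps)
      ultimately have "\<bar>(u (mesh N N) - v N) + \<alpha>1 * z (N - 1)\<bar> \<le> \<alpha>1 * (Hy * h powr \<beta>)"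
        using Uy[of "N - 1" 1] N h assms(9) by (simp add: abs_mult mult_left_mono)
      also have "\<dots> \<le> R * real N powr (- \<beta>)"
        unfolding hN mult.assoc[symmetric] using Ct nonneg by (intro mult_right_mono) (auto simp: R_def)
      finally show ?thesis .
    qed
    show ?thesis
      unfolding error_system_def z_def[symmetric]
      by (intro exI[of _ "\<lambda>j. b (mesh N j)"] exI[of _ "\<lambda>j. c (mesh N j)"] exI[of _ r],
          unfold Let_def, rule conjI[OF _ conjI[OF left right]], intro allI impI, rule int)
  qed
  have G2: "0 < Gamma (2 - \<beta>)" using \<beta> by (intro Gamma_real_pos) auto
  obtain C where C: "\<forall>N\<ge>1. \<forall>e. error_system \<beta> (Gamma (2 - \<beta>)) \<alpha>0 \<alpha>1 Mb Mc R N e \<longrightarrow>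
      (\<forall>j\<le>N. \<bar>e j\<bar> \<le> C * real N powr (- \<beta>))"
    using discrete_stability[OF \<beta> \<alpha>0 assms(9) Mb(1) Mc(1) R G2] by blast
  show ?thesis
  proof (intro exI[of _ C] allI impI)
    fix N :: nat and v assume N: "1 \<le> N" and v: "\<forall>j\<le>N. fd_op \<delta> b c \<alpha>0 \<alpha>1 N v j = fd_rhs f \<gamma>0 \<gamma>1 N j"
    have "real N powr (- \<beta>) = (1 / real N) powr (\<delta> - 1)"
      using N by (simp add: \<delta>\<beta> powr_divide powr_minus field_simps)
    moreover have "\<bar>u (mesh N j) - v j\<bar> \<le> C * real N powr (- \<beta>)" if "j \<le> N" for j
      using C[rule_format, OF N sys[OF N] that] v by blast
    ultimately show "(MAX j\<in>{0..N}. \<bar>u (mesh N j) - v j\<bar>) \<le> C * (1 / real N) powr (\<delta> - 1)"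
      by (subst Max_le_iff) auto
  qed
qed

end
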